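(* Let $d\ge2$ and fix $p\in(0,1)$. There exists some constant $\tilde\mu=\tilde\mu(p)>0$ such that for all $\mu>\tilde\mu$ the speed $\lambda\mapsto v_{\mu,p}(\lambda)$ of the $\lambda$-biased random walk on dynamical percolation on $\mathbb{Z}^d$ with parameters $\mu$ and $p$ is strictly increasing in $\lambda>0$.
   Context: Dynamical percolation on $\mathbb{Z}^d$ (nearest-neighbour graph with edge set $E$) with parameters $\mu>0$ and $p\in(0,1)$ is the Markov process $(\eta_t)_{t\ge0}$ on $\{0,1\}^{E}$ in which each edge carries an independent Poisson process of rate $\mu$; at each point of the process of $e$, the state of $e$ is refreshed: $\eta_t(e)=1$ ($e$ open) with probability $p$ and $\eta_t(e)=0$ ($e$ closed) with probability $1-p$, independently of everything else. The initial state $\eta_0$ has the Bernoulli-$p$ product law $\pi_p$. For $\lambda>0$ put $Z_\lambda=e^{\lambda}+e^{-\lambda}+2d-2$. The $\lambda$-biased random walk $(X_t)_{t\ge0}$ on dynamical percolation starts at $X_0=0$ and carries an independent rate $1$ Poisson clock. When the clock rings at time $t$ and the walker is at $x$, it chooses the neighbour $x+\mathrm{e}_1$ with probability $e^{\lambda}/Z_\lambda$, $x-\mathrm{e}_1$ with probability $e^{-\lambda}/Z_\lambda$, and each $x\pm\mathrm{e}_i$ ($i=2,\dots,d$) with probability $1/Z_\lambda$. If $y$ is the chosen neighbour and $\eta_t(\{x,y\})=1$, the walker moves to $y$; otherwise it stays at $x$. The speed $v_{\mu,p}(\lambda)$ is the deterministic number such that almost surely $\lim_{t\to\infty}X_t/t=(v_{\mu,p}(\lambda),0,\dots,0)$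 (this limit exists). The dimension $d$ is fixed throughout, so constants may depend on $d$. *)

theory Defs
  imports "HOL-Probability.Probability"
begin

text \<open>
  The lattice is \<open>int ^ 'd\<close> with \<open>d = CARD('d)\<close>.  An index type carries no distinguished
  first element, so the coordinate \<open>a :: 'd\<close> of the bias direction is an explicit parameter:
  \<open>axis a 1\<close> is the vector \<open>e_1\<close>.
\<close>

definition lattice_edges :: "(int ^ 'd::finite) set set" where
  "lattice_edges = {{x, y} | x y. (\<Sum>i\<in>UNIV. \<bar>x $ i - y $ i\<bar>) = 1}"

text \<open>A direction \<open>(i, True)\<close> stands for \<open>+ e_i\<close> and \<open>(i, False)\<close> for \<open>- e_i\<close>.\<close>

fun unit_step :: "'d \<times> bool \<Rightarrow> int ^ 'd::finite" where
  "unit_step (i, s) = axis i (if s then 1 else - 1)"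

lemma unit_step_edge: "{x, x + unit_step u} \<in> lattice_edges"
proof -
  obtain i s where u: "u = (i, s)" by (cases u)
  have "(\<Sum>j\<in>UNIV. \<bar>x $ j - (x + unit_step u) $ j\<bar>) = (\<Sum>j\<in>UNIV. if j = i then 1 else 0)"
    by (rule sum.cong) (auto simp: u axis_def)
  then have "(\<Sum>j\<in>UNIV. \<bar>x $ j - (x + unit_step u) $ j\<bar>) = 1"
    by simp
  then show ?thesis
    unfolding lattice_edges_def by blast
qed

definition bias_normalizer :: "'d::finite itself \<Rightarrow> real \<Rightarrow> real" where
  "bias_normalizer _ l = exp l + exp (- l) + 2 * real CARD('d) - 2"

definition direction_weight :: "'d::finite \<Rightarrow> real \<Rightarrow> 'd \<times> bool \<Rightarrow> real" where
  "direction_weight a l u =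
     (if u = (a, True) then exp l else if u = (a, False) then exp (- l) else 1)
       / bias_normalizer TYPE('d) l"

definition direction_pmf :: "'d::finite \<Rightarrow> real \<Rightarrow> ('d \<times> bool) pmf" where
  "direction_pmf a l = embed_pmf (direction_weight a l)"

lemma bias_normalizer_pos: "bias_normalizer TYPE('d::finite) l > 0"
proof -
  have "CARD('d) \<ge> 1"
    by (simp add: Suc_leI)
  then have "real CARD('d) \<ge> 1"
    by linarith
  then show ?thesis
    unfolding bias_normalizer_def using exp_gt_zero[of l] exp_gt_zero[of "- l"] by linarith
qed

lemma sum_direction_weight: "(\<Sum>u\<in>UNIV. direction_weight a l u) = 1"
  for a :: "'d::finite"
proof -
  let ?f = "\<lambda>u::'d \<times> bool. if u = (a, True) then exp l else if u = (a, False) then exp (- l) else 1"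
  let ?A = "{(a, True), (a, False)}"
  have "card ?A \<le> CARD('d \<times> bool)"
    by (rule card_mono) auto
  then have "real (card (UNIV - ?A)) = 2 * real CARD('d) - 2"
    by (simp add: card_Diff_subset)
  moreover have "sum ?f UNIV = sum ?f ?A + sum ?f (UNIV - ?A)"
    by (subst sum.subset_diff[of ?A]) auto
  moreover have "sum ?f (UNIV - ?A) = real (card (UNIV - ?A))"
    by (subst sum.cong[OF refl, where h = "\<lambda>_. 1"]) auto
  ultimately have "sum ?f UNIV = bias_normalizer TYPE('d) l"
    by (simp add: bias_normalizer_def)
  then show ?thesis
    using bias_normalizer_pos[of l, where 'd = 'd]
    by (simp add: direction_weight_def flip: sum_divide_distrib)
qed

lemma pmf_direction_pmf: "pmf (direction_pmf a l) u = direction_weight a l u"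
proof -
  have nonneg: "direction_weight a l u \<ge> 0" for u
    using bias_normalizer_pos[of l, where 'd = 'a] by (simp add: direction_weight_def)
  have "(\<integral>\<^sup>+u. ennreal (direction_weight a l u) \<partial>count_space UNIV)
      = (\<Sum>u\<in>UNIV. ennreal (direction_weight a l u))"
    by (rule nn_integral_count_space_finite) simp
  also have "\<dots> = 1"
    using nonneg by (simp add: sum_direction_weight)
  finally show ?thesis
    unfolding direction_pmf_def by (intro pmf_embed_pmf nonneg)
qed

text \<open>
  Graphical construction.  A sample consists of four independent families of independent
  variables: the waiting times between consecutive points of the Poisson process of each edge;
  the states of each edge, entry \<open>0\<close> being its initial state and entry \<open>n \<ge> 1\<close> the outcome of
  its \<open>n\<close>-th refresh; the waiting times of the walker's clock; and the directions chosen by the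
  walker at the successive rings.
\<close>

type_synonym 'd sample =
  "((int ^ 'd) set \<times> nat \<Rightarrow> real) \<times> ((int ^ 'd) set \<times> nat \<Rightarrow> bool) \<times>
   (nat \<Rightarrow> real) \<times> (nat \<Rightarrow> 'd \<times> bool)"

definition waiting_time :: "real \<Rightarrow> real measure" where
  "waiting_time r = density lborel (exponential_density r)"

definition walk_space :: "'d::finite \<Rightarrow> real \<Rightarrow> real \<Rightarrow> real \<Rightarrow> 'd sample measure" where
  "walk_space a mu p l =
     (\<Pi>\<^sub>M i\<in>lattice_edges \<times> UNIV. waiting_time mu) \<Otimes>\<^sub>M
     (\<Pi>\<^sub>M i\<in>lattice_edges \<times> UNIV. measure_pmf (bernoulli_pmf p)) \<Otimes>\<^sub>M
     (\<Pi>\<^sub>M n\<in>UNIV. waiting_time 1) \<Otimes>\<^sub>M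
     (\<Pi>\<^sub>M n\<in>UNIV. measure_pmf (direction_pmf a l))"

lemma prob_space_walk_space: "mu > 0 \<Longrightarrow> prob_space (walk_space a mu p l)"
  unfolding walk_space_def waiting_time_def
  by (intro prob_space_pair prob_space_PiM prob_space_exponential_density
      prob_space_measure_pmf) simp_all

text \<open>
  The point of index \<open>n\<close>, counting from \<open>0\<close>, of a point process with waiting times \<open>w\<close>, and the
  number of its points in \<open>[0, t]\<close>.  The set counted is almost surely finite for the processes
  used here.
\<close>

definition arrival_time :: "(nat \<Rightarrow> real) \<Rightarrow> nat \<Rightarrow> real" where
  "arrival_time w n = (\<Sum>k\<le>n. w k)"

definition num_arrivals :: "(nat \<Rightarrow> real) \<Rightarrow> real \<Rightarrow> nat" where
  "num_arrivals w t = card {n. arrival_time w n \<le> t}"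

definition edge_open :: "'d::finite sample \<Rightarrow> real \<Rightarrow> (int ^ 'd) set \<Rightarrow> bool" where
  "edge_open = (\<lambda>(g, b, w, u) t e. b (e, num_arrivals (\<lambda>n. g (e, n)) t))"

primrec position_after :: "'d::finite sample \<Rightarrow> nat \<Rightarrow> int ^ 'd" where
  "position_after \<omega> 0 = 0"
| "position_after \<omega> (Suc n) =
     (let (g, b, w, u) = \<omega>;
          x = position_after \<omega> n;
          y = x + unit_step (u n)
      in if edge_open \<omega> (arrival_time w n) {x, y} then y else x)"

definition walker :: "'d::finite sample \<Rightarrow> real \<Rightarrow> int ^ 'd" where
  "walker \<omega> t = (let (g, b, w, u) = \<omega> in position_after \<omega> (num_arrivals w t))"

definition has_speed :: "'d::finite \<Rightarrow> real \<Rightarrow> real \<Rightarrow> real \<Rightarrow> real \<Rightarrow> bool" where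
  "has_speed a mu p l v \<longleftrightarrow>
     (AE \<omega> in walk_space a mu p l.
        ((\<lambda>t. (1 / t) *\<^sub>R (\<chi> i. real_of_int (walker \<omega> t $ i))) \<longlongrightarrow> axis a v) at_top)"

definition speed :: "'d::finite \<Rightarrow> real \<Rightarrow> real \<Rightarrow> real \<Rightarrow> real" where
  "speed a mu p l = (THE v. has_speed a mu p l v)"

lemma speed_eqI:
  assumes "mu > 0" and v: "has_speed a mu p l v"
  shows "speed a mu p l = v"
  unfolding speed_def
proof (rule the_equality)
  show "has_speed a mu p l v" by (fact v)
next
  fix v' assume v': "has_speed a mu p l v'"
  interpret prob_space "walk_space a mu p l"
    by (rule prob_space_walk_space) fact
  have "AE \<omega> in walk_space a mu p l. (axis a v' :: real ^ 'a) = axis a v"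
    using v[unfolded has_speed_def] v'[unfolded has_speed_def]
    by eventually_elim (rule tendsto_unique[OF trivial_limit_at_top_linorder])
  then have "(axis a v' :: real ^ 'a) = axis a v"
    by simp
  then show "v' = v"
    by (metis axis_nth)
qed

end

theory Submission
  imports Defs "HOL-Library.Discrete_Functions"
begin

text \<open>
  Give every ring of the walker a token which remembers the state of the examined edge and which
  survives a waiting time \<open>w\<close> of the clock with probability \<open>exp (- mu * w)\<close>, independently of the
  other tokens.  An edge keeps its state between two examinations with the probability that the
  token of the earlier one survives, so the walk may copy the state when that token is alive and
  draw a fresh one otherwise.  When no token is alive the walk regenerates.  The number of alive
  tokens does not depend on the directions, hence neither does the law of the length of a tour, and
  this length has a tail of order \<open>(2 / (1 + mu)) ^ k\<close>.

  The speed is the mean displacement of a tour divided by its mean length.  Raising the bias from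
  \<open>l\<close> to \<open>l'\<close> changes the law of a single direction, in the l1 norm, by at most twice the increase of
  its mean.  A tour of length one, which has probability close to one, gains \<open>p\<close> times this
  increase; the effect on longer tours is smaller when \<open>mu\<close> is large.

  Existence of the speed: a renewal inequality bounds the second moment of the centred walk
  linearly in the number of rings, and Chebyshev's inequality along the squares suffices since the
  position plus the number of rings is nondecreasing.
\<close>

section \<open>Histories and tokens\<close>

text \<open>A refreshed edge has a Bernoulli state whatever happened before, so the past acts only
  through edges not refreshed since their last examination; tokens make this dependence visible.
  They are no part of the sample space: operators on functions of finite lists integrate them out,
  and only the law of the sequence of rings is matched with the graphical construction. Tokens of
  different rings decay during the same waiting times, so they are independent only given the clock,
  and the matching is done conditionally on it. A ring gets a token even if it examines an edge
  again, and the older token is kept. If it were discarded, the number of tokens would depend on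
  returns of the walk, hence on the directions, and the tours of two biases would differ in length.
  The error caused by longer tours is measured by the same increase of the mean that produces the
  gain of the shortest ones. This makes the threshold on \<open>mu\<close> independent of both
  biases, however close or large they are.\<close>

text \<open>
  Histories list the rings, newest first; the \<open>i\<close>-th ring, counted from \<open>0\<close>, is the one followed by
  a tail of length \<open>i\<close>.  A ring consists of the chosen direction and the state found; in the lists of
  pairs below the second component says whether the token of the ring is alive.  The token of an
  edge which is examined again is not removed but becomes irrelevant.
\<close>

type_synonym 'd ring = "('d \<times> bool) \<times> bool"

definition displacement :: "'d::finite ring \<Rightarrow> int ^ 'd" where
  "displacement y = (if snd y then unit_step (fst y) else 0)"

definition endpoint :: "'d::finite ring list \<Rightarrow> int ^ 'd" where
  "endpoint ys = sum_list (map displacement ys)"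

definition examined_edge :: "'d::finite ring list \<Rightarrow> 'd \<times> bool \<Rightarrow> (int ^ 'd) set" where
  "examined_edge ys u = {endpoint ys, endpoint ys + unit_step u}"

primrec last_visit :: "'d::finite ring list \<Rightarrow> (int ^ 'd) set \<Rightarrow> (nat \<times> bool) option" where
  "last_visit [] e = None"
| "last_visit (y # ys) e =
     (if e = examined_edge ys (fst y) then Some (length ys, snd y) else last_visit ys e)"

primrec alive :: "('y \<times> bool) list \<Rightarrow> nat set" where
  "alive [] = {}"
| "alive (z # h) = (if snd z then insert (length h) (alive h) else alive h)"

text \<open>The expectation of \<open>F\<close> after each alive token has been kept with
  probability \<open>q\<close>, independently of the others; dead tokens stay dead and the rings are
  untouched. The recursion spares a probability space for the flags.\<close>

primrec thin :: "real \<Rightarrow> (('y \<times> bool) list \<Rightarrow> real) \<Rightarrow> ('y \<times> bool) list \<Rightarrow> real" where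
  "thin q F [] = F []"
| "thin q F (z # h) =
     (if snd z
      then q * thin q (\<lambda>h'. F ((fst z, True) # h')) h
         + (1 - q) * thin q (\<lambda>h'. F ((fst z, False) # h')) h
      else thin q (\<lambda>h'. F ((fst z, False) # h')) h)"

lemma endpoint_Nil [simp]: "endpoint [] = 0"
  and endpoint_Cons [simp]: "endpoint (y # ys) = displacement y + endpoint ys"
  and endpoint_append [simp]: "endpoint (ys @ zs) = endpoint ys + endpoint zs"
  by (simp_all add: endpoint_def)

lemma alive_bound: "alive h \<subseteq> {..<length h}"
  by (induction h) (auto simp: less_Suc_eq)

lemma finite_alive [simp]: "finite (alive h)"
  using alive_bound finite_subset by blast

lemma thin_add: "thin q (\<lambda>h. F h + G h) h = thin q F h + thin q G h"
  by (induction h arbitrary: F G) (simp_all add: algebra_simps)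

lemma thin_cmult: "thin q (\<lambda>h. c * F h) h = c * thin q F h"
  by (induction h arbitrary: F) (simp_all add: algebra_simps)

lemma thin_cong:
  "(\<And>h'. map fst h' = map fst h \<Longrightarrow> F h' = G h') \<Longrightarrow> thin q F h = thin q G h"
proof (induction h arbitrary: F G)
  case (Cons z h)
  have "thin q (\<lambda>h'. F ((fst z, b) # h')) h = thin q (\<lambda>h'. G ((fst z, b) # h')) h" for b
    by (rule Cons.IH) (simp add: Cons.prems)
  then show ?case by simp
qed simp

lemma thin_const [simp]: "thin q (\<lambda>h. c) h = c"
  by (induction h) (simp_all add: algebra_simps)

lemma thin_mono:
  assumes "0 \<le> q" "q \<le> 1"
  shows "(\<And>h'. map fst h' = map fst h \<Longrightarrow> F h' \<le> G h') \<Longrightarrow> thin q F h \<le> thin q G h"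
proof (induction h arbitrary: F G)
  case (Cons z h)
  have "thin q (\<lambda>h'. F ((fst z, b) # h')) h \<le> thin q (\<lambda>h'. G ((fst z, b) # h')) h" for b
    by (rule Cons.IH) (simp add: Cons.prems)
  then show ?case using assms by (auto intro!: add_mono mult_left_mono)
qed simp

lemma thin_card_alive: "thin q (\<lambda>h. real (card (alive h))) h = q * real (card (alive h))"
proof (induction h)
  case (Cons z h)
  have *: "thin q (\<lambda>h'. real (card (alive ((fst z, True) # h')))) h
      = thin q (\<lambda>h'. 1 + real (card (alive h'))) h"
    by (rule thin_cong) (use alive_bound in \<open>force simp: card_insert_if\<close>)
  have "length h \<notin> alive h" using alive_bound[of h] by auto
  then show ?case
    using Cons * by (simp add: thin_add algebra_simps)
qed simp

text \<open>Inclusion events are the right test events: thinning multiplies them by a power of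
  \<open>q\<close>, and consulting one more token merely enlarges \<open>B\<close>.\<close>

lemma thin_subset_alive:
  assumes "finite B"
  shows "thin q (\<lambda>h. of_bool (B \<subseteq> alive h)) h = of_bool (B \<subseteq> alive h) * q ^ card B"
  using assms
proof (induction h arbitrary: B)
  case Nil
  then show ?case by auto
next
  case (Cons z h)
  let ?n = "length h"
  have n: "?n \<notin> alive h'" if "map fst h' = map fst h" for h' :: "('a \<times> bool) list"
    using alive_bound[of h'] map_eq_imp_length_eq[OF that] by auto
  have T: "thin q (\<lambda>h'. of_bool (B \<subseteq> alive ((fst z, True) # h'))) h
      = thin q (\<lambda>h'. of_bool (B - {?n} \<subseteq> alive h')) h"
    by (rule thin_cong) (auto simp: dest!: map_eq_imp_length_eq)
  have F: "thin q (\<lambda>h'. of_bool (B \<subseteq> alive ((fst z, False) # h'))) h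
      = thin q (\<lambda>h'. of_bool (B \<subseteq> alive h')) h"
    by simp
  have c: "card B = Suc (card (B - {?n}))" if "?n \<in> B"
    using that Cons.prems by (metis card.remove)
  have S: "(B \<subseteq> alive (z # h)) = (if snd z then B - {?n} \<subseteq> alive h else B \<subseteq> alive h)"
    by auto
  have "thin q (\<lambda>h. of_bool (B \<subseteq> alive h)) (z # h)
      = (if snd z then q * (of_bool (B - {?n} \<subseteq> alive h) * q ^ card (B - {?n}))
           + (1 - q) * (of_bool (B \<subseteq> alive h) * q ^ card B)
         else of_bool (B \<subseteq> alive h) * q ^ card B)"
    unfolding thin.simps T F using Cons.prems by (simp only: Cons.IH finite_Diff)
  also have "\<dots> = of_bool (B \<subseteq> alive (z # h)) * q ^ card B"
  proof (cases "?n \<in> B")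
    \<comment> \<open>The newest token is required, so the branch in which it dies contributes
      nothing: its index cannot occur in \<open>alive h\<close>.\<close>
    case True
    then have "\<not> B \<subseteq> alive h" using n[of h] by auto
    then show ?thesis unfolding S c[OF True] by (simp add: c[OF True])
  next
    case False
    then have "B - {?n} = B" by auto
    then show ?thesis unfolding S by (simp only:) (simp add: algebra_simps)
  qed
  finally show ?case .
qed

text \<open>Thinning cannot alter a list without alive tokens, so a regenerated past behaves as a
  constant.\<close>

lemma thin_append:
  "alive h0 = {} \<Longrightarrow> thin q F (h @ h0) = thin q (\<lambda>h. F (h @ h0)) h"
proof (induction h arbitrary: F)
  case Nil
  then show ?case
  proof (induction h0 arbitrary: F)
    case (Cons z h)
    from Cons.prems have z: "snd z = False" "alive h = {}"
      by (auto split: if_splits)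
    then have "(fst z, False) = z" by (metis prod.collapse)
    then show ?case using Cons.IH[OF z(2), of "\<lambda>h'. F (z # h')"] z by simp
  qed simp
qed simp

lemma thin_map:
  "thin q F (map (map_prod f id) h) = thin q (\<lambda>h. F (map (map_prod f id) h)) h"
  by (induction h arbitrary: F) simp_all

lemma continuous_on_thin: "continuous_on S (\<lambda>q. thin q F h)"
proof (induction h arbitrary: F)
  case (Cons z h)
  then show ?case by (cases "snd z") (auto intro!: continuous_intros)
qed simp

lemma thin_measurable [measurable]: "(\<lambda>q. thin q F h) \<in> borel_measurable borel"
  by (rule borel_measurable_continuous_onI) (rule continuous_on_thin)

text \<open>Continuity on the compact interval bounds the value for an arbitrary \<open>F\<close>;
  hence integrals over the waiting time exist without any growth condition on
  \<open>F\<close>.\<close>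

lemma thin_bounded: "\<exists>C. \<forall>q\<in>{0..1}. \<bar>thin q F h\<bar> \<le> C"
proof -
  have "compact ((\<lambda>q. thin q F h) ` {0..1})"
    by (intro compact_continuous_image continuous_on_thin) simp
  then have "bounded ((\<lambda>q. thin q F h) ` {0..1})" by (rule compact_imp_bounded)
  then show ?thesis unfolding bounded_iff by (metis imageI real_norm_def)
qed

section \<open>Averaging over the waiting time between two rings\<close>

lemma prob_space_waiting_time: "r > 0 \<Longrightarrow> prob_space (waiting_time r)"
  unfolding waiting_time_def by (rule prob_space_exponential_density)

lemma sets_waiting_time [simp, measurable_cong]: "sets (waiting_time r) = sets borel"
  and space_waiting_time [simp]: "space (waiting_time r) = UNIV"
  by (simp_all add: waiting_time_def)

lemma AE_waiting_time_pos: "r > 0 \<Longrightarrow> AE x in waiting_time r. x > 0"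
proof -
  assume "r > 0"
  have "AE x in lborel. x \<noteq> (0::real)"
    by (rule AE_lborel_singleton)
  then have "AE x in lborel. ennreal (exponential_density r x) > 0 \<longrightarrow> x > 0"
    by eventually_elim (auto simp: exponential_density_def)
  then show ?thesis
    unfolding waiting_time_def by (subst AE_density) (auto simp: )
qed

text \<open>One waiting time thins all tokens at once, which correlates them; this is why the
  average is taken outside \<open>thin\<close>.\<close>

definition gap :: "real \<Rightarrow> (('y \<times> bool) list \<Rightarrow> real) \<Rightarrow> ('y \<times> bool) list \<Rightarrow> real" where
  "gap mu F h = (\<integral>r. thin (exp (- (mu * r))) F h \<partial>waiting_time 1)"

lemma integrable_thin:
  assumes "mu > 0"
  shows "integrable (waiting_time 1) (\<lambda>r. thin (exp (- (mu * r))) F h)"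
proof -
  interpret prob_space "waiting_time 1" by (rule prob_space_waiting_time) simp
  obtain C where C: "\<And>q. q \<in> {0..1} \<Longrightarrow> \<bar>thin q F h\<bar> \<le> C" using thin_bounded by metis
  show ?thesis
  proof (rule integrable_const_bound)
    show "AE x in waiting_time 1. norm (thin (exp (- (mu * x))) F h) \<le> C"
      using AE_waiting_time_pos[OF zero_less_one]
      by eventually_elim (use assms in \<open>auto intro!: C\<close>)
  qed simp
qed

lemma gap_add: "mu > 0 \<Longrightarrow> gap mu (\<lambda>h. F h + G h) h = gap mu F h + gap mu G h"
  by (simp add: gap_def thin_add integrable_thin)

lemma gap_cmult: "gap mu (\<lambda>h. c * F h) h = c * gap mu F h"
  by (simp add: gap_def thin_cmult)

lemma gap_const [simp]: "gap mu (\<lambda>h. c) h = c"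
proof -
  interpret prob_space "waiting_time 1" by (rule prob_space_waiting_time) simp
  show ?thesis using prob_space by (simp add: gap_def)
qed

lemma gap_mono:
  assumes "mu > 0" "\<And>h'. map fst h' = map fst h \<Longrightarrow> F h' \<le> G h'"
  shows "gap mu F h \<le> gap mu G h"
  unfolding gap_def
proof (rule integral_mono_AE[OF integrable_thin integrable_thin])
  show "AE r in waiting_time 1. thin (exp (- (mu * r))) F h \<le> thin (exp (- (mu * r))) G h"
    using AE_waiting_time_pos[OF zero_less_one]
    by eventually_elim (use assms in \<open>auto intro!: thin_mono\<close>)
qed (use assms in auto)

lemma gap_append:
  "alive h0 = {} \<Longrightarrow> gap mu F (h @ h0) = gap mu (\<lambda>h. F (h @ h0)) h"
  by (simp add: gap_def thin_append)

lemma gap_map: "gap mu F (map (map_prod f id) h) = gap mu (\<lambda>h. F (map (map_prod f id) h)) h"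
  by (simp add: gap_def thin_map)

text \<open>Multiplied by the density of rate 1, the integrand is \<open>1 / (1 + mu)\<close> times
  the density of rate \<open>1 + mu\<close>.\<close>

lemma exp_waiting_time:
  assumes "mu \<ge> 0"
  shows "(\<integral>r. exp (- (mu * r)) \<partial>waiting_time 1) = 1 / (1 + mu)"
proof -
  let ?c = "1 + mu"
  interpret P: prob_space "density lborel (exponential_density ?c)"
    using assms by (intro prob_space_exponential_density) simp
  have "(\<integral>r. exp (- (mu * r)) \<partial>waiting_time 1)
      = (\<integral>r. exponential_density 1 r * exp (- (mu * r)) \<partial>lborel)"
    unfolding waiting_time_def by (subst integral_density) (auto simp: exponential_density_def)
  also have "\<dots> = (\<integral>r. (1 / ?c) * (exponential_density ?c r * 1) \<partial>lborel)"
    using assms by (intro Bochner_Integration.integral_cong)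
      (auto simp: exponential_density_def distrib_right mult_exp_exp exp_minus
        field_simps simp flip: exp_add)
  also have "\<dots> = (1 / ?c) * (\<integral>r. 1 \<partial>density lborel (exponential_density ?c))"
    using assms by (subst integral_density) (auto simp: exponential_density_def)
  also have "\<dots> = 1 / ?c" using P.prob_space by simp
  finally show ?thesis .
qed

lemma gap_card_alive:
  "mu > 0 \<Longrightarrow> gap mu (\<lambda>h. real (card (alive h))) h = real (card (alive h)) / (1 + mu)"
  using exp_waiting_time[of mu] by (simp add: gap_def thin_card_alive)

section \<open>Regeneration\<close>

definition status_prob :: "real \<Rightarrow> bool \<Rightarrow> real" where
  "status_prob p s = (if s then p else 1 - p)"

definition examine_prob ::
  "real \<Rightarrow> ('d::finite ring \<times> bool) list \<Rightarrow> 'd \<times> bool \<Rightarrow> bool \<Rightarrow> real" where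
  "examine_prob p h u s =
     (case last_visit (map fst h) (examined_edge (map fst h) u) of
        None \<Rightarrow> status_prob p s
      | Some (i, s') \<Rightarrow> if i \<in> alive h then of_bool (s = s') else status_prob p s)"

text \<open>Transition operator of one ring followed by the waiting time until the next one; the new
  token is alive when this waiting time begins. The waiting time before the first ring does not
  occur, as there is no token to be thinned by it.\<close>

definition ring_op ::
  "real \<Rightarrow> real \<Rightarrow> ('d::finite \<times> bool \<Rightarrow> real) \<Rightarrow> (('d ring \<times> bool) list \<Rightarrow> real)
     \<Rightarrow> ('d ring \<times> bool) list \<Rightarrow> real" where
  "ring_op mu p W F h =
     (\<Sum>u\<in>UNIV. W u * (\<Sum>s\<in>UNIV. examine_prob p h u s * gap mu F (((u, s), True) # h)))"

definition live_op where
  "live_op mu p W F = ring_op mu p W (\<lambda>h. if alive h = {} then 0 else F h)"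

definition dead_op where
  "dead_op mu p W F = ring_op mu p W (\<lambda>h. if alive h = {} then F h else 0)"

text \<open>
  \<open>tour mu p W k F\<close> is the expectation of \<open>F\<close> over excursions, that is over histories whose
  first regeneration (no alive token) comes after exactly \<open>k + 1\<close> rings.
\<close>

definition tour where
  "tour mu p W k F = (live_op mu p W ^^ k) (dead_op mu p W F) []"

text \<open>Lyapunov function for \<open>live_op\<close>. It is at least 1, so it dominates
  constants, and it is a multiple of the number of tokens, up to a factor, as soon as one is
  alive.\<close>

definition alive_weight :: "('y \<times> bool) list \<Rightarrow> real" where
  "alive_weight h = real (card (alive h)) + 1"

lemma alive_weight_ge_1: "alive_weight h \<ge> 1"
  and alive_weight_Nil [simp]: "alive_weight [] = 1"
  by (simp_all add: alive_weight_def)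

lemma last_visit_less: "last_visit ys e = Some (i, s) \<Longrightarrow> i < length ys"
  by (induction ys) (auto split: if_splits)

lemma examined_edge_append:
  "examined_edge (ys @ zs) u = (+) (endpoint zs) ` examined_edge ys u"
  by (simp add: examined_edge_def algebra_simps)

text \<open>Edges have absolute positions, so the recent part \<open>ys\<close>, read as a history
  of its own, is shifted by the endpoint of the older part \<open>zs\<close>; its indices are
  shifted by \<open>length zs\<close>.\<close>

lemma last_visit_append:
  "last_visit (ys @ zs) ((+) (endpoint zs) ` e) =
     (case last_visit ys e of
        None \<Rightarrow> last_visit zs ((+) (endpoint zs) ` e)
      | Some (i, s) \<Rightarrow> Some (i + length zs, s))"
  by (induction ys) (simp_all add: examined_edge_append inj_image_eq_iff)

lemma alive_append: "alive (h @ h0) = (+) (length h0) ` alive h \<union> alive h0"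
  by (induction h) (auto simp: add.commute)

text \<open>This is the regeneration property. The rings of \<open>h0\<close> act only through their
  tokens; when these are all dead, an edge known from \<open>h0\<close> alone has the same law as an
  edge never examined.\<close>

lemma examine_prob_append:
  assumes "alive h0 = {}"
  shows "examine_prob p (h @ h0) u s = examine_prob p h u s"
  using assms last_visit_less[of "map fst h0"]
  by (fastforce simp: examine_prob_def examined_edge_append last_visit_append alive_append
      image_iff split: option.split)

locale ring_params =
  fixes mu p :: real
  assumes mu_pos: "0 < mu" and p_pos: "0 < p" and p_less_1: "p < 1"
begin

text \<open>The mean survival probability of a token over one waiting time is
  \<open>1 / (1 + mu)\<close>; the factor 2 comes from \<open>n + 1 \<le> 2 * n\<close> for a number
  \<open>n \<ge> 1\<close> of alive tokens.\<close>

definition decay :: real where "decay = 2 / (1 + mu)"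

lemma decay_pos: "0 < decay"
  using mu_pos by (simp add: decay_def)

lemma examine_prob_nonneg: "examine_prob p h u s \<ge> 0"
  using p_pos p_less_1 by (auto simp: examine_prob_def status_prob_def split: option.split)

lemma sum_examine_prob: "(\<Sum>s\<in>UNIV. examine_prob p h u s) = 1"
  by (auto simp: examine_prob_def status_prob_def UNIV_bool split: option.split)

lemma sum_examine_bound:
  assumes "\<And>s. \<bar>G s\<bar> \<le> C"
  shows "\<bar>\<Sum>s\<in>UNIV. examine_prob p h u s * G s\<bar> \<le> C"
proof -
  have "\<bar>\<Sum>s\<in>UNIV. examine_prob p h u s * G s\<bar> \<le> (\<Sum>s\<in>UNIV. examine_prob p h u s * C)"
    by (rule order_trans[OF sum_abs sum_mono])
      (auto simp: abs_mult examine_prob_nonneg intro!: mult_left_mono assms)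
  then show ?thesis by (simp add: sum_examine_prob flip: sum_distrib_right)
qed

lemma gap_bound:
  assumes "\<And>h'. length h' = length h \<Longrightarrow> \<bar>F h'\<bar> \<le> G h'"
  shows "\<bar>gap mu F h\<bar> \<le> gap mu G h"
proof -
  have le: "F h' \<le> G h'" "- G h' \<le> F h'" if "map fst h' = map fst h" for h'
    using assms[OF map_eq_imp_length_eq[OF that]] by auto
  have "gap mu F h \<le> gap mu G h"
    using mu_pos le by (intro gap_mono)
  moreover have "gap mu (\<lambda>h. (-1) * G h) h \<le> gap mu F h"
    using mu_pos le by (intro gap_mono) auto
  ultimately show ?thesis unfolding gap_cmult by linarith
qed

text \<open>On the event that some token survives, \<open>alive_weight\<close> is at most twice the
  number of tokens, and the mean of that number contracts by \<open>1 / (1 + mu)\<close>. Before the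
  waiting time the number equals \<open>alive_weight h\<close>, because the token just created
  supplies the additional 1.\<close>

lemma gap_live_bound:
  fixes F :: "('y \<times> bool) list \<Rightarrow> real"
  assumes "C \<ge> 0" and F: "\<And>h'. length h' = Suc (length h) \<Longrightarrow> \<bar>F h'\<bar> \<le> C * alive_weight h'"
  shows "\<bar>gap mu (\<lambda>h. if alive h = {} then 0 else F h) ((z, True) # h)\<bar>
    \<le> decay * C * alive_weight h"
proof -
  have card_alive: "card (alive h') \<ge> 1" if "alive h' \<noteq> {}" for h' :: "('y \<times> bool) list"
    using that by (simp add: Suc_leI card_gt_0_iff)
  have "\<bar>gap mu (\<lambda>h. if alive h = {} then 0 else F h) ((z, True) # h)\<bar>
      \<le> gap mu (\<lambda>h. (2 * C) * real (card (alive h))) ((z, True) # h)"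
  proof (rule gap_bound)
    fix h' :: "('y \<times> bool) list"
    assume l: "length h' = length ((z, True) # h)"
    have "C * alive_weight h' \<le> C * (2 * real (card (alive h')))" if "alive h' \<noteq> {}"
      using card_alive[OF that] \<open>C \<ge> 0\<close> by (intro mult_left_mono) (auto simp: alive_weight_def)
    then show "\<bar>if alive h' = {} then 0 else F h'\<bar> \<le> 2 * C * real (card (alive h'))"
      using F[of h'] l by (cases "alive h' = {}") (simp_all add: mult.left_commute mult.assoc)
  qed
  also have "\<dots> = decay * C * real (card (alive ((z, True) # h)))"
    using mu_pos by (simp add: gap_cmult gap_card_alive decay_def)
  also have "real (card (alive ((z, True) # h))) = alive_weight h"
  proof -
    have "length h \<notin> alive h" using alive_bound[of h] by auto
    then show ?thesis by (simp add: alive_weight_def)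
  qed
  finally show ?thesis .
qed

lemma gap_dead_bound:
  assumes "C \<ge> 0" and "\<And>h'. length h' = Suc (length h) \<Longrightarrow> \<bar>F h'\<bar> \<le> C"
  shows "\<bar>gap mu (\<lambda>h. if alive h = {} then F h else 0) (z # h)\<bar> \<le> C"
  using gap_bound[of "z # h" "\<lambda>h. if alive h = {} then F h else 0" "\<lambda>h. C"] assms
  by (simp add: gap_const)

end

section \<open>Powers of the operators and renewal decomposition\<close>

locale ring_walk = ring_params +
  fixes W :: "'d::finite \<times> bool \<Rightarrow> real"
  assumes W_nonneg: "W u \<ge> 0" and sum_W: "(\<Sum>u\<in>UNIV. W u) = 1"
begin

abbreviation "K \<equiv> ring_op mu p W"
abbreviation "L \<equiv> live_op mu p W"
abbreviation "D \<equiv> dead_op mu p W"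

lemma K_add: "K (\<lambda>h. F h + G h) h = K F h + K G h"
  using mu_pos by (simp add: ring_op_def gap_add distrib_left sum.distrib)

lemma K_cmult: "K (\<lambda>h. c * F h) h = c * K F h"
  by (simp add: ring_op_def gap_cmult sum_distrib_left mult_ac)

lemma K_const [simp]: "K (\<lambda>h. c) h = c"
  by (simp add: ring_op_def sum_examine_prob sum_W flip: sum_distrib_right)

lemma K_mono:
  assumes "\<And>h'. length h' = Suc (length h) \<Longrightarrow> F h' \<le> G h'"
  shows "K F h \<le> K G h"
  unfolding ring_op_def
  by (intro sum_mono mult_left_mono gap_mono W_nonneg examine_prob_nonneg mu_pos assms)
    (auto dest: map_eq_imp_length_eq)

lemma K_cong:
  assumes "\<And>h'. length h' = Suc (length h) \<Longrightarrow> F h' = G h'"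
  shows "K F h = K G h"
  using assms by (intro antisym K_mono) auto

lemma K_append:
  assumes "alive h0 = {}"
  shows "K F (h @ h0) = K (\<lambda>h. F (h @ h0)) h"
proof -
  have "gap mu F (((u, s), True) # h @ h0) = gap mu (\<lambda>h. F (h @ h0)) (((u, s), True) # h)" for u s
    using gap_append[OF assms, of mu F "((u, s), True) # h"] by simp
  then show ?thesis by (simp add: ring_op_def examine_prob_append[OF assms])
qed

lemma K_pow_append:
  assumes "alive h0 = {}"
  shows "(K ^^ n) F (h @ h0) = (K ^^ n) (\<lambda>h. F (h @ h0)) h"
  by (induction n arbitrary: h) (simp_all add: K_append[OF assms] del: append_assoc)

lemma K_split: "K F h = L F h + D F h"
  unfolding live_op_def dead_op_def K_add[symmetric] by (rule K_cong) auto

lemma L_add: "L (\<lambda>h. F h + G h) h = L F h + L G h"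
  unfolding live_op_def K_add[symmetric] by (rule K_cong) auto

lemma L_cmult: "L (\<lambda>h. c * F h) h = c * L F h"
  unfolding live_op_def K_cmult[symmetric] by (rule K_cong) auto

lemma D_add: "D (\<lambda>h. F h + G h) h = D F h + D G h"
  unfolding dead_op_def K_add[symmetric] by (rule K_cong) auto

lemma D_cmult: "D (\<lambda>h. c * F h) h = c * D F h"
  unfolding dead_op_def K_cmult[symmetric] by (rule K_cong) auto

lemma L_pow_add: "(L ^^ n) (\<lambda>h. F h + G h) = (\<lambda>h. (L ^^ n) F h + (L ^^ n) G h)"
  by (induction n) (simp_all add: L_add)

lemma L_pow_cmult: "(L ^^ n) (\<lambda>h. c * F h) = (\<lambda>h. c * (L ^^ n) F h)"
  by (induction n) (simp_all add: L_cmult)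

lemma K_pow_add: "(K ^^ n) (\<lambda>h. F h + G h) = (\<lambda>h. (K ^^ n) F h + (K ^^ n) G h)"
  by (induction n) (simp_all add: K_add)

lemma K_pow_cmult: "(K ^^ n) (\<lambda>h. c * F h) = (\<lambda>h. c * (K ^^ n) F h)"
  by (induction n) (simp_all add: K_cmult)

lemma K_pow_const [simp]: "(K ^^ n) (\<lambda>h. c) = (\<lambda>h. c)"
  by (induction n) simp_all

lemma K_pow_cong:
  assumes "\<And>h'. length h' = length h + n \<Longrightarrow> F h' = G h'"
  shows "(K ^^ n) F h = (K ^^ n) G h"
  using assms
proof (induction n arbitrary: h)
  case (Suc n)
  show ?case by (simp, rule K_cong, rule Suc.IH, rule Suc.prems) simp
qed simp

lemma tour_add: "tour mu p W k (\<lambda>h. F h + G h) = tour mu p W k F + tour mu p W k G"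
  by (simp add: tour_def D_add[abs_def] L_pow_add)

lemma tour_cmult: "tour mu p W k (\<lambda>h. c * F h) = c * tour mu p W k F"
  by (simp add: tour_def D_cmult[abs_def] L_pow_cmult)

lemma L_sum: "finite I \<Longrightarrow> L (\<lambda>h. \<Sum>i\<in>I. F i h) h = (\<Sum>i\<in>I. L (F i) h)"
proof (induction rule: finite_induct)
  case empty
  then show ?case using L_cmult[of 0 "\<lambda>_. 0"] by simp
qed (simp add: L_add)

text \<open>Decomposition at the first regeneration: either it follows ring number
  \<open>k + 1\<close> for some \<open>k < n\<close>, which leaves \<open>n - 1 - k\<close> rings,
  or it does not occur within \<open>n\<close> rings.\<close>

lemma K_pow_renewal:
  "(K ^^ n) F h = (\<Sum>k<n. (L ^^ k) (D ((K ^^ (n - 1 - k)) F)) h) + (L ^^ n) F h"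
proof (induction n arbitrary: h)
  case (Suc n)
  have IH: "(K ^^ n) F = (\<lambda>h. (\<Sum>k<n. (L ^^ k) (D ((K ^^ (n - 1 - k)) F)) h) + (L ^^ n) F h)"
    using Suc.IH by auto
  have "(K ^^ Suc n) F h = L ((K ^^ n) F) h + D ((K ^^ n) F) h"
    by (simp add: K_split)
  also have "L ((K ^^ n) F) h = (\<Sum>k<n. (L ^^ Suc k) (D ((K ^^ (n - 1 - k)) F)) h) + (L ^^ Suc n) F h"
    by (subst IH) (simp add: L_add L_sum)
  finally show ?case
    by (simp add: sum.lessThan_Suc_shift del: sum.lessThan_Suc funpow.simps(2))
qed simp

lemma L_pow_cong:
  assumes "\<And>h'. length h' = length h + n \<Longrightarrow> F h' = G h'"
  shows "(L ^^ n) F h = (L ^^ n) G h"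
  using assms
proof (induction n arbitrary: h)
  case (Suc n)
  have "K (\<lambda>h. if alive h = {} then 0 else (L ^^ n) F h) h
      = K (\<lambda>h. if alive h = {} then 0 else (L ^^ n) G h) h"
  proof (rule K_cong)
    fix h' :: "('d ring \<times> bool) list"
    assume "length h' = Suc (length h)"
    then have "(L ^^ n) F h' = (L ^^ n) G h'" by (intro Suc.IH Suc.prems) simp
    then show "(if alive h' = {} then 0 else (L ^^ n) F h')
        = (if alive h' = {} then 0 else (L ^^ n) G h')" by simp
  qed
  then show ?case unfolding funpow.simps o_apply live_op_def[of mu p W "(L ^^ n) F"]
      live_op_def[of mu p W "(L ^^ n) G"] .
qed simp

lemma tour_cong:
  assumes "\<And>h. alive h = {} \<Longrightarrow> length h = Suc k \<Longrightarrow> F h = G h"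
  shows "tour mu p W k F = tour mu p W k G"
  unfolding tour_def
proof (rule L_pow_cong)
  fix h' :: "('d ring \<times> bool) list"
  assume "length h' = length ([] :: ('d ring \<times> bool) list) + k"
  then show "D F h' = D G h'"
    unfolding dead_op_def by (intro K_cong) (auto simp: assms)
qed

lemma tour_mono:
  assumes "\<And>h. F h \<le> G h"
  shows "tour mu p W k F \<le> tour mu p W k G"
proof -
  have "(L ^^ k) (D F) h \<le> (L ^^ k) (D G) h" for h
    by (induction k arbitrary: h)
      (auto simp: live_op_def dead_op_def assms intro!: K_mono)
  then show ?thesis by (simp add: tour_def)
qed

lemma sum_direction_bound:
  assumes "\<And>u s. \<bar>G u s\<bar> \<le> C"
  shows "\<bar>\<Sum>u\<in>UNIV. V u * (\<Sum>s\<in>UNIV. examine_prob p h u s * G u s)\<bar> \<le> (\<Sum>u\<in>UNIV. \<bar>V u\<bar>) * C"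
  unfolding sum_distrib_right
  by (rule order_trans[OF sum_abs sum_mono])
    (auto simp: abs_mult intro!: mult_left_mono sum_examine_bound assms)

lemma sum_abs_W: "(\<Sum>u\<in>UNIV. \<bar>W u\<bar>) = 1"
  using W_nonneg sum_W by simp

lemma L_bound:
  assumes "C \<ge> 0" "\<And>h'. length h' = Suc (length h) \<Longrightarrow> \<bar>F h'\<bar> \<le> C * alive_weight h'"
  shows "\<bar>L F h\<bar> \<le> decay * C * alive_weight h"
  unfolding live_op_def ring_op_def
  by (rule order_trans[OF sum_direction_bound[OF gap_live_bound]])
    (use assms in \<open>auto simp: sum_abs_W\<close>)

lemma D_bound:
  assumes "C \<ge> 0" "\<And>h'. length h' = Suc (length h) \<Longrightarrow> \<bar>F h'\<bar> \<le> C"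
  shows "\<bar>D F h\<bar> \<le> C"
proof -
  have "\<bar>D F h\<bar> \<le> (\<Sum>u\<in>UNIV. \<bar>W u\<bar>) * C"
    unfolding dead_op_def ring_op_def
    by (intro sum_direction_bound gap_dead_bound assms)
  then show ?thesis by (simp add: sum_abs_W)
qed

lemma L_pow_bound:
  assumes "C \<ge> 0" "\<And>h'. length h' = length h + n \<Longrightarrow> \<bar>F h'\<bar> \<le> C * alive_weight h'"
  shows "\<bar>(L ^^ n) F h\<bar> \<le> decay ^ n * C * alive_weight h"
  using assms(2)
proof (induction n arbitrary: h)
  case (Suc n)
  have "\<bar>L ((L ^^ n) F) h\<bar> \<le> decay * (decay ^ n * C) * alive_weight h"
    using assms(1) decay_pos by (intro L_bound Suc.IH Suc.prems) auto
  then show ?case by (simp add: mult_ac)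
qed simp

lemma L_pow_D_bound:
  assumes "C \<ge> 0" "\<And>h'. length h' = Suc (length h + n) \<Longrightarrow> \<bar>F h'\<bar> \<le> C"
  shows "\<bar>(L ^^ n) (D F) h\<bar> \<le> decay ^ n * C * alive_weight h"
proof (rule L_pow_bound[OF assms(1)])
  fix h' :: "('d ring \<times> bool) list"
  assume "length h' = length h + n"
  then have "\<bar>D F h'\<bar> \<le> C" using assms by (intro D_bound) auto
  also have "C \<le> C * alive_weight h'"
    using assms(1) alive_weight_ge_1[of h'] by (simp add: mult_le_cancel_left1)
  finally show "\<bar>D F h'\<bar> \<le> C * alive_weight h'" .
qed

text \<open>A tour of \<open>k + 1\<close> rings misses the regeneration \<open>k\<close> times,
  each miss costing \<open>decay\<close>; the empty history has weight 1.\<close>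

lemma tour_bound:
  assumes "C \<ge> 0" "\<And>h. length h = Suc k \<Longrightarrow> \<bar>F h\<bar> \<le> C"
  shows "\<bar>tour mu p W k F\<bar> \<le> decay ^ k * C"
  using L_pow_D_bound[OF assms(1), of "[]" k F] assms(2) by (simp add: tour_def)

lemma tour_nonneg: "(\<And>h. F h \<ge> 0) \<Longrightarrow> tour mu p W k F \<ge> 0"
  using tour_mono[of "\<lambda>_. 0" F k] tour_cmult[of k 0 F] by simp

end

section \<open>Moments of the compensated walk\<close>

text \<open>The weights \<open>f\<close> have total mass at most 1 and the partial sums of
  \<open>r\<close> increase, so the average of the earlier values is at most the sum of the earlier
  remainders. A summable \<open>r\<close> thus gives a uniform bound and a bounded \<open>r\<close>
  a linear one; both cases occur below.\<close>

lemma renewal_bound: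
  fixes f b r :: "nat \<Rightarrow> real"
  assumes f: "\<And>k. f k \<ge> 0" "\<And>n. (\<Sum>k<n. f k) \<le> 1" and r: "\<And>k. r k \<ge> 0"
    and b: "\<And>n. \<bar>b n\<bar> \<le> (\<Sum>k<n. f k * \<bar>b (n - 1 - k)\<bar>) + r n"
  shows "\<bar>b n\<bar> \<le> (\<Sum>j\<le>n. r j)"
proof (induction n rule: less_induct)
  case (less n)
  let ?R = "\<Sum>j<n. r j"
  have "f k * \<bar>b (n - 1 - k)\<bar> \<le> f k * ?R" if "k < n" for k
  proof (intro mult_left_mono f(1))
    have "\<bar>b (n - 1 - k)\<bar> \<le> (\<Sum>j\<le>n - 1 - k. r j)"
      using that by (intro less) auto
    also have "\<dots> \<le> ?R"
      using that r by (intro sum_mono2) auto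
    finally show "\<bar>b (n - 1 - k)\<bar> \<le> ?R" .
  qed
  then have "(\<Sum>k<n. f k * \<bar>b (n - 1 - k)\<bar>) \<le> (\<Sum>k<n. f k) * ?R"
    unfolding sum_distrib_right by (intro sum_mono) auto
  also have "\<dots> \<le> 1 * ?R"
    using r f(2) by (intro mult_right_mono sum_nonneg) auto
  finally have "\<bar>b n\<bar> \<le> ?R + r n" using b[of n] by linarith
  also have "?R + r n = (\<Sum>j\<le>n. r j)"
    by (simp flip: lessThan_Suc_atMost)
  finally show ?case .
qed

lemma Suc_le_two_pow: "real (Suc k) \<le> 2 ^ k"
proof -
  have "Suc k \<le> 2 ^ k" by (induction k) auto
  then show ?thesis by (metis of_nat_le_iff of_nat_numeral of_nat_power)
qed

text \<open>Since \<open>k + 1 \<le> 2 ^ k\<close>, polynomial factors disappear into the base of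
  the geometric bound, at the price of a factor 2 or 4. For this reason \<open>decay\<close> has to
  be small and not just below 1.\<close>

lemma Suc_mult_pow_le:
  fixes x :: real
  assumes "0 \<le> x"
  shows "x ^ k * real (Suc k) \<le> (2 * x) ^ k" "x ^ k * (real (Suc k))\<^sup>2 \<le> (4 * x) ^ k"
    "x ^ k * real k \<le> (2 * x) ^ k" "x ^ k * (real k)\<^sup>2 \<le> (4 * x) ^ k"
proof -
  have "(4 :: real) ^ k = (2 ^ k)\<^sup>2"
    by (simp add: power2_eq_square flip: power_mult_distrib)
  then have pow: "(2 * x) ^ k = x ^ k * 2 ^ k" "(4 * x) ^ k = x ^ k * (2 ^ k)\<^sup>2"
    by (simp_all add: power_mult_distrib)
  show "x ^ k * real (Suc k) \<le> (2 * x) ^ k" "x ^ k * (real (Suc k))\<^sup>2 \<le> (4 * x) ^ k"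
    "x ^ k * real k \<le> (2 * x) ^ k" "x ^ k * (real k)\<^sup>2 \<le> (4 * x) ^ k"
    unfolding pow using Suc_le_two_pow[of k] assms
    by (auto intro!: mult_left_mono power_mono)
qed

definition coord :: "'d::finite \<Rightarrow> ('d ring \<times> bool) list \<Rightarrow> real" where
  "coord i h = real_of_int (endpoint (map fst h) $ i)"

lemma coord_append: "coord i (h @ h0) = coord i h + coord i h0"
  by (simp add: coord_def)

lemma abs_unit_step_le: "\<bar>unit_step u $ i\<bar> \<le> 1"
  by (cases u) (auto simp: axis_def)

lemma abs_displacement_le: "\<bar>displacement y $ i\<bar> \<le> 1"
  using abs_unit_step_le[of "fst y" i] by (auto simp: displacement_def)

lemma abs_coord_le: "\<bar>coord i h\<bar> \<le> length h"
proof (induction h)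
  case (Cons z h)
  have "\<bar>real_of_int (displacement (fst z) $ i)\<bar> \<le> 1"
    using abs_displacement_le[of "fst z" i] by linarith
  then show ?case using Cons by (simp add: coord_def)
qed (simp add: coord_def)

context ring_walk
begin

definition drift :: "'d \<Rightarrow> real" where
  "drift i = (\<Sum>k. tour mu p W k (coord i)) / (\<Sum>k. tour mu p W k (\<lambda>h. real (length h)))"

definition compensated :: "'d \<Rightarrow> ('d ring \<times> bool) list \<Rightarrow> real" where
  "compensated i h = coord i h - drift i * real (length h)"

lemma compensated_append: "compensated i (h @ h0) = compensated i h + compensated i h0"
  by (simp add: compensated_def coord_append algebra_simps)

lemma tour_1_nonneg: "tour mu p W k (\<lambda>_. 1) \<ge> 0"
  by (rule tour_nonneg) simp

text \<open>The renewal decomposition of the constant 1: the regeneration probabilities and the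
  nonnegative mass which has not regenerated add up to 1.\<close>

lemma sum_tour_1_le: "(\<Sum>k<n. tour mu p W k (\<lambda>_. 1)) \<le> 1"
proof -
  have "(L ^^ n) (\<lambda>h. 1) h \<ge> 0" for h
  proof (induction n arbitrary: h)
    case (Suc n)
    have "K (\<lambda>h. 0) h \<le> L ((L ^^ n) (\<lambda>h. 1)) h"
      unfolding live_op_def[of mu p W "(L ^^ n) (\<lambda>h. 1)"] by (rule K_mono) (simp add: Suc)
    then show ?case by simp
  qed simp
  from this[of "[]"] show ?thesis
    using K_pow_renewal[of n "\<lambda>_. 1" "[]"] by (simp add: tour_def)
qed

lemma tour_length: "tour mu p W k (\<lambda>h. real (length h)) = real (Suc k) * tour mu p W k (\<lambda>_. 1)"
proof -
  have "tour mu p W k (\<lambda>h. real (length h)) = tour mu p W k (\<lambda>h. real (Suc k) * 1)"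
    by (rule tour_cong) simp
  then show ?thesis unfolding tour_cmult .
qed

lemma tour_0_1_pos:
  assumes "decay < 1"
  shows "tour mu p W 0 (\<lambda>_. 1) > 0"
proof -
  have "\<bar>L (\<lambda>_. 1) []\<bar> \<le> decay * 1 * alive_weight ([] :: ('d ring \<times> bool) list)"
    using alive_weight_ge_1 by (intro L_bound) auto
  moreover have "K (\<lambda>_. 1) [] = L (\<lambda>_. 1) [] + D (\<lambda>_. 1) []" by (rule K_split)
  ultimately show ?thesis using assms by (simp add: tour_def)
qed

lemma tour_linear_bound:
  assumes "C \<ge> 0" "\<And>h. \<bar>F h\<bar> \<le> C * real (length h)"
  shows "\<bar>tour mu p W k F\<bar> \<le> C * (2 * decay) ^ k"
proof -
  have "\<bar>F h\<bar> \<le> C * real (Suc k)" if "length h = Suc k" for h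
    using assms(2)[of h] that by simp
  then have "\<bar>tour mu p W k F\<bar> \<le> decay ^ k * (C * real (Suc k))"
    using assms(1) by (intro tour_bound) auto
  also have "\<dots> = C * (decay ^ k * real (Suc k))" by simp
  also have "\<dots> \<le> C * (2 * decay) ^ k"
    using decay_pos assms(1) by (intro mult_left_mono Suc_mult_pow_le) auto
  finally show ?thesis .
qed

lemma summable_tour:
  assumes "decay < 1 / 2" "\<And>h. \<bar>F h\<bar> \<le> C * real (length h)" "C \<ge> 0"
  shows "summable (\<lambda>k. tour mu p W k F)"
proof (rule summable_comparison_test')
  show "summable (\<lambda>k. C * (2 * decay) ^ k)"
    using assms decay_pos by (intro summable_mult summable_geometric) auto
  show "\<And>n. n \<ge> 0 \<Longrightarrow> norm (tour mu p W n F) \<le> C * (2 * decay) ^ n"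
    using tour_linear_bound[OF assms(3,2)] by simp
qed

lemma summable_tour_coord: "decay < 1 / 2 \<Longrightarrow> summable (\<lambda>k. tour mu p W k (coord i))"
  by (rule summable_tour[of _ 1]) (simp_all add: abs_coord_le)

lemma summable_tour_length:
  "decay < 1 / 2 \<Longrightarrow> summable (\<lambda>k. tour mu p W k (\<lambda>h. real (length h)))"
  by (rule summable_tour[of _ 1]) simp_all

lemma mean_tour_length_pos:
  assumes "decay < 1 / 2"
  shows "(\<Sum>k. tour mu p W k (\<lambda>h. real (length h))) > 0"
proof (rule suminf_pos2)
  show "tour mu p W n (\<lambda>h. real (length h)) \<ge> 0" for n
    by (rule tour_nonneg) simp
  show "tour mu p W 0 (\<lambda>h. real (length h)) > 0"
    using tour_0_1_pos assms by (simp add: tour_length)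
qed (rule summable_tour_length[OF assms])

lemma compensated_bound: "\<bar>compensated i h\<bar> \<le> (1 + \<bar>drift i\<bar>) * real (length h)"
  using abs_coord_le[of i h] abs_triangle_ineq4[of "coord i h" "drift i * real (length h)"]
  by (simp add: compensated_def abs_mult algebra_simps)

lemma tour_compensated:
  "tour mu p W k (compensated i)
     = tour mu p W k (coord i) - drift i * tour mu p W k (\<lambda>h. real (length h))"
  using tour_add[of k "coord i" "\<lambda>h. (- drift i) * real (length h)"]
    tour_cmult[of k "- drift i" "\<lambda>h. real (length h)"]
  by (simp add: compensated_def[abs_def])

text \<open>The quotient \<open>drift\<close> is chosen exactly so that the compensated displacement
  of a whole tour has mean zero.\<close>

lemma sums_tour_compensated:
  assumes "decay < 1 / 2"
  shows "(\<lambda>k. tour mu p W k (compensated i)) sums 0"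
proof -
  have "(\<lambda>k. tour mu p W k (compensated i)) sums
      ((\<Sum>k. tour mu p W k (coord i)) - drift i * (\<Sum>k. tour mu p W k (\<lambda>h. real (length h))))"
    unfolding tour_compensated
    by (intro sums_diff sums_mult summable_sums summable_tour_coord summable_tour_length assms)
  then show ?thesis
    using mean_tour_length_pos[OF assms] by (simp add: drift_def)
qed

text \<open>Mean zero over a tour makes the first \<open>n\<close> terms of the series equal to
  minus its tail, which is geometrically small. The remainder in the renewal inequality is therefore
  summable.\<close>

lemma K_pow_compensated_bounded:
  assumes dec: "decay \<le> 1 / 8"
  shows "\<bar>(K ^^ n) (compensated i) []\<bar> \<le> 4 * (1 + \<bar>drift i\<bar>)"
proof -
  let ?C = "1 + \<bar>drift i\<bar>"
  let ?Y = "compensated i"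
  let ?t = "\<lambda>k. tour mu p W k ?Y"
  let ?b = "\<lambda>n. (K ^^ n) ?Y []"
  let ?f = "\<lambda>k. tour mu p W k (\<lambda>_. 1)"
  \<comment> \<open>The tail of the series contributes \<open>4 / 3\<close> and the part without
    regeneration contributes 1, together at most 3; summing the powers of \<open>1 / 4\<close> then
    gives \<open>3 * (4 / 3) = 4\<close>.\<close>
  let ?r = "\<lambda>n. 3 * ?C * (1 / 4) ^ n"
  have quarter: "(2 * decay) ^ k \<le> (1 / 4) ^ k" for k
    using dec decay_pos by (intro power_mono) auto
  have t_le: "\<bar>?t k\<bar> \<le> ?C * (1 / 4) ^ k" for k
    by (rule order_trans[OF tour_linear_bound mult_left_mono[OF quarter]])
      (auto intro: compensated_bound)
  have L_le: "\<bar>(L ^^ n) ?Y []\<bar> \<le> ?C * (1 / 4) ^ n" for n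
  proof -
    have "\<bar>(L ^^ n) ?Y []\<bar> \<le> decay ^ n * (?C * real n) * alive_weight ([] :: ('d ring \<times> bool) list)"
    proof (rule L_pow_bound)
      fix h' :: "('d ring \<times> bool) list"
      assume "length h' = length ([] :: ('d ring \<times> bool) list) + n"
      then have "\<bar>?Y h'\<bar> \<le> ?C * real n * 1" using compensated_bound[of i h'] by simp
      also have "\<dots> \<le> ?C * real n * alive_weight h'"
        by (intro mult_left_mono alive_weight_ge_1) auto
      finally show "\<bar>?Y h'\<bar> \<le> ?C * real n * alive_weight h'" .
    qed simp
    also have "\<dots> = ?C * (decay ^ n * real n)" by simp
    also have "\<dots> \<le> ?C * (1 / 4) ^ n"
      using order_trans[OF Suc_mult_pow_le(3)[of decay n] quarter[of n]] decay_pos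
      by (intro mult_left_mono) auto
    finally show ?thesis .
  qed
  have sum_t: "\<bar>\<Sum>k<n. ?t k\<bar> \<le> ?C * (4 / 3) * (1 / 4) ^ n" for n
  proof -
    have s: "?t sums 0" using dec by (intro sums_tour_compensated) simp
    have geo: "(\<lambda>k. ?C * (1 / 4) ^ (k + n)) sums (?C * (1 / 4) ^ n * (4 / 3))"
      using sums_mult[OF geometric_sums[of "1 / 4 :: real"], of "?C * (1 / 4) ^ n"]
      by (simp add: power_add mult_ac)
    have "(\<Sum>k<n. ?t k) = - (\<Sum>k. ?t (k + n))"
      using suminf_split_initial_segment[OF sums_summable[OF s], of n] sums_unique[OF s] by simp
    also have "\<bar>\<dots>\<bar> \<le> (\<Sum>k. ?C * (1 / 4) ^ (k + n))"
      unfolding abs_minus_cancel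
      using summable_norm_comparison_test norm_suminf_le[of "\<lambda>k. ?t (k + n)" "\<lambda>k. ?C * (1 / 4) ^ (k + n)"]
        t_le sums_summable[OF geo] by auto
    also have "\<dots> = ?C * (1 / 4) ^ n * (4 / 3)"
      using sums_unique[OF geo] by (rule sym)
    finally show ?thesis by (simp only: mult_ac)
  qed
  have rec: "\<bar>?b n\<bar> \<le> (\<Sum>k<n. ?f k * \<bar>?b (n - 1 - k)\<bar>) + ?r n" for n
  proof -
    \<comment> \<open>After a regeneration the walk starts afresh, and its displacement is added to
      that of the tour.\<close>
    have "tour mu p W k ((K ^^ m) ?Y) = ?f k * ?b m + ?t k" for k m
    proof -
      have "tour mu p W k ((K ^^ m) ?Y) = tour mu p W k (\<lambda>h. ?b m * 1 + ?Y h)"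
      proof (rule tour_cong)
        fix h :: "('d ring \<times> bool) list"
        assume h: "alive h = {}"
        show "(K ^^ m) ?Y h = ?b m * 1 + ?Y h"
          using K_pow_append[OF h, of m ?Y "[]"] by (simp add: compensated_append K_pow_add)
      qed
      then show ?thesis unfolding tour_add tour_cmult by simp
    qed
    then have "?b n = (\<Sum>k<n. ?f k * ?b (n - 1 - k)) + (\<Sum>k<n. ?t k) + (L ^^ n) ?Y []"
      using K_pow_renewal[of n ?Y "[]"] by (simp add: tour_def sum.distrib)
    moreover have "\<bar>\<Sum>k<n. ?f k * ?b (n - 1 - k)\<bar> \<le> (\<Sum>k<n. ?f k * \<bar>?b (n - 1 - k)\<bar>)"
      by (rule order_trans[OF sum_abs]) (simp add: abs_mult tour_1_nonneg)
    moreover have "?C * (4 / 3) * (1 / 4) ^ n + ?C * (1 / 4) ^ n \<le> ?r n"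
    proof -
      have "0 \<le> ?C * (1 / 4) ^ n" by simp
      then show ?thesis by argo
    qed
    ultimately show ?thesis using sum_t[of n] L_le[of n] by linarith
  qed
  have "\<bar>?b n\<bar> \<le> (\<Sum>j\<le>n. ?r j)"
    using rec by (intro renewal_bound[of ?f] tour_1_nonneg sum_tour_1_le) auto
  also have "\<dots> = 3 * ?C * (\<Sum>j\<le>n. (1 / 4) ^ j)"
    by (simp add: sum_distrib_left)
  also have "\<dots> \<le> 3 * ?C * (4 / 3)"
    by (intro mult_left_mono) (simp_all add: sum_gp0)
  finally show ?thesis by simp
qed

text \<open>Squaring the sum of the tour and the fresh continuation produces a cross term,
  controlled by the uniform bound on the first moment. The remainder is now bounded instead of
  summable, whence the linear growth.\<close>

lemma K_pow_compensated_square: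
  assumes dec: "decay \<le> 1 / 8"
  shows "(K ^^ n) (\<lambda>h. (compensated i h)\<^sup>2) [] \<le> 19 * (1 + \<bar>drift i\<bar>)\<^sup>2 * real (Suc n)"
proof -
  let ?C = "1 + \<bar>drift i\<bar>"
  let ?Y = "compensated i"
  let ?Z = "\<lambda>h. (compensated i h)\<^sup>2"
  let ?b = "\<lambda>n. (K ^^ n) ?Y []"
  let ?s = "\<lambda>n. (K ^^ n) ?Z []"
  let ?f = "\<lambda>k. tour mu p W k (\<lambda>_. 1)"
  let ?t = "\<lambda>k. tour mu p W k ?Y"
  have half: "(4 * decay) ^ k \<le> (1 / 2) ^ k" "(2 * decay) ^ k \<le> (1 / 2) ^ k" for k
    using dec decay_pos by (intro power_mono; simp)+
  have t_le: "\<bar>?t k\<bar> \<le> ?C * (1 / 2) ^ k" for k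
    by (rule order_trans[OF tour_linear_bound mult_left_mono[OF half(2)]])
      (auto intro: compensated_bound)
  have Z_le: "\<bar>?Z h\<bar> \<le> ?C\<^sup>2 * (real (length h))\<^sup>2" for h
    using power_mono[OF compensated_bound[of i h], of 2] by (simp add: power_mult_distrib)
  have t2_le: "\<bar>tour mu p W k ?Z\<bar> \<le> ?C\<^sup>2 * (1 / 2) ^ k" for k
  proof -
    have "\<bar>tour mu p W k ?Z\<bar> \<le> decay ^ k * (?C\<^sup>2 * (real (Suc k))\<^sup>2)"
      using Z_le by (intro tour_bound) (auto, metis of_nat_Suc)
    also have "\<dots> = ?C\<^sup>2 * (decay ^ k * (real (Suc k))\<^sup>2)" by (simp only: mult_ac)
    also have "\<dots> \<le> ?C\<^sup>2 * (1 / 2) ^ k"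
      using order_trans[OF Suc_mult_pow_le(2)[of decay k] half(1)[of k]] decay_pos
      by (intro mult_left_mono) auto
    finally show ?thesis .
  qed
  have L_le: "\<bar>(L ^^ n) ?Z []\<bar> \<le> ?C\<^sup>2" for n
  proof -
    have "\<bar>(L ^^ n) ?Z []\<bar>
        \<le> decay ^ n * (?C\<^sup>2 * (real n)\<^sup>2) * alive_weight ([] :: ('d ring \<times> bool) list)"
    proof (rule L_pow_bound)
      fix h' :: "('d ring \<times> bool) list"
      assume "length h' = length ([] :: ('d ring \<times> bool) list) + n"
      then have "\<bar>?Z h'\<bar> \<le> ?C\<^sup>2 * (real n)\<^sup>2 * 1" using Z_le[of h'] by simp
      also have "\<dots> \<le> ?C\<^sup>2 * (real n)\<^sup>2 * alive_weight h'"
        by (intro mult_left_mono alive_weight_ge_1) auto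
      finally show "\<bar>?Z h'\<bar> \<le> ?C\<^sup>2 * (real n)\<^sup>2 * alive_weight h'" .
    qed simp
    also have "\<dots> = ?C\<^sup>2 * (decay ^ n * (real n)\<^sup>2)" by simp
    also have "\<dots> \<le> ?C\<^sup>2 * (1 / 2) ^ n"
      using order_trans[OF Suc_mult_pow_le(4)[of decay n] half(1)[of n]] decay_pos
      by (intro mult_left_mono) auto
    also have "\<dots> \<le> ?C\<^sup>2 * 1"
      by (intro mult_left_mono power_le_one) auto
    finally show ?thesis by simp
  qed
  have geo: "(\<Sum>k<n. (1 / 2 :: real) ^ k) \<le> 2" for n
    by (simp add: sum_gp_strict)
  \<comment> \<open>The constant is \<open>16 + 2 + 1\<close>: the cross terms give
    \<open>2 * 4 * 2\<close>, the second moments of the tours 2, the part without regeneration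
    1.\<close>
  have rec: "\<bar>?s n\<bar> \<le> (\<Sum>k<n. ?f k * \<bar>?s (n - 1 - k)\<bar>) + 19 * ?C\<^sup>2" for n
  proof -
    have T: "tour mu p W k ((K ^^ m) ?Z) = ?f k * ?s m + (2 * ?b m * ?t k + tour mu p W k ?Z)"
      for k m
    proof -
      have "tour mu p W k ((K ^^ m) ?Z)
          = tour mu p W k (\<lambda>h. ?s m * 1 + ((2 * ?b m) * ?Y h + ?Z h))"
      proof (rule tour_cong)
        fix h :: "('d ring \<times> bool) list"
        assume h: "alive h = {}"
        have "(K ^^ m) ?Z h = (K ^^ m) (\<lambda>h'. ?Z h' + ((2 * ?Y h) * ?Y h' + ?Z h)) []"
          using K_pow_append[OF h, of m ?Z "[]"]
          by (simp add: compensated_append power2_sum algebra_simps)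
        then show "(K ^^ m) ?Z h = ?s m * 1 + ((2 * ?b m) * ?Y h + ?Z h)"
          by (simp add: K_pow_add K_pow_cmult)
      qed
      then show ?thesis unfolding tour_add tour_cmult by simp
    qed
    have "?s n = (\<Sum>k<n. ?f k * ?s (n - 1 - k))
        + (\<Sum>k<n. 2 * ?b (n - 1 - k) * ?t k) + (\<Sum>k<n. tour mu p W k ?Z) + (L ^^ n) ?Z []"
      using K_pow_renewal[of n ?Z "[]"] unfolding tour_def[symmetric] T
      by (simp add: sum.distrib)
    moreover have "\<bar>\<Sum>k<n. ?f k * ?s (n - 1 - k)\<bar> \<le> (\<Sum>k<n. ?f k * \<bar>?s (n - 1 - k)\<bar>)"
      by (rule order_trans[OF sum_abs]) (simp add: abs_mult tour_1_nonneg)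
    moreover have "\<bar>\<Sum>k<n. 2 * ?b (n - 1 - k) * ?t k\<bar> \<le> 16 * ?C\<^sup>2"
    proof -
      have "\<bar>2 * ?b m * ?t k\<bar> \<le> 8 * ?C\<^sup>2 * (1 / 2) ^ k" for m k
      proof -
        have "\<bar>?b m\<bar> * \<bar>?t k\<bar> \<le> (4 * ?C) * (?C * (1 / 2) ^ k)"
          by (intro mult_mono K_pow_compensated_bounded[OF dec] t_le) auto
        also have "\<dots> = 4 * ?C\<^sup>2 * (1 / 2) ^ k"
          by (simp add: power2_eq_square)
        finally show ?thesis by (simp add: abs_mult mult_ac)
      qed
      then have "\<bar>\<Sum>k<n. 2 * ?b (n - 1 - k) * ?t k\<bar> \<le> (\<Sum>k<n. 8 * ?C\<^sup>2 * (1 / 2) ^ k)"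
        by (intro order_trans[OF sum_abs sum_mono])
      also have "\<dots> = 8 * ?C\<^sup>2 * (\<Sum>k<n. (1 / 2) ^ k)" by (simp add: sum_distrib_left)
      also have "\<dots> \<le> 8 * ?C\<^sup>2 * 2" by (intro mult_left_mono geo) auto
      finally show ?thesis by simp
    qed
    moreover have "\<bar>\<Sum>k<n. tour mu p W k ?Z\<bar> \<le> 2 * ?C\<^sup>2"
    proof -
      have "\<bar>\<Sum>k<n. tour mu p W k ?Z\<bar> \<le> (\<Sum>k<n. ?C\<^sup>2 * (1 / 2) ^ k)"
        using t2_le by (intro order_trans[OF sum_abs sum_mono])
      also have "\<dots> = ?C\<^sup>2 * (\<Sum>k<n. (1 / 2) ^ k)" by (simp add: sum_distrib_left)
      also have "\<dots> \<le> ?C\<^sup>2 * 2" by (intro mult_left_mono geo) auto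
      finally show ?thesis by simp
    qed
    ultimately show ?thesis using L_le[of n] by linarith
  qed
  have "\<bar>?s n\<bar> \<le> (\<Sum>j\<le>n. 19 * ?C\<^sup>2)"
    using rec by (intro renewal_bound[of ?f] tour_1_nonneg sum_tour_1_le) auto
  then show ?thesis by (simp add: mult_ac)
qed

end

section \<open>Comparison of two biases\<close>

lemma thin_flags:
  assumes F: "\<And>h1 h2. map snd h1 = map snd h2 \<Longrightarrow> F h1 = F h2"
  shows "map snd h1 = map snd h2 \<Longrightarrow> thin q F h1 = thin q F h2"
  using F
proof (induction h1 arbitrary: h2 F)
  case (Cons z h1)
  obtain z' h2' where h2: "h2 = z' # h2'" "snd z = snd z'" "map snd h1 = map snd h2'"
    using Cons.prems(1) by (cases h2) simp_all
  have "thin q (\<lambda>h'. F ((fst z, b) # h')) h1 = thin q (\<lambda>h'. F ((fst z', b) # h')) h2'" for b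
  proof -
    have "(\<lambda>h'. F ((fst z, b) # h')) = (\<lambda>h'. F ((fst z', b) # h'))"
      by (rule ext, rule Cons.prems(2)) simp
    moreover have "thin q (\<lambda>h'. F ((fst z', b) # h')) h1 = thin q (\<lambda>h'. F ((fst z', b) # h')) h2'"
      by (rule Cons.IH[OF h2(3)], rule Cons.prems(2)) simp
    ultimately show ?thesis by simp
  qed
  then show ?case using h2 by simp
next
  case Nil
  have "h2 = []" using Nil.prems(1) by simp
  then show ?case by (simp only:)
qed

lemma alive_flags: "map snd h1 = map snd h2 \<Longrightarrow> alive h1 = alive h2"
proof (induction h1 arbitrary: h2)
  case (Cons z h)
  obtain z' h2' where h2: "h2 = z' # h2'" "snd z = snd z'" "map snd h = map snd h2'"
    using Cons.prems by (cases h2) simp_all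
  then show ?case using Cons.IH[OF h2(3)] map_eq_imp_length_eq[OF h2(3)] by simp
qed simp

text \<open>Such functions do not feel the directions, so their expectations are independent of the bias.\<close>

definition depends_on_flags :: "(('y \<times> bool) list \<Rightarrow> real) \<Rightarrow> bool" where
  "depends_on_flags F \<longleftrightarrow> (\<forall>h1 h2. map snd h1 = map snd h2 \<longrightarrow> F h1 = F h2)"

lemma depends_on_flagsD: "depends_on_flags F \<Longrightarrow> map snd h1 = map snd h2 \<Longrightarrow> F h1 = F h2"
  unfolding depends_on_flags_def by iprover

lemma gap_flags:
  assumes "depends_on_flags F" "map snd h1 = map snd h2"
  shows "gap mu F h1 = gap mu F h2"
proof -
  have "thin q F h1 = thin q F h2" for q
    by (rule thin_flags[OF depends_on_flagsD[OF assms(1)] assms(2)])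
  then show ?thesis by (simp add: gap_def)
qed

context ring_walk
begin

text \<open>Directions and states carry total mass one and do not influence the flags, so they
  integrate out. The right-hand side no longer involves \<open>W\<close>; the ring \<open>z\<close>
  is a placeholder.\<close>

lemma K_flags:
  assumes "depends_on_flags F"
  shows "K F h = gap mu F ((z, True) # h)"
proof -
  have "gap mu F (((u, s), True) # h) = gap mu F ((z, True) # h)" for u s
    by (rule gap_flags[OF assms]) simp
  then have "K F h = (\<Sum>u\<in>UNIV. W u * (\<Sum>s\<in>UNIV. examine_prob p h u s * gap mu F ((z, True) # h)))"
    unfolding ring_op_def by (intro sum.cong refl arg_cong2[where f = times])
  then show ?thesis
    by (simp add: sum_examine_prob sum_W flip: sum_distrib_right)
qed

lemma depends_on_flags_K:
  assumes "depends_on_flags F"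
  shows "depends_on_flags (K F)"
  unfolding depends_on_flags_def
proof (intro allI impI)
  fix h1 h2 :: "('d ring \<times> bool) list"
  assume "map snd h1 = map snd h2"
  then show "K F h1 = K F h2"
    unfolding K_flags[OF assms, of _ undefined]
    by (intro gap_flags[OF assms]) simp
qed

end

lemma depends_on_flags_if:
  "depends_on_flags F \<Longrightarrow> depends_on_flags G \<Longrightarrow>
    depends_on_flags (\<lambda>h. if alive h = {} then F h else G h)"
  unfolding depends_on_flags_def[of "\<lambda>h. if _ h then _ h else _ h"]
proof (intro allI impI)
  fix h1 h2 :: "('a \<times> bool) list"
  assume F: "depends_on_flags F" and G: "depends_on_flags G" and h: "map snd h1 = map snd h2"
  show "(if alive h1 = {} then F h1 else G h1) = (if alive h2 = {} then F h2 else G h2)"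
    unfolding alive_flags[OF h] depends_on_flagsD[OF F h] depends_on_flagsD[OF G h] ..
qed

lemma depends_on_flags_const: "depends_on_flags (\<lambda>_. c)"
  by (simp add: depends_on_flags_def)

context ring_params
begin

text \<open>Applied to the length, this gives both biases the same mean tour length, so that
  comparing the speeds amounts to comparing mean displacements.\<close>

lemma tour_flags_eq:
  assumes W: "ring_walk mu p W" and W': "ring_walk mu p W'" and F: "depends_on_flags F"
  shows "tour mu p W k F = tour mu p W' k F"
proof -
  interpret A: ring_walk mu p W by (rule W)
  interpret B: ring_walk mu p W' by (rule W')
  have K_eq: "A.K G = B.K G" if "depends_on_flags G" for G
    by (rule ext) (simp only: A.K_flags[OF that, of _ undefined] B.K_flags[OF that, of _ undefined])
  have D: "depends_on_flags (A.D F)" "A.D F = B.D F"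
    unfolding dead_op_def
    by (intro A.depends_on_flags_K K_eq depends_on_flags_if F depends_on_flags_const)+
  have "depends_on_flags ((A.L ^^ k) (A.D F)) \<and> (A.L ^^ k) (A.D F) = (B.L ^^ k) (B.D F)"
  proof (induction k)
    case (Suc k)
    let ?G = "\<lambda>h. if alive h = {} then 0 else (A.L ^^ k) (A.D F) h"
    have G: "depends_on_flags ?G"
      using Suc by (intro depends_on_flags_if depends_on_flags_const) auto
    have AB: "(A.L ^^ k) (A.D F) = (B.L ^^ k) (B.D F)" using Suc by blast
    have e: "(A.L ^^ Suc k) (A.D F) = A.K ?G" "(B.L ^^ Suc k) (B.D F) = B.K ?G"
      unfolding funpow.simps o_apply live_op_def[of mu p _ "(_ ^^ k) _"] AB by (rule refl)+
    show ?case
      unfolding e by (intro conjI A.depends_on_flags_K[OF G] K_eq[OF G])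
  qed (use D in simp)
  then show ?thesis by (simp add: tour_def)
qed

text \<open>The two direction laws are exchanged one ring at a time. Each of the
  \<open>m + 1\<close> exchanges costs the l1 distance of the laws, and the other rings keep their
  contraction by \<open>decay\<close>.\<close>

lemma tour_perturbation:
  fixes W W' :: "'d::finite \<times> bool \<Rightarrow> real"
  assumes W: "ring_walk mu p W" and W': "ring_walk mu p W'" and M: "M \<ge> 0"
  assumes "\<And>h'. length h' = Suc (length h + m) \<Longrightarrow> \<bar>F h'\<bar> \<le> M"
  shows "\<bar>(live_op mu p W' ^^ m) (dead_op mu p W' F) h - (live_op mu p W ^^ m) (dead_op mu p W F) h\<bar>
    \<le> real (Suc m) * (\<Sum>u\<in>UNIV. \<bar>W' u - W u\<bar>) * M * decay ^ m * alive_weight h"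
  using assms(4)
proof (induction m arbitrary: h)
  interpret A: ring_walk mu p W by (rule W)
  interpret B: ring_walk mu p W' by (rule W')
  let ?\<Delta> = "\<Sum>u\<in>UNIV. \<bar>W' u - W u\<bar>"
  have \<Delta>: "?\<Delta> \<ge> 0" by (intro sum_nonneg) auto
  have diff: "ring_op mu p W' G h - ring_op mu p W G h
      = (\<Sum>u\<in>UNIV. (W' u - W u) * (\<Sum>s\<in>UNIV. examine_prob p h u s * gap mu G (((u, s), True) # h)))"
    for G and h :: "('d ring \<times> bool) list"
    unfolding ring_op_def by (simp add: left_diff_distrib sum_subtractf)
  {
    case 0
    have "\<bar>B.D F h - A.D F h\<bar> \<le> ?\<Delta> * M"
      unfolding dead_op_def diff by (intro A.sum_direction_bound gap_dead_bound M 0) simp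
    also have "\<dots> \<le> ?\<Delta> * M * alive_weight h"
      using mult_nonneg_nonneg[OF \<Delta> M] alive_weight_ge_1[of h] by (simp add: mult_le_cancel_left1)
    finally show ?case by simp
  next
    case (Suc m)
    let ?A = "(A.L ^^ m) (A.D F)" and ?B = "(B.L ^^ m) (B.D F)"
    \<comment> \<open>The difference splits into the exchanges at later rings, covered by the
      induction hypothesis, and the exchange at the present one, which acts on the unchanged
      function \<open>?A\<close>.\<close>
    have B_add: "B.L ?B h = B.L ?A h + B.L (\<lambda>h. ?B h - ?A h) h"
      unfolding B.L_add[symmetric] by simp
    have "\<bar>B.L (\<lambda>h. ?B h - ?A h) h\<bar> \<le> decay * (real (Suc m) * ?\<Delta> * M * decay ^ m) * alive_weight h"
      using \<Delta> M decay_pos by (intro B.L_bound Suc.IH Suc.prems mult_nonneg_nonneg) auto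
    moreover have "\<bar>B.L ?A h - A.L ?A h\<bar> \<le> ?\<Delta> * (decay * (decay ^ m * M) * alive_weight h)"
      unfolding live_op_def[of mu p _ "(A.L ^^ m) (A.D F)"] diff
      using M decay_pos
      by (intro A.sum_direction_bound gap_live_bound A.L_pow_D_bound Suc.prems mult_nonneg_nonneg) auto
    ultimately have "\<bar>B.L ?B h - A.L ?A h\<bar>
        \<le> decay * (real (Suc m) * ?\<Delta> * M * decay ^ m) * alive_weight h
          + ?\<Delta> * (decay * (decay ^ m * M) * alive_weight h)"
      unfolding B_add by linarith
    also have "\<dots> = real (Suc (Suc m)) * ?\<Delta> * M * decay ^ Suc m * alive_weight h"
      by (simp add: algebra_simps)
    finally show ?case by simp
  }
qed

lemma gap_dead_singleton:
  "gap mu (\<lambda>h. if alive h = {} then F h else 0) [(y, True)] = F [(y, False)] * (mu / (1 + mu))"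
proof -
  interpret prob_space "waiting_time 1" by (rule prob_space_waiting_time) simp
  have "integrable (waiting_time 1) (\<lambda>r. exp (- (mu * r)))"
    using integrable_thin[OF mu_pos, of "\<lambda>h. real (card (alive h))" "[(undefined, True)]"]
    unfolding thin_card_alive by simp
  then have "gap mu (\<lambda>h. if alive h = {} then F h else 0) [(y, True)] = (1 - 1 / (1 + mu)) * F [(y, False)]"
    using exp_waiting_time[of mu] mu_pos prob_space by (simp add: gap_def)
  also have "1 - 1 / (1 + mu) = mu / (1 + mu)"
    using mu_pos by (simp add: field_simps)
  finally show ?thesis by simp
qed

end

context ring_walk
begin

text \<open>A tour of length one examines a new edge, which is open with probability
  \<open>p\<close>, and its only token dies before the next ring, with probability
  \<open>mu / (1 + mu)\<close>.\<close>

lemma tour_0_coord: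
  "tour mu p W 0 (coord i) = p * (mu / (1 + mu)) * (W (i, True) - W (i, False))"
proof -
  have e: "examine_prob p [] u s = status_prob p s" for u :: "'d \<times> bool" and s
    by (simp add: examine_prob_def)
  have "tour mu p W 0 (coord i)
      = (\<Sum>u\<in>UNIV. W u * (p * (real_of_int (unit_step u $ i) * (mu / (1 + mu)))))"
    by (simp add: tour_def dead_op_def ring_op_def gap_dead_singleton e status_prob_def UNIV_bool
        coord_def displacement_def)
  also have "\<dots> = (\<Sum>u\<in>{(i, True), (i, False)}. W u * (p * (real_of_int (unit_step u $ i) * (mu / (1 + mu)))))"
  proof (rule sum.mono_neutral_right)
    show "\<forall>u\<in>UNIV - {(i, True), (i, False)}. W u * (p * (real_of_int (unit_step u $ i) * (mu / (1 + mu)))) = 0"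
    proof
      fix u assume "u \<in> UNIV - {(i, True), (i, False)}"
      then have "unit_step u $ i = (0 :: int)" by (cases u) (auto simp: axis_def)
      then show "W u * (p * (real_of_int (unit_step u $ i) * (mu / (1 + mu)))) = 0" by simp
    qed
  qed auto
  also have "\<dots> = p * (mu / (1 + mu)) * (W (i, True) - W (i, False))"
    by (simp add: axis_def algebra_simps)
  finally show ?thesis .
qed

end

text \<open>With \<open>?m\<close> the increase of the mean of a single direction, tours of length
  one gain at least \<open>p * ?m / 2\<close>, while the change over all longer tours is at most
  \<open>2 / 7 * p * ?m\<close>.\<close>

lemma ring_params_drift_less:
  fixes W W' :: "'d::finite \<times> bool \<Rightarrow> real"
  assumes W: "ring_walk mu p W" and W': "ring_walk mu p W'" and mu: "mu \<ge> 64 / p"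
    and m: "W (i, True) - W (i, False) < W' (i, True) - W' (i, False)"
    and \<Delta>: "(\<Sum>u\<in>UNIV. \<bar>W' u - W u\<bar>)
      \<le> 2 * ((W' (i, True) - W' (i, False)) - (W (i, True) - W (i, False)))"
  shows "ring_walk.drift mu p W i < ring_walk.drift mu p W' i"
proof -
  interpret A: ring_walk mu p W by (rule W)
  interpret B: ring_walk mu p W' by (rule W')
  let ?m = "(W' (i, True) - W' (i, False)) - (W (i, True) - W (i, False))"
  let ?\<Delta> = "\<Sum>u\<in>UNIV. \<bar>W' u - W u\<bar>"
  let ?g = "\<lambda>k. tour mu p W' k (coord i) - tour mu p W k (coord i)"
  \<comment> \<open>The factor 4 absorbs \<open>(k + 1)^2\<close>: one factor \<open>k + 1\<close>
    counts the exchanged rings, the other bounds the displacement. The threshold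
    \<open>64 / p\<close> ensures \<open>?x = 8 / (1 + mu) \<le> p / 8\<close>.\<close>
  let ?x = "4 * A.decay"
  have pm: "64 \<le> p * mu" using mu A.p_pos by (simp add: field_simps)
  have mu64: "64 \<le> mu"
    using pm A.p_less_1 A.mu_pos by (smt (verit) mult_less_cancel_right1)
  have x: "0 < ?x" "?x \<le> 1 / 8 * p" "?x \<le> 1 / 8"
  proof -
    show "0 < ?x" using A.decay_pos by simp
    show *: "?x \<le> 1 / 8 * p"
      using A.mu_pos A.p_pos pm by (simp add: A.decay_def field_simps)
    show "?x \<le> 1 / 8" using * A.p_less_1 by simp
  qed
  have dec: "A.decay < 1 / 2" using x by simp
  have g: "\<bar>?g k\<bar> \<le> ?\<Delta> * ?x ^ k" for k
  proof -
    have "\<bar>coord i h'\<bar> \<le> real (Suc k)" if "length h' = Suc (length ([] :: ('d ring \<times> bool) list) + k)"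
      for h' :: "('d ring \<times> bool) list"
      using abs_coord_le[of i h'] that by simp
    then have "\<bar>?g k\<bar> \<le> real (Suc k) * ?\<Delta> * real (Suc k) * A.decay ^ k
        * alive_weight ([] :: ('d ring \<times> bool) list)"
      unfolding tour_def by (intro A.tour_perturbation W W') auto
    also have "\<dots> = ?\<Delta> * (A.decay ^ k * (real (Suc k))\<^sup>2)"
      by (simp add: power2_eq_square)
    also have "\<dots> \<le> ?\<Delta> * ?x ^ k"
      using A.decay_pos by (intro mult_left_mono Suc_mult_pow_le sum_nonneg) auto
    finally show ?thesis .
  qed
  have sg: "summable ?g"
    by (intro summable_diff A.summable_tour_coord B.summable_tour_coord dec)
  have geo: "(\<lambda>k. ?\<Delta> * ?x ^ Suc k) sums (?\<Delta> * ?x * (1 / (1 - ?x)))"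
    using sums_mult[OF geometric_sums[of ?x], of "?\<Delta> * ?x"] x by (simp add: mult_ac)
  have "\<bar>\<Sum>k. ?g (Suc k)\<bar> \<le> (\<Sum>k. ?\<Delta> * ?x ^ Suc k)"
    using norm_suminf_le[of "\<lambda>k. ?g (Suc k)" "\<lambda>k. ?\<Delta> * ?x ^ Suc k"] g[of "Suc _"] sums_summable[OF geo]
    by (metis real_norm_def)
  also have "\<dots> = ?\<Delta> * (?x * (1 / (1 - ?x)))"
    using sums_unique[OF geo] by simp
  \<comment> \<open>Since \<open>?x \<le> 1 / 8\<close>, the geometric series contributes at most
    \<open>8 / 7\<close>.\<close>
  also have "\<dots> \<le> (2 * ?m) * (?x * (8 / 7))"
    using x m \<Delta> by (intro mult_mono) (auto simp: field_simps intro!: sum_nonneg)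
  also have "\<dots> \<le> (2 * ?m) * (1 / 8 * p * (8 / 7))"
    using x m by (intro mult_left_mono mult_right_mono) auto
  finally have rest: "\<bar>\<Sum>k. ?g (Suc k)\<bar> \<le> 2 / 7 * p * ?m" by argo
  have "?g 0 = p * (mu / (1 + mu)) * ?m"
    unfolding A.tour_0_coord B.tour_0_coord by (simp add: algebra_simps)
  also have "\<dots> \<ge> p * (1 / 2) * ?m"
    using mu64 m A.p_pos by (intro mult_right_mono mult_left_mono) (auto simp: field_simps)
  finally have "?g 0 + (\<Sum>k. ?g (Suc k)) > 0"
    using rest mult_pos_pos[OF A.p_pos, of ?m] m by argo
  moreover have "(\<Sum>k. ?g k) = (\<Sum>k. tour mu p W' k (coord i)) - (\<Sum>k. tour mu p W k (coord i))"
    by (intro suminf_diff[symmetric] A.summable_tour_coord B.summable_tour_coord dec)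
  ultimately have "(\<Sum>k. tour mu p W k (coord i)) < (\<Sum>k. tour mu p W' k (coord i))"
    using suminf_split_head[OF sg] by simp
  moreover have "tour mu p W' k (\<lambda>h. real (length h)) = tour mu p W k (\<lambda>h. real (length h))" for k
    by (rule A.tour_flags_eq[OF W' W])
      (unfold depends_on_flags_def, intro allI impI, drule map_eq_imp_length_eq, simp)
  ultimately show ?thesis
    unfolding A.drift_def B.drift_def
    using A.mean_tour_length_pos[OF dec] by (simp add: divide_strict_right_mono)
qed

section \<open>Reflection symmetry\<close>

definition reflect :: "'d \<Rightarrow> int ^ 'd::finite \<Rightarrow> int ^ 'd" where
  "reflect i x = (\<chi> j. if j = i then - x $ j else x $ j)"

definition flip :: "'d \<Rightarrow> 'd \<times> bool \<Rightarrow> 'd \<times> bool" where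
  "flip i u = (if fst u = i then (i, \<not> snd u) else u)"

lemma reflect_add: "reflect i (x + y) = reflect i x + reflect i y"
  and reflect_0 [simp]: "reflect i 0 = 0"
  and reflect_reflect [simp]: "reflect i (reflect i x) = x"
  by (simp_all add: reflect_def vec_eq_iff)

lemma inj_reflect: "inj (reflect i)"
  by (metis injI reflect_reflect)

lemma flip_flip [simp]: "flip i (flip i u) = u"
  by (auto simp: flip_def prod_eq_iff)

lemma bij_flip: "bij (flip i)"
  by (metis bijI' flip_flip)

lemma unit_step_flip: "unit_step (flip i u) = reflect i (unit_step u)"
  by (cases u) (auto simp: flip_def reflect_def axis_def vec_eq_iff)

definition flip_ring :: "'d \<Rightarrow> 'd ring \<Rightarrow> 'd ring" where
  "flip_ring i y = (flip i (fst y), snd y)"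

lemma flip_ring_simps [simp]:
  "fst (flip_ring i y) = flip i (fst y)" "snd (flip_ring i y) = snd y"
  by (simp_all add: flip_ring_def)

abbreviation flip_history :: "'d \<Rightarrow> ('d::finite ring \<times> bool) list \<Rightarrow> ('d ring \<times> bool) list" where
  "flip_history i \<equiv> map (map_prod (flip_ring i) id)"

lemma endpoint_flip: "endpoint (map (flip_ring i) ys) = reflect i (endpoint ys)"
  by (induction ys) (auto simp: displacement_def reflect_add unit_step_flip)

lemma examined_edge_flip:
  "examined_edge (map (flip_ring i) ys) (flip i u) = reflect i ` examined_edge ys u"
  by (simp add: examined_edge_def endpoint_flip unit_step_flip reflect_add)

lemma last_visit_flip:
  "last_visit (map (flip_ring i) ys) (reflect i ` e) = last_visit ys e"
  by (induction ys) (simp_all add: examined_edge_flip inj_image_eq_iff[OF inj_reflect])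

lemma examine_prob_flip: "examine_prob p (flip_history i h) (flip i u) s = examine_prob p h u s"
proof -
  have m: "map fst (flip_history i h) = map (flip_ring i) (map fst h)" by simp
  have "alive (flip_history i h) = alive h"
    by (rule alive_flags) simp
  then show ?thesis
    unfolding examine_prob_def m examined_edge_flip last_visit_flip by (simp only:)
qed

text \<open>The operators commute with the reflection of histories and the coordinate is odd, so
  each tour mean equals its negative. This is needed for the coordinates transversal to the
  bias.\<close>

lemma (in ring_walk) drift_eq_0:
  assumes W: "\<And>u. W (flip i u) = W u"
  shows "drift i = 0"
proof -
  have K: "K F (flip_history i h) = K (\<lambda>h. F (flip_history i h)) h" for F h
  proof -
    have "K F (flip_history i h) = (\<Sum>u\<in>UNIV. W (flip i u) * (\<Sum>s\<in>UNIV.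
        examine_prob p (flip_history i h) (flip i u) s * gap mu F (((flip i u, s), True) # flip_history i h)))"
      unfolding ring_op_def by (rule sum.reindex_bij_betw[OF bij_flip, symmetric])
    moreover have "gap mu F (((flip i u, s), True) # flip_history i h)
        = gap mu (\<lambda>h. F (flip_history i h)) (((u, s), True) # h)" for u s
      using gap_map[of mu F "flip_ring i" "((u, s), True) # h"] by (simp add: flip_ring_def)
    ultimately show ?thesis by (simp only: ring_op_def W examine_prob_flip)
  qed
  have alive: "alive (flip_history i h) = alive h" for h :: "('d ring \<times> bool) list"
    by (rule alive_flags) simp
  have D: "D F (flip_history i h) = D (\<lambda>h. F (flip_history i h)) h" for F h
    unfolding dead_op_def K alive ..
  have L: "(L ^^ k) F (flip_history i h) = (L ^^ k) (\<lambda>h. F (flip_history i h)) h" for F h k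
    by (induction k arbitrary: h) (simp_all add: live_op_def K alive cong: if_cong)
  have "tour mu p W k (coord i) = 0" for k
  proof -
    have "tour mu p W k (coord i) = tour mu p W k (\<lambda>h. coord i (flip_history i h))"
      using L[of k "D (coord i)" "[]"] by (simp add: tour_def D)
    also have "(\<lambda>h. coord i (flip_history i h)) = (\<lambda>h. (-1) * coord i h)"
    proof
      fix h :: "('d ring \<times> bool) list"
      have "map fst (flip_history i h) = map (flip_ring i) (map fst h)" by simp
      then show "coord i (flip_history i h) = (-1) * coord i h"
        unfolding coord_def by (simp only: endpoint_flip) (simp add: reflect_def)
    qed
    finally show ?thesis unfolding tour_cmult by simp
  qed
  then show ?thesis by (simp add: drift_def)
qed

section \<open>The law of the history given the rings\<close>

lemma indep_vars_PiM_components: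
  assumes M: "\<And>i. i \<in> I \<Longrightarrow> prob_space (M i)" and "I \<noteq> {}"
  shows "prob_space.indep_vars (PiM I M) M (\<lambda>i x. x i) I"
proof -
  interpret prob_space "PiM I M" by (intro prob_space_PiM M)
  have "distr (PiM I M) (PiM I M) (\<lambda>x. \<lambda>i\<in>I. x i) = distr (PiM I M) (PiM I M) (\<lambda>x. x)"
    by (rule distr_cong) (auto simp: space_PiM PiE_def extensional_restrict)
  also have "\<dots> = PiM I M" by (rule distr_id)
  also have "\<dots> = PiM I (\<lambda>i. distr (PiM I M) (M i) (\<lambda>x. x i))"
    by (intro PiM_cong refl distr_PiM_component[symmetric] M) auto
  finally show ?thesis
    by (subst indep_vars_iff_distr_eq_PiM'[OF \<open>I \<noteq> {}\<close>]) auto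
qed

text \<open>The common form of all uses of independence below: waiting times of the clock, refresh
  times of different edges, states and directions.\<close>

lemma integral_mult_disjoint_coordinates:
  fixes f g :: "('i \<Rightarrow> 'a) \<Rightarrow> real"
  assumes M: "\<And>i. i \<in> I \<Longrightarrow> prob_space (M i)" and "I \<noteq> {}"
    and f: "integrable (PiM I M) f" and g: "integrable (PiM I M) g"
    and AB: "A \<inter> B = {}" "A \<subseteq> I" "B \<subseteq> I"
    and fA: "\<And>x y. (\<And>i. i \<in> A \<Longrightarrow> x i = y i) \<Longrightarrow> f x = f y"
    and gB: "\<And>x y. (\<And>i. i \<in> B \<Longrightarrow> x i = y i) \<Longrightarrow> g x = g y"
  shows "(\<integral>x. f x * g x \<partial>PiM I M) = (\<integral>x. f x \<partial>PiM I M) * (\<integral>x. g x \<partial>PiM I M)"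
    and "integrable (PiM I M) (\<lambda>x. f x * g x)"
proof -
  interpret prob_space "PiM I M" by (intro prob_space_PiM M)
  obtain z where z: "z \<in> space (PiM I M)" using not_empty by blast
  \<comment> \<open>Filling the coordinates outside \<open>C\<close> from a fixed point
    \<open>z\<close> of the space lets \<open>f\<close> and \<open>g\<close> factor through
    restrictions, which are the independent objects.\<close>
  define ext where "ext C v = (\<lambda>i\<in>I. if i \<in> C then v i else z i)" for C and v :: "'i \<Rightarrow> 'a"
  have ext_measurable: "ext C \<in> measurable (PiM C M) (PiM I M)" if "C \<subseteq> I" for C
    unfolding ext_def
  proof (rule measurable_restrict)
    fix i assume "i \<in> I"
    then show "(\<lambda>v. if i \<in> C then v i else z i) \<in> measurable (PiM C M) (M i)"
      using z by (cases "i \<in> C") (auto simp: space_PiM intro!: measurable_const)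
  qed
  have f': "f \<circ> ext A \<circ> (\<lambda>\<omega>. restrict \<omega> A) = f"
    unfolding o_def using AB by (intro ext fA) (auto simp: ext_def)
  have g': "g \<circ> ext B \<circ> (\<lambda>\<omega>. restrict \<omega> B) = g"
    unfolding o_def using AB by (intro ext gB) (auto simp: ext_def)
  have "indep_var (PiM A M) (\<lambda>\<omega>. restrict (\<lambda>i. \<omega> i) A) (PiM B M) (\<lambda>\<omega>. restrict (\<lambda>i. \<omega> i) B)"
    by (rule indep_var_restrict[OF indep_vars_PiM_components]) (use M \<open>I \<noteq> {}\<close> AB in auto)
  then have "indep_var borel (f \<circ> ext A \<circ> (\<lambda>\<omega>. restrict \<omega> A)) borel (g \<circ> ext B \<circ> (\<lambda>\<omega>. restrict \<omega> B))"
    using ext_measurable AB f g by (intro indep_var_compose measurable_comp) auto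
  then have "indep_var borel f borel g" unfolding f' g' .
  then show "(\<integral>x. f x * g x \<partial>PiM I M) = (\<integral>x. f x \<partial>PiM I M) * (\<integral>x. g x \<partial>PiM I M)"
    "integrable (PiM I M) (\<lambda>x. f x * g x)"
    using f g by (rule indep_var_lebesgue_integral, rule indep_var_integrable)
qed

text \<open>
  Since its last examination at the \<open>i\<close>-th ring the edge has not been refreshed with probability
  \<open>exp (- mu * (T n - T i))\<close>, where \<open>T = arrival_time w\<close>.
\<close>

definition cond_prob ::
  "real \<Rightarrow> real \<Rightarrow> (nat \<Rightarrow> real) \<Rightarrow> 'd::finite ring list \<Rightarrow> 'd ring \<Rightarrow> real" where
  "cond_prob mu p w ys y =
     (case last_visit ys (examined_edge ys (fst y)) of
        None \<Rightarrow> status_prob p (snd y)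
      | Some (i, s') \<Rightarrow> status_prob p (snd y) + exp (- (mu * (arrival_time w (length ys) - arrival_time w i)))
          * (of_bool (snd y = s') - status_prob p (snd y)))"

primrec path_prob :: "real \<Rightarrow> real \<Rightarrow> (nat \<Rightarrow> real) \<Rightarrow> 'd::finite ring list \<Rightarrow> real" where
  "path_prob mu p w [] = 1"
| "path_prob mu p w (y # ys) = path_prob mu p w ys * cond_prob mu p w ys y"

primrec direction_prob :: "('d \<times> bool \<Rightarrow> real) \<Rightarrow> 'd::finite ring list \<Rightarrow> real" where
  "direction_prob W [] = 1"
| "direction_prob W (y # ys) = direction_prob W ys * W (fst y)"

text \<open>The tokens which may still matter: an examination consults only the latest visit of its
  edge.\<close>

primrec latest_visits :: "'d::finite ring list \<Rightarrow> nat set" where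
  "latest_visits [] = {}"
| "latest_visits (y # ys) = insert (length ys)
     (latest_visits ys - {i. \<exists>s. last_visit ys (examined_edge ys (fst y)) = Some (i, s)})"

lemma latest_visits_less: "latest_visits ys \<subseteq> {..<length ys}"
  by (induction ys) (auto simp: less_Suc_eq)

lemma last_visit_inj:
  "last_visit ys e = Some (i, s) \<Longrightarrow> last_visit ys e' = Some (i, s') \<Longrightarrow> e = e'"
  by (induction ys) (auto split: if_splits dest: last_visit_less)

lemma last_visit_latest: "last_visit ys e = Some (i, s) \<Longrightarrow> i \<in> latest_visits ys"
  by (induction ys) (auto split: if_splits dest: last_visit_inj)

abbreviation clock_space :: "(nat \<Rightarrow> real) measure" where
  "clock_space \<equiv> \<Pi>\<^sub>M n\<in>UNIV. waiting_time 1"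

lemma prob_space_clock: "prob_space clock_space"
  by (intro prob_space_PiM prob_space_waiting_time) simp

lemma measurable_arrival_time [measurable]:
  "(\<lambda>w. arrival_time w n) \<in> borel_measurable (\<Pi>\<^sub>M n\<in>UNIV. waiting_time r)"
  unfolding arrival_time_def by measurable

lemma measurable_path_prob [measurable]:
  "(\<lambda>w. path_prob mu p w ys) \<in> borel_measurable clock_space"
proof (induction ys)
  case (Cons y ys)
  note [measurable] = Cons
  show ?case
    by (cases "last_visit ys (examined_edge ys (fst y))")
      (auto simp: cond_prob_def split: prod.split)
qed simp

lemma AE_clock_pos: "AE w in clock_space. \<forall>n. w n > 0"
  unfolding AE_all_countable
  by (intro allI AE_PiM_component prob_space_waiting_time AE_waiting_time_pos) auto

lemma arrival_time_mono:
  assumes "\<And>n. w n \<ge> 0" "m \<le> n"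
  shows "arrival_time w m \<le> arrival_time w n"
  unfolding arrival_time_def using assms by (intro sum_mono2) auto

context ring_params
begin

lemma cond_prob_bounds:
  assumes "\<And>n. w n \<ge> 0"
  shows "cond_prob mu p w ys y \<in> {0..1}"
proof (cases "last_visit ys (examined_edge ys (fst y))")
  case None
  then show ?thesis using p_pos p_less_1 by (auto simp: cond_prob_def status_prob_def)
next
  case (Some vs)
  obtain i s' where vs: "vs = (i, s')" by (cases vs)
  have "arrival_time w i \<le> arrival_time w (length ys)"
    using last_visit_less[of ys _ i s'] Some vs by (intro arrival_time_mono assms) (auto simp: less_imp_le)
  then have q: "0 \<le> exp (- (mu * (arrival_time w (length ys) - arrival_time w i)))"
    "exp (- (mu * (arrival_time w (length ys) - arrival_time w i))) \<le> 1"
    using mu_pos by auto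
  define q where "q = exp (- (mu * (arrival_time w (length ys) - arrival_time w i)))"
  have "cond_prob mu p w ys y = (1 - q) * status_prob p (snd y) + q * of_bool (snd y = s')"
    using Some vs by (simp add: cond_prob_def q_def algebra_simps)
  moreover have "status_prob p (snd y) \<in> {0..1}" using p_pos p_less_1 by (auto simp: status_prob_def)
  ultimately show ?thesis
    using q convex_bound_le[of "status_prob p (snd y)" 1 "of_bool (snd y = s')" "1 - q" q]
    unfolding q_def[symmetric] by (auto intro!: add_nonneg_nonneg mult_nonneg_nonneg)
qed

lemma path_prob_bounds:
  assumes "\<And>n. w n \<ge> 0"
  shows "path_prob mu p w ys \<in> {0..1}"
proof (induction ys)
  case (Cons y ys)
  then show ?case
    using cond_prob_bounds[of w ys y] assms by (auto intro: mult_le_one)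
qed simp

lemma path_prob_cong:
  "(\<And>k. k < length ys \<Longrightarrow> w k = w' k) \<Longrightarrow> path_prob mu p w ys = path_prob mu p w' ys"
proof (induction ys)
  case (Cons y ys)
  have "arrival_time w i = arrival_time w' i" if "i \<le> length ys" for i
    unfolding arrival_time_def using Cons.prems that by (intro sum.cong) auto
  moreover have "path_prob mu p w ys = path_prob mu p w' ys"
    by (rule Cons.IH) (simp add: Cons.prems)
  ultimately show ?case
    by (auto simp: cond_prob_def split: option.split dest!: last_visit_less)
qed simp

text \<open>Given the clock, the probability that all tokens in \<open>B\<close> survive until the
  ring with index \<open>n\<close>.\<close>

definition survival :: "(nat \<Rightarrow> real) \<Rightarrow> nat \<Rightarrow> nat set \<Rightarrow> real" where
  "survival w n B = (\<Prod>i\<in>B. exp (- (mu * (arrival_time w n - arrival_time w i))))"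

lemma measurable_survival [measurable]: "(\<lambda>w. survival w n B) \<in> borel_measurable clock_space"
  unfolding survival_def by measurable

lemma survival_bounds:
  assumes "\<And>n. w n \<ge> 0" "B \<subseteq> {..n}"
  shows "survival w n B \<in> {0..1}"
proof -
  have "arrival_time w i \<le> arrival_time w n" if "i \<in> B" for i
    using assms that by (intro arrival_time_mono) auto
  then show ?thesis
    unfolding survival_def using mu_pos by (auto intro!: prod_nonneg prod_le_1)
qed

lemma survival_Suc:
  assumes "finite B"
  shows "survival w (Suc n) B = survival w n B * exp (- (mu * w (Suc n))) ^ card B"
  unfolding survival_def prod_constant[symmetric] prod.distrib[symmetric]
  by (rule prod.cong) (auto simp: arrival_time_def algebra_simps simp flip: exp_add)

text \<open>The token with index \<open>n\<close> is created at that very ring, and its factor is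
  \<open>exp 0\<close>.\<close>

lemma survival_remove: "survival w n (B - {n}) = survival w n B"
proof (cases "finite B")
  case True
  then show ?thesis unfolding survival_def
    by (intro prod.mono_neutral_left) auto
qed (simp add: survival_def)

lemma integrable_path_survival:
  assumes "B \<subseteq> {..n}"
  shows "integrable clock_space (\<lambda>w. path_prob mu p w ys * survival w n B)"
proof -
  interpret prob_space clock_space by (rule prob_space_clock)
  show ?thesis
  proof (rule integrable_const_bound)
    show "AE w in clock_space. norm (path_prob mu p w ys * survival w n B) \<le> 1"
      using AE_clock_pos
    proof eventually_elim
      case (elim w)
      then have w: "\<And>n. w n \<ge> 0" by (simp add: less_imp_le)
      show ?case
        using path_prob_bounds[of w ys] survival_bounds[of w B n] w assms
        by (auto simp: abs_mult intro!: mult_le_one)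
    qed
  qed simp
qed

lemma gap_subset_alive:
  assumes "finite B"
  shows "gap mu (\<lambda>h. of_bool (map fst h = zs \<and> B \<subseteq> alive h)) h
    = of_bool (map fst h = zs \<and> B \<subseteq> alive h) * (\<integral>r. exp (- (mu * r)) ^ card B \<partial>waiting_time 1)"
proof -
  have "thin q (\<lambda>h. of_bool (map fst h = zs \<and> B \<subseteq> alive h)) h
      = of_bool (map fst h = zs \<and> B \<subseteq> alive h) * q ^ card B" for q
  proof (cases "map fst h = zs")
    case True
    then have "thin q (\<lambda>h. of_bool (map fst h = zs \<and> B \<subseteq> alive h)) h
        = thin q (\<lambda>h. of_bool (B \<subseteq> alive h)) h"
      by (intro thin_cong) simp
    then show ?thesis using True by (simp add: thin_subset_alive[OF assms])
  next
    case False
    then have "thin q (\<lambda>h. of_bool (map fst h = zs \<and> B \<subseteq> alive h)) h = thin q (\<lambda>h. 0) h"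
      by (intro thin_cong) simp
    then show ?thesis using False by simp
  qed
  then show ?thesis by (simp add: gap_def)
qed

text \<open>The ring with index \<open>n\<close> occurs at the sum of the waiting times
  \<open>0..n\<close>. Everything up to it is therefore independent of the waiting time with index
  \<open>Suc n\<close>, which supplies the additional factor.\<close>

lemma integral_survival_Suc:
  assumes "B \<subseteq> {..length ys}" "length ys = n"
  shows "(\<integral>w. path_prob mu p w (y # ys) * survival w (Suc n) B \<partial>clock_space)
    = (\<integral>w. path_prob mu p w (y # ys) * survival w n B \<partial>clock_space)
        * (\<integral>r. exp (- (mu * r)) ^ card B \<partial>waiting_time 1)"
proof -
  interpret prob_space clock_space by (rule prob_space_clock)
  have B: "finite B" using assms finite_subset by blast
  let ?f = "\<lambda>w. path_prob mu p w (y # ys) * survival w n B"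
  let ?g = "\<lambda>w. exp (- (mu * w (Suc n))) ^ card B"
  have distr: "distr clock_space (waiting_time 1) (\<lambda>w. w (Suc n)) = waiting_time 1"
    by (rule distr_PiM_component) (auto intro: prob_space_waiting_time)
  have "(\<integral>w. path_prob mu p w (y # ys) * survival w (Suc n) B \<partial>clock_space) = (\<integral>w. ?f w * ?g w \<partial>clock_space)"
    unfolding survival_Suc[OF B] by (simp only: mult_ac)
  also have "\<dots> = (\<integral>w. ?f w \<partial>clock_space) * (\<integral>w. ?g w \<partial>clock_space)"
  proof (rule integral_mult_disjoint_coordinates(1)[where A = "{..n}" and B = "{Suc n}"])
    show "integrable clock_space ?f" using assms by (intro integrable_path_survival) auto
    show "integrable clock_space ?g"
    proof (rule integrable_const_bound)
      show "AE w in clock_space. norm (?g w) \<le> 1"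
        using AE_clock_pos
      proof eventually_elim
        case (elim w)
        then show ?case using mu_pos by (auto intro!: power_le_one simp: less_imp_le)
      qed
    qed measurable
  next
    fix w w' :: "nat \<Rightarrow> real"
    assume w: "\<And>i. i \<in> {..n} \<Longrightarrow> w i = w' i"
    have "arrival_time w i = arrival_time w' i" if "i \<le> n" for i
      unfolding arrival_time_def using w that by (intro sum.cong) auto
    then have "survival w n B = survival w' n B"
      unfolding survival_def using assms by (intro prod.cong) auto
    moreover have "path_prob mu p w (y # ys) = path_prob mu p w' (y # ys)"
      using assms by (intro path_prob_cong w) auto
    ultimately show "?f w = ?f w'" by simp
  qed (auto intro: prob_space_waiting_time)
  also have "(\<integral>w. ?g w \<partial>clock_space) = (\<integral>r. exp (- (mu * r)) ^ card B \<partial>distr clock_space (waiting_time 1) (\<lambda>w. w (Suc n)))"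
    by (subst integral_distr) auto
  finally show ?thesis unfolding distr .
qed

end

context ring_walk
begin

text \<open>
  Given the rings and the history, the tokens of the latest visits are independent, because none of
  them has been consulted yet.
\<close>

lemma K_pow_history:
  assumes "B \<subseteq> latest_visits ys"
  shows "(K ^^ length ys) (\<lambda>h. of_bool (map fst h = ys \<and> B \<subseteq> alive h)) []
    = direction_prob W ys * (\<integral>w. path_prob mu p w ys * survival w (length ys) B \<partial>clock_space)"
  using assms
proof (induction ys arbitrary: B)
  case Nil
  interpret prob_space clock_space by (rule prob_space_clock)
  show ?case using Nil prob_space by (simp add: survival_def)
next
  case (Cons y ys)
  obtain u s where y: "y = (u, s)" by (cases y)
  let ?n = "length ys" and ?c = "\<integral>r. exp (- (mu * r)) ^ card B \<partial>waiting_time 1"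
  let ?B = "B - {?n}" and ?lv = "last_visit ys (examined_edge ys u)"
  let ?F = "\<lambda>B h. of_bool (map fst h = ys \<and> B \<subseteq> alive h) :: real"
  let ?I = "\<lambda>B. \<integral>w. path_prob mu p w ys * survival w ?n B \<partial>clock_space"
  have B_le: "B \<subseteq> {..?n}" using order_trans[OF Cons.prems latest_visits_less]
    by (simp only: list.size lessThan_Suc_atMost add_0_right add_Suc_right)
  then have finB: "finite B" using finite_subset by blast
  have B: "?B \<subseteq> latest_visits ys" using Cons.prems by auto
  \<comment> \<open>The token of the new ring is alive when its waiting time begins, so requiring it
    costs nothing beforehand and only \<open>?B\<close> is asked of \<open>h\<close>; all of
    \<open>B\<close> must then survive the waiting time, with probability \<open>?c\<close>.\<close>
  have K: "K (\<lambda>h. of_bool (map fst h = y # ys \<and> B \<subseteq> alive h)) h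
      = W u * ?c * (?F ?B h * examine_prob p h u s)" for h
  proof -
    have "K (\<lambda>h. of_bool (map fst h = y # ys \<and> B \<subseteq> alive h)) h
        = (\<Sum>u'\<in>UNIV. W u' * (\<Sum>s'\<in>UNIV. examine_prob p h u' s'
            * (of_bool ((u', s') = y \<and> map fst h = ys \<and> B \<subseteq> insert (length h) (alive h)) * ?c)))"
      unfolding ring_op_def gap_subset_alive[OF finB] by simp
    also have "\<dots> = (\<Sum>u'\<in>UNIV. if u' = u then W u * (examine_prob p h u s
        * (of_bool (map fst h = ys \<and> B \<subseteq> insert (length h) (alive h)) * ?c)) else 0)"
    proof (intro sum.cong refl)
      fix u'
      show "W u' * (\<Sum>s'\<in>UNIV. examine_prob p h u' s'
            * (of_bool ((u', s') = y \<and> map fst h = ys \<and> B \<subseteq> insert (length h) (alive h)) * ?c))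
          = (if u' = u then W u * (examine_prob p h u s
              * (of_bool (map fst h = ys \<and> B \<subseteq> insert (length h) (alive h)) * ?c)) else 0)"
        by (cases "u' = u"; cases s) (simp_all add: y UNIV_bool)
    qed
    also have "\<dots> = W u * (examine_prob p h u s
        * (of_bool (map fst h = ys \<and> B \<subseteq> insert (length h) (alive h)) * ?c))"
      by simp
    also have "(map fst h = ys \<and> B \<subseteq> insert (length h) (alive h)) \<longleftrightarrow> (map fst h = ys \<and> ?B \<subseteq> alive h)"
      by auto
    finally show ?thesis by (simp add: mult_ac)
  qed
  have "(K ^^ length (y # ys)) (\<lambda>h. of_bool (map fst h = y # ys \<and> B \<subseteq> alive h)) []
      = (K ^^ ?n) (\<lambda>h. W u * ?c * (?F ?B h * examine_prob p h u s)) []"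
    by (simp only: list.size add_0_right add_Suc_right funpow_Suc_right o_apply K[THEN ext])
  also have "\<dots> = W u * ?c * (K ^^ ?n) (\<lambda>h. ?F ?B h * examine_prob p h u s) []"
    by (simp add: K_pow_cmult)
  also have "(K ^^ ?n) (\<lambda>h. ?F ?B h * examine_prob p h u s) []
      = direction_prob W ys * (\<integral>w. path_prob mu p w (y # ys) * survival w ?n ?B \<partial>clock_space)"
  proof (cases ?lv)
    case None
    have "(\<lambda>h. ?F ?B h * examine_prob p h u s) = (\<lambda>h. status_prob p s * ?F ?B h)"
      using None by (auto simp: examine_prob_def)
    then have "(K ^^ ?n) (\<lambda>h. ?F ?B h * examine_prob p h u s) [] = direction_prob W ys * (status_prob p s * ?I ?B)"
      by (simp add: K_pow_cmult Cons.IH[OF B])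
    also have "status_prob p s * ?I ?B = (\<integral>w. path_prob mu p w (y # ys) * survival w ?n ?B \<partial>clock_space)"
      using None by (simp add: cond_prob_def y mult_ac flip: integral_mult_right_zero)
    finally show ?thesis by (simp add: mult_ac)
  next
    case (Some vs)
    obtain i s' where vs: "vs = (i, s')" by (cases vs)
    have i: "i \<in> latest_visits ys" "i \<notin> ?B" "i < ?n"
      using Some Cons.prems last_visit_latest last_visit_less unfolding vs y by fastforce+
    let ?d = "of_bool (s = s') - status_prob p s"
    have iB: "insert i ?B \<subseteq> latest_visits ys" using i B by auto
    \<comment> \<open>The law of the state is affine in the indicator that the token
      \<open>i\<close> is alive, so a second event, with \<open>i\<close> added, appears; this
      forces the generality in \<open>B\<close>. The index \<open>i\<close> is not in
      \<open>?B\<close> because the present examination ends its role as a latest visit.\<close>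
    have "(\<lambda>h. ?F ?B h * examine_prob p h u s) = (\<lambda>h. status_prob p s * ?F ?B h + ?d * ?F (insert i ?B) h)"
      using Some vs by (auto simp: examine_prob_def)
    then have "(K ^^ ?n) (\<lambda>h. ?F ?B h * examine_prob p h u s) []
        = status_prob p s * (direction_prob W ys * ?I ?B) + ?d * (direction_prob W ys * ?I (insert i ?B))"
      by (simp only: K_pow_add K_pow_cmult Cons.IH[OF B] Cons.IH[OF iB])
    also have "\<dots> = direction_prob W ys * (status_prob p s * ?I ?B + ?d * ?I (insert i ?B))"
      by algebra
    also have "status_prob p s * ?I ?B + ?d * ?I (insert i ?B)
        = (\<integral>w. status_prob p s * (path_prob mu p w ys * survival w ?n ?B)
            + ?d * (path_prob mu p w ys * survival w ?n (insert i ?B)) \<partial>clock_space)"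
      using B_le i
      by (subst Bochner_Integration.integral_add) (auto intro!: integrable_mult_right integrable_path_survival)
    also have "\<dots> = (\<integral>w. path_prob mu p w (y # ys) * survival w ?n ?B \<partial>clock_space)"
    proof (intro Bochner_Integration.integral_cong refl)
      fix w
      have "survival w ?n (insert i ?B)
          = exp (- (mu * (arrival_time w ?n - arrival_time w i))) * survival w ?n ?B"
        unfolding survival_def using i finB by (subst prod.insert) auto
      then show "status_prob p s * (path_prob mu p w ys * survival w ?n ?B)
            + ?d * (path_prob mu p w ys * survival w ?n (insert i ?B))
          = path_prob mu p w (y # ys) * survival w ?n ?B"
        using Some vs by (simp add: cond_prob_def y algebra_simps)
    qed
    finally show ?thesis .
  qed
  also have "W u * ?c * (direction_prob W ys * (\<integral>w. path_prob mu p w (y # ys) * survival w ?n ?B \<partial>clock_space))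
      = direction_prob W (y # ys) * ((\<integral>w. path_prob mu p w (y # ys) * survival w ?n B \<partial>clock_space) * ?c)"
    by (simp add: survival_remove y mult_ac)
  also have "\<dots> = direction_prob W (y # ys)
      * (\<integral>w. path_prob mu p w (y # ys) * survival w (length (y # ys)) B \<partial>clock_space)"
    using integral_survival_Suc[OF B_le refl, of y] by simp
  finally show ?case .
qed

lemma K_pow_history_prob:
  "(K ^^ length ys) (\<lambda>h. of_bool (map fst h = ys)) []
    = direction_prob W ys * (\<integral>w. path_prob mu p w ys \<partial>clock_space)"
  using K_pow_history[of "{}" ys] by (simp add: survival_def)

end

section \<open>Void probabilities of the Poisson process\<close>

lemma integrable_waiting_time_bounded:
  fixes f :: "real \<Rightarrow> real"
  assumes "r > 0" "f \<in> borel_measurable borel" "\<And>x. \<bar>f x\<bar> \<le> C"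
  shows "integrable (waiting_time r) f"
proof -
  interpret prob_space "waiting_time r" using assms(1) by (rule prob_space_waiting_time)
  show ?thesis
    by (rule integrable_const_bound[where B = C]) (use assms in auto)
qed

lemma memoryless_integral:
  fixes f :: "real \<Rightarrow> real"
  assumes "r > 0" "d \<ge> 0" and [measurable]: "f \<in> borel_measurable borel"
  shows "(\<integral>x. of_bool (d \<le> x) * f x \<partial>waiting_time r) = exp (- (r * d)) * (\<integral>x. f (d + x) \<partial>waiting_time r)"
proof -
  have "(\<integral>x. of_bool (d \<le> x) * f x \<partial>waiting_time r)
      = (\<integral>x. exponential_density r x * (of_bool (d \<le> x) * f x) \<partial>lborel)"
    unfolding waiting_time_def using assms
    by (subst integral_density) (auto simp: exponential_density_def)
  also have "\<dots> = (\<integral>x. exponential_density r (d + x) * (of_bool (d \<le> d + x) * f (d + x)) \<partial>lborel)"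
    by (subst lborel_integral_real_affine[where c = 1 and t = d]) auto
  also have "\<dots> = (\<integral>x. exp (- (r * d)) * (exponential_density r x * f (d + x)) \<partial>lborel)"
    using assms by (intro Bochner_Integration.integral_cong refl)
      (auto simp: exponential_density_def algebra_simps simp flip: exp_add)
  also have "\<dots> = exp (- (r * d)) * (\<integral>x. f (d + x) \<partial>waiting_time r)"
    unfolding waiting_time_def using assms
    by (subst integral_density) (auto simp: exponential_density_def)
  finally show ?thesis .
qed

lemma arrival_time_case_nat:
  "arrival_time (case_nat x w) 0 = x" "arrival_time (case_nat x w) (Suc n) = x + arrival_time w n"
  by (simp_all add: arrival_time_def atMost_Suc_eq_insert_0 sum.reindex)

text \<open>The probability that a process started at time \<open>s\<close> has no point in
  \<open>U\<close>. Absence of refreshes from given intervals is what determines whether an examined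
  edge may be copied.\<close>

definition void_prob :: "real \<Rightarrow> real set \<Rightarrow> real \<Rightarrow> real" where
  "void_prob r U s = (\<integral>w. of_bool (\<forall>n. s + arrival_time w n \<notin> U) \<partial>(\<Pi>\<^sub>M n\<in>UNIV. waiting_time r))"

locale poisson =
  fixes r :: real
  assumes r_pos: "r > 0"
begin

abbreviation "S \<equiv> \<Pi>\<^sub>M n\<in>(UNIV :: nat set). waiting_time r"

sublocale gap: prob_space "waiting_time r"
  using r_pos by (rule prob_space_waiting_time)

sublocale seq: sequence_space "waiting_time r" ..

lemma AE_pos: "AE w in S. \<forall>n. w n > 0"
  unfolding AE_all_countable using r_pos
  by (intro allI AE_PiM_component prob_space_waiting_time AE_waiting_time_pos) auto

lemma void_measurable:
  assumes [measurable]: "U \<in> sets borel"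
  shows "(\<lambda>(s, w). of_bool (\<forall>n. s + arrival_time w n \<notin> U) :: real) \<in> borel_measurable (borel \<Otimes>\<^sub>M S)"
  by measurable

lemma void_measurable' [measurable]:
  assumes [measurable]: "U \<in> sets borel"
  shows "(\<lambda>w. of_bool (\<forall>n. s + arrival_time w n \<notin> U) :: real) \<in> borel_measurable S"
  by measurable

lemma void_prob_measurable [measurable]:
  assumes U: "U \<in> sets borel"
  shows "void_prob r U \<in> borel_measurable borel"
  unfolding void_prob_def[abs_def]
  by (rule seq.P.borel_measurable_lebesgue_integral[OF void_measurable[OF U]])

lemma void_prob_bounds: "void_prob r U s \<in> {0..1}"
proof -
  have "void_prob r U s \<le> (\<integral>w. 1 \<partial>S)" if "integrable S (\<lambda>w. of_bool (\<forall>n. s + arrival_time w n \<notin> U) :: real)"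
    unfolding void_prob_def using that by (intro integral_mono) auto
  \<comment> \<open>For a set \<open>U\<close> whose indicator is not integrable, the integral takes
    its default value 0, so the bounds hold for every \<open>U\<close>.\<close>
  moreover have "void_prob r U s = 0" if "\<not> integrable S (\<lambda>w. of_bool (\<forall>n. s + arrival_time w n \<notin> U) :: real)"
    unfolding void_prob_def using that by (rule not_integrable_integral_eq)
  moreover have "void_prob r U s \<ge> 0"
    unfolding void_prob_def by (intro Bochner_Integration.integral_nonneg) auto
  ultimately show ?thesis using seq.P.prob_space by fastforce
qed

text \<open>The sequence of gaps without its head is an independent copy of the whole sequence,
  which gives a renewal equation in the starting time.\<close>

lemma void_prob_first_gap:
  assumes U [measurable]: "U \<in> sets borel"
  shows "void_prob r U s = (\<integral>x. of_bool (s + x \<notin> U) * void_prob r U (s + x) \<partial>waiting_time r)"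
proof -
  let ?f = "\<lambda>w. of_bool (\<forall>n. s + arrival_time w n \<notin> U) :: real"
  interpret P: pair_prob_space "waiting_time r" S ..
  have "void_prob r U s = (\<integral>w. ?f w \<partial>distr (waiting_time r \<Otimes>\<^sub>M S) S (\<lambda>(x, w). case_nat x w))"
    unfolding void_prob_def seq.PiM_iter ..
  also have "\<dots> = (\<integral>z. ?f (case_nat (fst z) (snd z)) \<partial>(waiting_time r \<Otimes>\<^sub>M S))"
    by (subst integral_distr) (auto simp: case_prod_beta intro!: measurable_case_nat')
  also have "\<dots> = (\<integral>x. (\<integral>w. ?f (case_nat x w) \<partial>S) \<partial>waiting_time r)"
  proof (subst P.integral_fst'[symmetric])
    have "(\<lambda>z. case_nat (fst z) (snd z)) \<in> measurable (waiting_time r \<Otimes>\<^sub>M S) S"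
      by (rule measurable_case_nat') auto
    then have "(\<lambda>z. ?f (case_nat (fst z) (snd z))) \<in> borel_measurable (waiting_time r \<Otimes>\<^sub>M S)"
      by (rule measurable_compose[OF _ void_measurable'[OF U]])
    then show "integrable (waiting_time r \<Otimes>\<^sub>M S) (\<lambda>z. ?f (case_nat (fst z) (snd z)))"
      by (intro P.integrable_const_bound[where B = 1]) auto
  qed simp
  also have "\<dots> = (\<integral>x. of_bool (s + x \<notin> U) * void_prob r U (s + x) \<partial>waiting_time r)"
  proof (intro Bochner_Integration.integral_cong refl)
    fix x
    have "?f (case_nat x w) = of_bool (s + x \<notin> U) * of_bool (\<forall>n. s + x + arrival_time w n \<notin> U)" for w
    proof -
      have "(\<forall>n. s + arrival_time (case_nat x w) n \<notin> U)
          \<longleftrightarrow> s + x \<notin> U \<and> (\<forall>n. s + x + arrival_time w n \<notin> U)"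
      proof -
        have "(\<forall>n. Q n) \<longleftrightarrow> Q 0 \<and> (\<forall>n. Q (Suc n))" for Q :: "nat \<Rightarrow> bool"
          by (metis not0_implies_Suc)
        from this[of "\<lambda>n. s + arrival_time (case_nat x w) n \<notin> U"] show ?thesis
          unfolding arrival_time_case_nat add.assoc .
      qed
      then show ?thesis by simp
    qed
    then show "(\<integral>w. ?f (case_nat x w) \<partial>S) = of_bool (s + x \<notin> U) * void_prob r U (s + x)"
      by (simp add: void_prob_def)
  qed
  finally show ?thesis .
qed

lemma void_prob_integrable:
  assumes [measurable]: "U \<in> sets borel" "A \<in> sets borel"
  shows "integrable (waiting_time r) (\<lambda>x. of_bool (x \<in> A) * (of_bool (s + x \<notin> U) * void_prob r U (s + x)))"
proof (rule integrable_waiting_time_bounded[OF r_pos, where C = 1])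
  show "\<bar>of_bool (x \<in> A) * (of_bool (s + x \<notin> U) * void_prob r U (s + x))\<bar> \<le> 1" for x
    using void_prob_bounds[of U "s + x"] by auto
qed measurable

text \<open>
  The difference of the two sides, as a function of the starting time \<open>s\<close>, is contracted by the
  first-gap equation.
\<close>

lemma void_prob_start:
  assumes U: "U \<in> sets borel" "U \<subseteq> {c<..}" and "s \<le> c"
  shows "void_prob r U s = void_prob r U c"
proof -
  \<comment> \<open>The probability that a gap beginning at \<open>s\<close> ends before
    \<open>c\<close>; it bounds the same probability for every later start
    \<open>t \<le> c\<close>.\<close>
  define q where "q = 1 - exp (- (r * (c - s)))"
  have q: "0 \<le> q" "q < 1" using \<open>s \<le> c\<close> r_pos by (auto simp: q_def)
  let ?D = "\<lambda>t. void_prob r U t - void_prob r U c"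
  note [measurable] = U(1)
  have cdf: "(\<integral>x. of_bool (x < d) \<partial>waiting_time r) = 1 - exp (- (r * d))" if "d \<ge> 0" for d
  proof -
    have "(\<integral>x. of_bool (d \<le> x) * 1 \<partial>waiting_time r) = exp (- (r * d)) * (\<integral>x. 1 \<partial>waiting_time r)"
      using that r_pos by (intro memoryless_integral) auto
    moreover have "(\<integral>x. of_bool (x < d) \<partial>waiting_time r) = (\<integral>x. 1 - of_bool (d \<le> x) \<partial>waiting_time r :: real)"
      by (intro Bochner_Integration.integral_cong) auto
    moreover have "(\<integral>x. 1 - of_bool (d \<le> x) \<partial>waiting_time r :: real)
        = (\<integral>x. 1 \<partial>waiting_time r) - (\<integral>x. of_bool (d \<le> x) \<partial>waiting_time r :: real)"
      by (intro Bochner_Integration.integral_diff gap.integrable_const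
          integrable_waiting_time_bounded[OF r_pos, where C = 1]) auto
    moreover have "(\<integral>x. 1 \<partial>waiting_time r) = (1 :: real)" using gap.prob_space by simp
    ultimately show ?thesis by (simp only: mult_1_right)
  qed
  \<comment> \<open>A gap which passes \<open>c\<close> restarts there by lack of memory and
    contributes no difference; a shorter one leads to \<open>t + x\<close>, where the set
    \<open>U\<close> has not been reached yet.\<close>
  have step: "?D t = (\<integral>x. of_bool (x < c - t) * ?D (t + x) \<partial>waiting_time r)" if "t \<le> c" for t
  proof -
    let ?g = "\<lambda>x. of_bool (t + x \<notin> U) * void_prob r U (t + x)"
    have int: "integrable (waiting_time r) (\<lambda>x. of_bool (P x) * ?g x)" if "{x. P x} \<in> sets borel" for P
      using void_prob_integrable[OF U(1) that, of t] by simp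
    have "void_prob r U t = (\<integral>x. of_bool (x < c - t) * ?g x + of_bool (c - t \<le> x) * ?g x \<partial>waiting_time r)"
      unfolding void_prob_first_gap[OF U(1), of t]
      by (intro Bochner_Integration.integral_cong refl) auto
    also have "\<dots> = (\<integral>x. of_bool (x < c - t) * ?g x \<partial>waiting_time r)
        + (\<integral>x. of_bool (c - t \<le> x) * ?g x \<partial>waiting_time r)"
      by (intro Bochner_Integration.integral_add int) auto
    also have "(\<integral>x. of_bool (c - t \<le> x) * ?g x \<partial>waiting_time r)
        = exp (- (r * (c - t))) * (\<integral>x. ?g (c - t + x) \<partial>waiting_time r)"
      using that r_pos by (intro memoryless_integral) auto
    also have "(\<integral>x. ?g (c - t + x) \<partial>waiting_time r) = void_prob r U c"
      unfolding void_prob_first_gap[OF U(1), of c] by (simp add: algebra_simps)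
    also have "(\<integral>x. of_bool (x < c - t) * ?g x \<partial>waiting_time r)
        = (\<integral>x. of_bool (x < c - t) * ?D (t + x) + void_prob r U c * of_bool (x < c - t) \<partial>waiting_time r)"
      using U(2) by (intro Bochner_Integration.integral_cong refl) (auto simp: algebra_simps)
    also have "\<dots> = (\<integral>x. of_bool (x < c - t) * ?D (t + x) \<partial>waiting_time r)
        + void_prob r U c * (\<integral>x. of_bool (x < c - t) \<partial>waiting_time r)"
    proof (subst Bochner_Integration.integral_add)
      show "integrable (waiting_time r) (\<lambda>x. of_bool (x < c - t) * ?D (t + x))"
      proof (rule integrable_waiting_time_bounded[OF r_pos, where C = 1])
        show "\<bar>of_bool (x < c - t) * ?D (t + x)\<bar> \<le> 1" for x
          using void_prob_bounds[of U "t + x"] void_prob_bounds[of U c] by auto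
      qed measurable
      show "integrable (waiting_time r) (\<lambda>x. void_prob r U c * of_bool (x < c - t))"
        by (intro integrable_mult_right integrable_waiting_time_bounded[OF r_pos, where C = 1]) auto
    qed simp
    also have "(\<integral>x. of_bool (x < c - t) \<partial>waiting_time r) = 1 - exp (- (r * (c - t)))"
      using that by (intro cdf) simp
    finally show ?thesis by (simp only: right_diff_distrib mult_1_right mult.commute)
  qed
  have bound: "\<bar>?D t\<bar> \<le> q ^ n" if "s \<le> t" "t \<le> c" for n t
    using that
  proof (induction n arbitrary: t)
    case 0
    then show ?case using void_prob_bounds[of U t] void_prob_bounds[of U c] by auto
  next
    case (Suc n)
    have "\<bar>?D t\<bar> \<le> (\<integral>x. \<bar>of_bool (x < c - t) * ?D (t + x)\<bar> \<partial>waiting_time r)"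
      unfolding step[OF Suc.prems(2)] by (rule integral_abs_bound)
    also have "\<dots> \<le> (\<integral>x. q ^ n * of_bool (x < c - t) \<partial>waiting_time r)"
    proof (rule integral_mono_AE)
      show "integrable (waiting_time r) (\<lambda>x. \<bar>of_bool (x < c - t) * ?D (t + x)\<bar>)"
      proof (rule integrable_waiting_time_bounded[OF r_pos, where C = 1])
        show "\<bar>\<bar>of_bool (x < c - t) * ?D (t + x)\<bar>\<bar> \<le> 1" for x
          using void_prob_bounds[of U "t + x"] void_prob_bounds[of U c] by auto
      qed measurable
      show "integrable (waiting_time r) (\<lambda>x. q ^ n * of_bool (x < c - t))"
        by (intro integrable_mult_right integrable_waiting_time_bounded[OF r_pos, where C = 1]) auto
      show "AE x in waiting_time r. \<bar>of_bool (x < c - t) * ?D (t + x)\<bar> \<le> q ^ n * of_bool (x < c - t)"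
        using AE_waiting_time_pos[OF r_pos]
      proof eventually_elim
        case (elim x)
        then show ?case using Suc.IH[of "t + x"] Suc.prems by (cases "x < c - t") auto
      qed
    qed
    also have "\<dots> = q ^ n * (1 - exp (- (r * (c - t))))"
      using cdf[of "c - t"] Suc.prems by simp
    also have "\<dots> \<le> q ^ n * q"
      using Suc.prems q r_pos unfolding q_def by (intro mult_left_mono) auto
    finally show ?case by (simp add: mult.commute)
  qed
  have "(\<lambda>n. q ^ n) \<longlonglongrightarrow> 0" using q by (intro LIMSEQ_power_zero) auto
  then have "\<bar>?D s\<bar> \<le> 0"
    by (rule LIMSEQ_le_const) (use bound[of s] \<open>s \<le> c\<close> in auto)
  then show ?thesis by simp
qed

text \<open>The process may be started at \<open>a\<close>; its first gap has to exceed
  \<open>b - a\<close>, and by lack of memory it then starts anew at \<open>b\<close>. The half-open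
  interval fits \<open>num_arrivals\<close>, which counts the points up to and including a
  time.\<close>

lemma void_prob_interval:
  assumes U: "U \<in> sets borel" "U \<subseteq> {b<..}" and ab: "0 \<le> a" "a \<le> b"
  shows "void_prob r ({a<..b} \<union> U) 0 = exp (- (r * (b - a))) * void_prob r U 0"
proof -
  let ?U = "{a<..b} \<union> U"
  have U' [measurable]: "?U \<in> sets borel" using U by auto
  note [measurable] = U(1)
  let ?g = "\<lambda>x. of_bool (a + x \<notin> ?U) * void_prob r ?U (a + x)"
  have "void_prob r ?U 0 = void_prob r ?U a"
    using U ab by (intro void_prob_start U') auto
  also have "\<dots> = (\<integral>x. ?g x \<partial>waiting_time r)" by (rule void_prob_first_gap[OF U'])
  also have "\<dots> = (\<integral>x. of_bool (b - a \<le> x) * ?g x \<partial>waiting_time r)"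
  proof (rule integral_cong_AE)
    show "AE x in waiting_time r. ?g x = of_bool (b - a \<le> x) * ?g x"
      using AE_waiting_time_pos[OF r_pos] by eventually_elim auto
  qed measurable
  also have "\<dots> = exp (- (r * (b - a))) * (\<integral>x. ?g (b - a + x) \<partial>waiting_time r)"
    using ab r_pos by (intro memoryless_integral) auto
  also have "(\<integral>x. ?g (b - a + x) \<partial>waiting_time r)
      = (\<integral>x. of_bool (b + x \<notin> U) * void_prob r U (b + x) \<partial>waiting_time r)"
  proof (rule integral_cong_AE)
    have eq: "void_prob r ?U t = void_prob r U t" if "b \<le> t" for t
      unfolding void_prob_def
    proof (rule integral_cong_AE)
      show "AE w in S. (of_bool (\<forall>n. t + arrival_time w n \<notin> ?U) :: real) = of_bool (\<forall>n. t + arrival_time w n \<notin> U)"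
        using AE_pos
      proof eventually_elim
        case (elim w)
        then have "arrival_time w n > 0" for n
          unfolding arrival_time_def by (intro sum_pos) auto
        then have "t + arrival_time w n > b" for n using that 
            by (smt (verit))
        then show ?case by (simp add: not_le[symmetric])
      qed
    qed measurable
    show "AE x in waiting_time r. ?g (b - a + x) = of_bool (b + x \<notin> U) * void_prob r U (b + x)"
      using AE_waiting_time_pos[OF r_pos] by eventually_elim (auto simp: eq)
  qed measurable
  also have "\<dots> = void_prob r U b" by (rule void_prob_first_gap[OF U(1), symmetric])
  also have "void_prob r U b = void_prob r U 0"
    using U ab by (intro void_prob_start[symmetric]) auto
  finally show ?thesis .
qed

lemma void_prob_empty [simp]: "void_prob r {} s = 1"
  using seq.P.prob_space by (simp add: void_prob_def)

text \<open>If all points stay below \<open>t\<close>, the set \<open>{t<..}\<close> is void;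
  cutting an interval of length \<open>m\<close> off that set shows that its void probability is at
  most \<open>exp (- r) ^ m\<close>, for every \<open>m\<close>.\<close>

lemma AE_arrivals_finite: "AE w in S. \<forall>t. finite {n. arrival_time w n \<le> t}"
proof -
  have 0: "void_prob r {t<..} 0 = 0" if "t \<ge> 0" for t
  proof -
    have "\<bar>void_prob r {t<..} 0\<bar> \<le> exp (- r) ^ m" for m
    proof -
      have "{t<..} = {t<..t + real m} \<union> {t + real m<..}" by auto
      then have "void_prob r {t<..} 0 = exp (- (r * real m)) * void_prob r {t + real m<..} 0"
        using void_prob_interval[of "{t + real m<..}" "t + real m" t] that by simp
      also have "\<bar>\<dots>\<bar> \<le> exp (- (r * real m)) * 1"
        using void_prob_bounds[of "{t + real m<..}" 0] by (simp add: abs_mult)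
      also have "\<dots> = exp (- r) ^ m" by (simp add: mult.commute flip: exp_of_nat_mult)
      finally show ?thesis .
    qed
    moreover have "(\<lambda>m. exp (- r) ^ m) \<longlonglongrightarrow> 0"
      using r_pos by (intro LIMSEQ_power_zero) auto
    ultimately have "\<bar>void_prob r {t<..} 0\<bar> \<le> 0"
      by (intro LIMSEQ_le_const[of "\<lambda>m. exp (- r) ^ m"]) auto
    then show ?thesis by simp
  qed
  have "AE w in S. \<exists>n. arrival_time w n > real t" for t
  proof -
    have "AE w in S. of_bool (\<forall>n. 0 + arrival_time w n \<notin> {real t<..}) = (0 :: real)"
    proof (subst integral_nonneg_eq_0_iff_AE[symmetric])
      show "integrable S (\<lambda>w. of_bool (\<forall>n. 0 + arrival_time w n \<notin> {real t<..}) :: real)"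
        by (rule seq.P.integrable_const_bound[where B = 1]) auto
      show "(\<integral>w. of_bool (\<forall>n. 0 + arrival_time w n \<notin> {real t<..}) \<partial>S) = (0 :: real)"
        using 0[of "real t"] unfolding void_prob_def by simp
    qed auto
    then show ?thesis by eventually_elim (auto split: if_splits)
  qed
  then have "AE w in S. \<forall>t. \<exists>n. arrival_time w n > real t"
    by (simp add: AE_all_countable)
  then show ?thesis
    using AE_pos
  proof eventually_elim
    case (elim w)
    show ?case
    proof
      fix t :: real
      obtain n where n: "arrival_time w n > real (nat \<lceil>t\<rceil>)" using elim(1) by blast
      have "m < n" if "arrival_time w m \<le> t" for m
      proof (rule ccontr)
        assume "\<not> m < n"
        then have "arrival_time w n \<le> arrival_time w m"
          using elim(2) by (intro arrival_time_mono) (auto simp: less_imp_le)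
        then show False using n that real_nat_ceiling_ge[of t] by linarith
      qed
      then have "{n. arrival_time w n \<le> t} \<subseteq> {..<n}" by auto
      then show "finite {n. arrival_time w n \<le> t}" by (rule finite_subset) simp
    qed
  qed
qed

end

section \<open>The graphical construction\<close>

abbreviation refresh_space :: "'d::finite itself \<Rightarrow> real \<Rightarrow> ((int ^ 'd) set \<times> nat \<Rightarrow> real) measure" where
  "refresh_space _ mu \<equiv> \<Pi>\<^sub>M i\<in>(lattice_edges :: (int ^ 'd) set set) \<times> UNIV. waiting_time mu"

abbreviation state_space :: "'d::finite itself \<Rightarrow> real \<Rightarrow> ((int ^ 'd) set \<times> nat \<Rightarrow> bool) measure" where
  "state_space _ p \<equiv> \<Pi>\<^sub>M i\<in>(lattice_edges :: (int ^ 'd) set set) \<times> UNIV. measure_pmf (bernoulli_pmf p)"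

lemma examined_edge_lattice: "examined_edge ys u \<in> lattice_edges"
  unfolding examined_edge_def by (rule unit_step_edge)

lemma lattice_edges_nonempty: "(lattice_edges :: (int ^ 'd::finite) set set) \<noteq> {}"
  using unit_step_edge[of 0 undefined] by blast

lemma countable_lattice_edges: "countable (lattice_edges :: (int ^ 'd::finite) set set)"
proof -
  have "lattice_edges \<subseteq> (\<lambda>(x, y). {x, y}) ` (UNIV :: ((int ^ 'd) \<times> (int ^ 'd)) set)"
    by (auto simp: lattice_edges_def)
  moreover have "countable (UNIV :: (int ^ 'd) set)"
  proof (rule countable_image_inj_on)
    show "inj (vec_nth :: int ^ 'd \<Rightarrow> _)" by (simp add: inj_def vec_nth_inject)
    show "countable (range (vec_nth :: int ^ 'd \<Rightarrow> 'd \<Rightarrow> int))" by simp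
  qed
  then have "countable (UNIV :: ((int ^ 'd) \<times> (int ^ 'd)) set)"
    by (metis UNIV_Times_UNIV countable_SIGMA)
  ultimately show ?thesis by (meson countable_image countable_subset)
qed

abbreviation edge_time :: "((int ^ 'd::finite) set \<times> nat \<Rightarrow> real) \<Rightarrow> (int ^ 'd) set \<Rightarrow> nat \<Rightarrow> real" where
  "edge_time g e \<equiv> arrival_time (\<lambda>k. g (e, k))"

lemma edge_time_measurable [measurable]:
  fixes e :: "(int ^ 'd::finite) set"
  assumes "e \<in> lattice_edges"
  shows "(\<lambda>g. edge_time g e n) \<in> borel_measurable (refresh_space TYPE('d) mu)"
proof -
  have [measurable]: "(\<lambda>g. g (e, k)) \<in> borel_measurable (refresh_space TYPE('d) mu)" for k
    using measurable_component_singleton[of "(e, k)" "lattice_edges \<times> UNIV" "\<lambda>_. waiting_time mu"] assms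
    by simp
  show ?thesis unfolding arrival_time_def by measurable
qed

context ring_params
begin

sublocale poisson mu by standard (rule mu_pos)

lemma edge_marginal:
  fixes e :: "(int ^ 'd::finite) set"
  assumes e: "e \<in> lattice_edges"
  shows "distr (refresh_space TYPE('d) mu) S (\<lambda>g k. g (e, k)) = S"
proof -
  have "distr (refresh_space TYPE('d) mu) (\<Pi>\<^sub>M k\<in>UNIV. waiting_time mu) (\<lambda>g. \<lambda>k\<in>UNIV. g (e, k)) = S"
    by (rule distr_PiM_reindex[where f = "\<lambda>k. (e, k)"])
      (use e mu_pos in \<open>auto intro: prob_space_waiting_time simp: inj_on_def\<close>)
  then show ?thesis by (simp add: restrict_def)
qed

lemma edge_process_measurable:
  fixes e :: "(int ^ 'd::finite) set"
  assumes e: "e \<in> lattice_edges"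
  shows "(\<lambda>g k. g (e, k)) \<in> measurable (refresh_space TYPE('d) mu) S"
proof (rule measurable_PiM_single')
  fix k :: nat
  show "(\<lambda>g. g (e, k)) \<in> measurable (refresh_space TYPE('d) mu) (waiting_time mu)"
    by (rule measurable_component_singleton) (use e in simp)
qed (simp add: space_PiM)

lemma edges_void_measurable:
  fixes A :: "(int ^ 'd::finite) set set"
  assumes "finite A" "A \<subseteq> lattice_edges" and U: "\<And>e. e \<in> A \<Longrightarrow> U e \<in> sets borel"
  shows "(\<lambda>g. of_bool (\<forall>e\<in>A. \<forall>n. edge_time g e n \<notin> U e) :: real)
    \<in> borel_measurable (refresh_space TYPE('d) mu)"
proof -
  let ?G = "refresh_space TYPE('d) mu"
  have "{g \<in> space ?G. \<forall>e\<in>A. \<forall>n. edge_time g e n \<notin> U e} \<in> sets ?G"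
  proof (intro sets.sets_Collect_finite_All sets.sets_Collect_countable_All \<open>finite A\<close>)
    fix e n assume "e \<in> A"
    then have [measurable]: "(\<lambda>g. edge_time g e n) \<in> borel_measurable ?G" "U e \<in> sets borel"
      using assms by (auto intro!: edge_time_measurable)
    show "{g \<in> space ?G. edge_time g e n \<notin> U e} \<in> sets ?G" by measurable
  qed
  then show ?thesis by simp
qed

lemma edges_void_prob:
  fixes A :: "(int ^ 'd::finite) set set"
  assumes "finite A" "A \<subseteq> lattice_edges" and U: "\<And>e. e \<in> A \<Longrightarrow> U e \<in> sets borel"
  shows "(\<integral>g. of_bool (\<forall>e\<in>A. \<forall>n. edge_time g e n \<notin> U e) \<partial>refresh_space TYPE('d) mu)
    = (\<Prod>e\<in>A. void_prob mu (U e) 0)"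
  using assms
proof (induction A rule: finite_induct)
  case empty
  interpret G: prob_space "refresh_space TYPE('d) mu"
    using mu_pos by (intro prob_space_PiM prob_space_waiting_time)
  show ?case using G.prob_space by simp
next
  case (insert e A)
  let ?G = "refresh_space TYPE('d) mu"
  interpret G: prob_space ?G
    using mu_pos by (intro prob_space_PiM prob_space_waiting_time)
  let ?f = "\<lambda>g. of_bool (\<forall>e\<in>A. \<forall>n. edge_time g e n \<notin> U e) :: real"
  let ?h = "\<lambda>w. of_bool (\<forall>n. 0 + arrival_time w n \<notin> U e) :: real"
  let ?g = "\<lambda>g. ?h (\<lambda>k. g (e, k))"
  have e: "e \<in> lattice_edges" using insert.prems by auto
  have [measurable]: "U e \<in> sets borel" using insert.prems by auto
  have h: "?h \<in> borel_measurable S" by (rule void_measurable') fact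
  have f_meas: "?f \<in> borel_measurable ?G"
    using insert by (intro edges_void_measurable) auto
  have g_meas: "?g \<in> borel_measurable ?G"
    by (rule measurable_compose[OF edge_process_measurable[OF e] h])
  have "(\<integral>g. of_bool (\<forall>e\<in>insert e A. \<forall>n. edge_time g e n \<notin> U e) \<partial>?G) = (\<integral>g. ?f g * ?g g \<partial>?G)"
    by (intro Bochner_Integration.integral_cong refl) auto
  also have "\<dots> = (\<integral>g. ?f g \<partial>?G) * (\<integral>g. ?g g \<partial>?G)"
  proof (rule integral_mult_disjoint_coordinates(1)[where A = "A \<times> UNIV" and B = "{e} \<times> UNIV"])
    show "integrable ?G ?f" "integrable ?G ?g"
      using f_meas g_meas by (auto intro!: G.integrable_const_bound[where B = 1])
  next
    fix x y :: "(int ^ 'd) set \<times> nat \<Rightarrow> real"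
    assume "\<And>i. i \<in> A \<times> UNIV \<Longrightarrow> x i = y i"
    then have "edge_time x e n = edge_time y e n" if "e \<in> A" for e n
      using that by (simp add: arrival_time_def)
    then show "?f x = ?f y" by simp
  next
    fix x y :: "(int ^ 'd) set \<times> nat \<Rightarrow> real"
    assume "\<And>i. i \<in> {e} \<times> UNIV \<Longrightarrow> x i = y i"
    then have "edge_time x e n = edge_time y e n" for n
      by (simp add: arrival_time_def)
    then show "?g x = ?g y" by simp
  qed (use insert lattice_edges_nonempty mu_pos in \<open>auto intro: prob_space_waiting_time\<close>)
  also have "(\<integral>g. ?f g \<partial>?G) = (\<Prod>e\<in>A. void_prob mu (U e) 0)"
    using insert by auto
  also have "(\<integral>g. ?g g \<partial>?G) = (\<integral>w. ?h w \<partial>distr ?G S (\<lambda>g k. g (e, k)))"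
    by (rule integral_distr[symmetric, OF edge_process_measurable[OF e] h])
  also have "\<dots> = void_prob mu (U e) 0"
    unfolding edge_marginal[OF e] void_prob_def ..
  finally show ?case using insert.hyps by (simp add: mult.commute)
qed

text \<open>
  \<open>env_prob\<close> is the conditional probability of the examined states given the refresh times
  \<open>g\<close> and the rings \<open>w\<close>; \<open>quiet\<close> says that \<open>e\<close> is not refreshed between two rings.
\<close>

definition quiet :: "(nat \<Rightarrow> real) \<Rightarrow> ((int ^ 'd::finite) set \<times> nat \<Rightarrow> real) \<Rightarrow> (int ^ 'd) set \<Rightarrow> nat \<Rightarrow> nat \<Rightarrow> bool" where
  "quiet w g e i n \<longleftrightarrow> (\<forall>k. edge_time g e k \<notin> {arrival_time w i<..arrival_time w n})"

definition env_factor where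
  "env_factor w g ys y =
     (case last_visit ys (examined_edge ys (fst y)) of
        None \<Rightarrow> status_prob p (snd y)
      | Some (i, s') \<Rightarrow> status_prob p (snd y) + of_bool (quiet w g (examined_edge ys (fst y)) i (length ys))
          * (of_bool (snd y = s') - status_prob p (snd y)))"

primrec env_prob where
  "env_prob w g [] = 1"
| "env_prob w g (y # ys) = env_prob w g ys * env_factor w g ys y"

lemma env_factor_bounds: "env_factor w g ys y \<in> {0..1}"
  using p_pos p_less_1 by (auto simp: env_factor_def status_prob_def split: option.split)

lemma env_prob_bounds: "env_prob w g ys \<in> {0..1}"
proof (induction ys)
  case (Cons y ys)
  then show ?case using env_factor_bounds[of w g ys y] by (auto intro: mult_le_one)
qed simp

lemma pred_quiet [measurable]:
  fixes e :: "(int ^ 'd::finite) set"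
  assumes "e \<in> lattice_edges"
  shows "Measurable.pred (clock_space \<Otimes>\<^sub>M refresh_space TYPE('d) mu) (\<lambda>z. quiet (fst z) (snd z) e i n)"
proof -
  note [measurable] = edge_time_measurable[OF assms]
  have [measurable]: "(\<lambda>z. edge_time (snd z) e k) \<in> borel_measurable (clock_space \<Otimes>\<^sub>M refresh_space TYPE('d) mu)" for k
    by (rule measurable_compose[OF measurable_snd]) measurable
  have [measurable]: "(\<lambda>z. arrival_time (fst z) k) \<in> borel_measurable (clock_space \<Otimes>\<^sub>M refresh_space TYPE('d) mu)" for k
    by (rule measurable_compose[OF measurable_fst]) measurable
  show ?thesis unfolding quiet_def greaterThanAtMost_iff by measurable
qed

lemma env_prob_measurable [measurable]:
  "(\<lambda>z. env_prob (fst z) (snd z) ys) \<in> borel_measurable (clock_space \<Otimes>\<^sub>M refresh_space TYPE('d::finite) mu)"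
proof (induction ys)
  case (Cons y ys)
  note [measurable] = Cons pred_quiet[OF examined_edge_lattice[of ys "fst y"]]
  show ?case
    by (cases "last_visit ys (examined_edge ys (fst y))")
      (auto simp: env_factor_def split: prod.split)
qed simp

lemma env_prob_measurable_refresh:
  "(\<lambda>g. env_prob w g ys) \<in> borel_measurable (refresh_space TYPE('d::finite) mu)"
  using measurable_compose[OF measurable_Pair1' env_prob_measurable, of w ys] by (simp add: space_PiM)

lemma integrable_env_prob_void:
  fixes ys :: "'d::finite ring list"
  assumes "finite A" "A \<subseteq> lattice_edges" and U: "\<And>e. e \<in> A \<Longrightarrow> U e \<in> sets borel"
  shows "integrable (refresh_space TYPE('d) mu)
    (\<lambda>g. env_prob w g ys * of_bool (\<forall>e\<in>A. \<forall>n. edge_time g e n \<notin> U e))"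
proof -
  interpret G: prob_space "refresh_space TYPE('d) mu"
    using mu_pos by (intro prob_space_PiM prob_space_waiting_time)
  show ?thesis
  proof (rule G.integrable_const_bound[where B = 1])
    show "AE g in refresh_space TYPE('d) mu.
        norm (env_prob w g ys * of_bool (\<forall>e\<in>A. \<forall>n. edge_time g e n \<notin> U e)) \<le> 1"
      using env_prob_bounds[of w _ ys] by (intro AE_I2) (auto simp: abs_mult)
  qed (intro borel_measurable_times env_prob_measurable_refresh edges_void_measurable assms)
qed

text \<open>
  The void events carry the induction: a quiet factor of \<open>env_prob\<close> is absorbed by adding an
  interval to \<open>U\<close> at the examined edge.
\<close>

lemma integral_env_prob_void:
  fixes ys :: "'d::finite ring list"
  assumes w: "\<And>n. w n \<ge> 0"
    and A: "finite A" "A \<subseteq> lattice_edges"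
    and U: "\<And>e. e \<in> A \<Longrightarrow> U e \<in> sets borel"
    and U_after: "\<And>e i s. e \<in> A \<Longrightarrow> last_visit ys e = Some (i, s) \<Longrightarrow> U e \<subseteq> {arrival_time w i<..}"
  shows "(\<integral>g. env_prob w g ys * of_bool (\<forall>e\<in>A. \<forall>n. edge_time g e n \<notin> U e) \<partial>refresh_space TYPE('d) mu)
      = path_prob mu p w ys * (\<Prod>e\<in>A. void_prob mu (U e) 0)"
  using A U U_after
proof (induction ys arbitrary: A U)
  case Nil
  then show ?case by (simp add: edges_void_prob)
next
  case (Cons y ys)
  let ?G = "refresh_space TYPE('d) mu"
  let ?e = "examined_edge ys (fst y)" and ?T = "arrival_time w" and ?n = "length ys"
  let ?V = "\<lambda>A U g. of_bool (\<forall>e\<in>A. \<forall>n. edge_time g e n \<notin> U e) :: real"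
  have mono: "?T i \<le> ?T j" if "i \<le> j" for i j
    using w that by (rule arrival_time_mono)
  have after: "U e \<subseteq> {?T i<..}" if "e \<in> A" "last_visit ys e = Some (i, s)" for e i s
  proof (cases "e = ?e")
    case True
    then have "U e \<subseteq> {?T ?n<..}" using Cons.prems(4)[of e ?n "snd y"] that by simp
    then show ?thesis using mono[of i ?n] last_visit_less[OF that(2)] by fastforce
  next
    case False
    then show ?thesis using Cons.prems(4)[of e i s] that by simp
  qed
  have IH: "(\<integral>g. env_prob w g ys * ?V A U g \<partial>?G) = path_prob mu p w ys * (\<Prod>e\<in>A. void_prob mu (U e) 0)"
    by (intro Cons.IH Cons.prems after)
  show ?case
  proof (cases "last_visit ys ?e")
    case None
    have "(\<integral>g. env_prob w g (y # ys) * ?V A U g \<partial>?G)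
        = (\<integral>g. status_prob p (snd y) * (env_prob w g ys * ?V A U g) \<partial>?G)"
      using None by (intro Bochner_Integration.integral_cong refl) (simp add: env_factor_def)
    then show ?thesis using IH None by (simp add: cond_prob_def)
  next
    case (Some v)
    obtain i s' where v: "v = (i, s')" by (cases v)
    let ?d = "of_bool (snd y = s') - status_prob p (snd y)"
    let ?u = "if ?e \<in> A then U ?e else {}"
    define A' where "A' = insert ?e A"
    \<comment> \<open>That the edge is quiet is one more void condition on it. The old set at this
      edge lies after time \<open>?T ?n\<close>, the present ring being its last visit, so
      \<open>void_prob_interval\<close> splits off the exponential factor.\<close>
    define U' where "U' = U(?e := {?T i<..?T ?n} \<union> ?u)"
    have u: "?u \<in> sets borel" "?u \<subseteq> {?T ?n<..}"
      using Cons.prems(3)[of ?e] Cons.prems(4)[of ?e ?n "snd y"] by auto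
    have A': "finite A'" "A' \<subseteq> lattice_edges"
      using Cons.prems(1,2) examined_edge_lattice[of ys "fst y"] by (simp_all add: A'_def)
    have U': "U' e \<in> sets borel" if "e \<in> A'" for e
      using that Cons.prems(3) u(1) by (auto simp: U'_def A'_def)
    have "?T i \<le> ?T ?n" using last_visit_less[of ys ?e i s'] Some v by (intro mono) simp
    have U'_after: "U' e \<subseteq> {?T j<..}" if e: "e \<in> A'" "last_visit ys e = Some (j, s)" for e j s
    proof (cases "e = ?e")
      case True
      then have "j = i" using e Some v by simp
      then show ?thesis using True u(2) \<open>?T i \<le> ?T ?n\<close> unfolding U'_def by fastforce
    next
      case False
      then show ?thesis using after[of e j s] e by (simp add: U'_def A'_def)
    qed
    have V': "of_bool (quiet w g ?e i ?n) * ?V A U g = ?V A' U' g" for g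
      unfolding quiet_def U'_def A'_def of_bool_conj[symmetric] by (rule arg_cong[where f = of_bool]) auto
    have P: "(\<Prod>e\<in>A'. void_prob mu (U' e) 0)
        = exp (- (mu * (?T ?n - ?T i))) * (\<Prod>e\<in>A. void_prob mu (U e) 0)"
    proof -
      have "(\<Prod>e\<in>A'. void_prob mu (U' e) 0) = void_prob mu (U' ?e) 0 * (\<Prod>e\<in>A - {?e}. void_prob mu (U' e) 0)"
        unfolding A'_def using Cons.prems(1) by (rule prod.insert_remove)
      also have "(\<Prod>e\<in>A - {?e}. void_prob mu (U' e) 0) = (\<Prod>e\<in>A - {?e}. void_prob mu (U e) 0)"
        by (rule prod.cong) (auto simp: U'_def)
      also have "void_prob mu (U' ?e) 0 = exp (- (mu * (?T ?n - ?T i))) * void_prob mu ?u 0"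
        unfolding U'_def fun_upd_same using u \<open>?T i \<le> ?T ?n\<close> w
        by (intro void_prob_interval) (auto simp: arrival_time_def intro!: sum_nonneg)
      also have "exp (- (mu * (?T ?n - ?T i))) * void_prob mu ?u 0 * (\<Prod>e\<in>A - {?e}. void_prob mu (U e) 0)
          = exp (- (mu * (?T ?n - ?T i))) * (\<Prod>e\<in>A. void_prob mu (U e) 0)"
        using Cons.prems(1) by (cases "?e \<in> A") (simp_all add: prod.remove)
      finally show ?thesis .
    qed
    have "(\<integral>g. env_prob w g (y # ys) * ?V A U g \<partial>?G)
        = (\<integral>g. status_prob p (snd y) * (env_prob w g ys * ?V A U g)
            + ?d * (env_prob w g ys * ?V A' U' g) \<partial>?G)"
    proof (intro Bochner_Integration.integral_cong refl)
      fix g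
      show "env_prob w g (y # ys) * ?V A U g = status_prob p (snd y) * (env_prob w g ys * ?V A U g)
            + ?d * (env_prob w g ys * ?V A' U' g)"
        unfolding V'[symmetric] using Some v
        by (simp add: env_factor_def algebra_simps del: of_bool_eq_iff)
    qed
    also have "\<dots> = status_prob p (snd y) * (\<integral>g. env_prob w g ys * ?V A U g \<partial>?G)
        + ?d * (\<integral>g. env_prob w g ys * ?V A' U' g \<partial>?G)"
      by (subst Bochner_Integration.integral_add)
        (auto intro!: integrable_mult_right integrable_env_prob_void Cons.prems A' U')
    also have "(\<integral>g. env_prob w g ys * ?V A' U' g \<partial>?G)
        = path_prob mu p w ys * (\<Prod>e\<in>A'. void_prob mu (U' e) 0)"
      by (intro Cons.IH A' U' U'_after)
    finally show ?thesis unfolding IH P using Some v by (simp add: cond_prob_def algebra_simps)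
  qed
qed

lemma integral_env_prob:
  fixes ys :: "'d::finite ring list"
  assumes "\<And>n. w n \<ge> 0"
  shows "(\<integral>g. env_prob w g ys \<partial>refresh_space TYPE('d) mu) = path_prob mu p w ys"
  using integral_env_prob_void[of w "{}" "\<lambda>_. {}" ys] assms by simp

end

section \<open>The states read along a fixed history\<close>

text \<open>The list is prescribed and not generated by the walk, so the clock and the refresh times
  alone decide which coordinates of \<open>b\<close> are read.\<close>

primrec env_event ::
  "(nat \<Rightarrow> real) \<Rightarrow> ((int ^ 'd::finite) set \<times> nat \<Rightarrow> real) \<Rightarrow> 'd ring list
     \<Rightarrow> ((int ^ 'd) set \<times> nat \<Rightarrow> bool) \<Rightarrow> bool" where
  "env_event w g [] b \<longleftrightarrow> True"
| "env_event w g (y # ys) b \<longleftrightarrow> env_event w g ys b \<and>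
     b (examined_edge ys (fst y),
        num_arrivals (\<lambda>k. g (examined_edge ys (fst y), k)) (arrival_time w (length ys))) = snd y"

primrec dir_event :: "(nat \<Rightarrow> 'd \<times> bool) \<Rightarrow> 'd::finite ring list \<Rightarrow> bool" where
  "dir_event u [] \<longleftrightarrow> True"
| "dir_event u (y # ys) \<longleftrightarrow> dir_event u ys \<and> u (length ys) = fst y"

text \<open>The coordinates of \<open>b\<close> on which \<open>env_event\<close> depends; a
  coordinate outside this set is independent of it.\<close>

primrec read_states ::
  "(nat \<Rightarrow> real) \<Rightarrow> ((int ^ 'd::finite) set \<times> nat \<Rightarrow> real) \<Rightarrow> 'd ring list \<Rightarrow> ((int ^ 'd) set \<times> nat) set" where
  "read_states w g [] = {}"
| "read_states w g (y # ys) = insert (examined_edge ys (fst y),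
     num_arrivals (\<lambda>k. g (examined_edge ys (fst y), k)) (arrival_time w (length ys))) (read_states w g ys)"

lemma read_states_lattice: "read_states w g ys \<subseteq> lattice_edges \<times> UNIV"
  by (induction ys) (simp_all add: examined_edge_lattice)

lemma env_event_last_visit:
  "env_event w g ys b \<Longrightarrow> last_visit ys e = Some (i, s) \<Longrightarrow>
    b (e, num_arrivals (\<lambda>k. g (e, k)) (arrival_time w i)) = s"
  by (induction ys) (auto split: if_splits)

lemma env_event_cong:
  "(\<And>z. z \<in> read_states w g ys \<Longrightarrow> b z = b' z) \<Longrightarrow> env_event w g ys b = env_event w g ys b'"
  by (induction ys) auto

lemma num_arrivals_mono:
  "finite {n. arrival_time v n \<le> t} \<Longrightarrow> s \<le> t \<Longrightarrow> num_arrivals v s \<le> num_arrivals v t"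
  unfolding num_arrivals_def by (rule card_mono) auto

lemma num_arrivals_eq_iff:
  assumes "finite {n. arrival_time v n \<le> t}" "s \<le> t"
  shows "num_arrivals v s = num_arrivals v t \<longleftrightarrow> (\<forall>n. arrival_time v n \<notin> {s<..t})"
proof -
  have sub: "{n. arrival_time v n \<le> s} \<subseteq> {n. arrival_time v n \<le> t}" using assms by auto
  have "num_arrivals v s = num_arrivals v t \<longleftrightarrow> {n. arrival_time v n \<le> s} = {n. arrival_time v n \<le> t}"
    unfolding num_arrivals_def by (rule iffI, rule card_subset_eq[OF assms(1) sub], assumption, simp only:)
  also have "\<dots> \<longleftrightarrow> (\<forall>n. arrival_time v n \<notin> {s<..t})"
    unfolding set_eq_iff mem_Collect_eq greaterThanAtMost_iff
    by (meson assms(2) not_le order_trans)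
  finally show ?thesis .
qed

text \<open>Refresh counters increase with time, so the latest visit carries the largest counter
  read at its edge. Any larger counter points to a coordinate not yet read.\<close>

lemma read_states_last_visit:
  assumes w: "\<And>n. w n \<ge> 0" and fin: "\<And>e t. e \<in> lattice_edges \<Longrightarrow> finite {n. edge_time g e n \<le> t}"
  shows "(e, k) \<in> read_states w g ys \<Longrightarrow>
    \<exists>i s. last_visit ys e = Some (i, s) \<and> k \<le> num_arrivals (\<lambda>k. g (e, k)) (arrival_time w i)"
proof (induction ys)
  case (Cons y ys)
  let ?e = "examined_edge ys (fst y)" and ?N = "\<lambda>i. num_arrivals (\<lambda>k. g (e, k)) (arrival_time w i)"
  show ?case
  proof (cases "(e, k) \<in> read_states w g ys")
    case True
    then obtain i s where i: "last_visit ys e = Some (i, s)" "k \<le> ?N i" using Cons.IH by blast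
    show ?thesis
    proof (cases "e = ?e")
      case e: True
      then have "?N i \<le> ?N (length ys)"
        using last_visit_less[OF i(1)] fin[of e] w examined_edge_lattice[of ys "fst y"]
        by (intro num_arrivals_mono arrival_time_mono) auto
      then show ?thesis using i(2) e by auto
    next
      case False
      then show ?thesis using i by auto
    qed
  next
    case False
    then show ?thesis using Cons.prems by auto
  qed
qed simp

context ring_params
begin

lemma integral_state_coordinate:
  fixes e :: "(int ^ 'd::finite) set"
  assumes "e \<in> lattice_edges"
  shows "(\<integral>b. of_bool (b (e, k) = s) \<partial>state_space TYPE('d) p) = status_prob p s"
proof -
  have "(\<integral>b. of_bool (b (e, k) = s) \<partial>state_space TYPE('d) p)
      = (\<integral>x. (of_bool (x = s) :: real) \<partial>distr (state_space TYPE('d) p) (measure_pmf (bernoulli_pmf p)) (\<lambda>b. b (e, k)))"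
    by (rule integral_distr[symmetric])
      (use assms in \<open>auto intro!: measurable_component_singleton[of "(e, k)" _ "\<lambda>_. measure_pmf (bernoulli_pmf p)"]\<close>)
  also have "distr (state_space TYPE('d) p) (measure_pmf (bernoulli_pmf p)) (\<lambda>b. b (e, k)) = measure_pmf (bernoulli_pmf p)"
    by (rule distr_PiM_component[of _ "\<lambda>_. measure_pmf (bernoulli_pmf p)"])
      (use assms in \<open>auto intro: prob_space_measure_pmf\<close>)
  also have "(\<integral>x. of_bool (x = s) \<partial>measure_pmf (bernoulli_pmf p)) = status_prob p s"
    using p_pos p_less_1 by (subst integral_measure_pmf[of UNIV]) (auto simp: UNIV_bool status_prob_def)
  finally show ?thesis .
qed

lemma env_event_measurable_state:
  fixes ys :: "'d::finite ring list"
  shows "(\<lambda>b. of_bool (env_event w g ys b) :: real) \<in> borel_measurable (state_space TYPE('d) p)"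
proof -
  have "Measurable.pred (state_space TYPE('d) p) (env_event w g ys)"
  proof (induction ys)
    case (Cons y ys)
    have [measurable]: "(\<lambda>b. b (examined_edge ys (fst y), k)) \<in> measurable (state_space TYPE('d) p) (count_space UNIV)" for k
      using measurable_component_singleton[of "(examined_edge ys (fst y), k)" "lattice_edges \<times> UNIV"
          "\<lambda>_. measure_pmf (bernoulli_pmf p)"] examined_edge_lattice[of ys "fst y"] by simp
    note [measurable] = Cons
    show ?case by simp
  qed simp
  then show ?thesis by measurable
qed

text \<open>An edge that has stayed quiet is read again at the same coordinate, so its state is
  forced; a new edge, or one refreshed since its last visit, leads to an unread coordinate and an
  independent Bernoulli state.\<close>

lemma integral_env_event:
  fixes ys :: "'d::finite ring list"
  assumes w: "\<And>n. w n \<ge> 0" and fin: "\<And>e t. e \<in> lattice_edges \<Longrightarrow> finite {n. edge_time g e n \<le> t}"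
  shows "(\<integral>b. of_bool (env_event w g ys b) \<partial>state_space TYPE('d) p) = env_prob w g ys"
proof (induction ys)
  let ?B = "state_space TYPE('d) p"
  interpret B: prob_space ?B by (intro prob_space_PiM prob_space_measure_pmf)
  {
    case Nil
    show ?case using B.prob_space by simp
  next
    case (Cons y ys)
    let ?e = "examined_edge ys (fst y)"
    let ?N = "\<lambda>i. num_arrivals (\<lambda>k. g (?e, k)) (arrival_time w i)"
    have e: "?e \<in> lattice_edges" by (rule examined_edge_lattice)
    have fresh: "(\<integral>b. of_bool (env_event w g (y # ys) b) \<partial>?B) = env_prob w g ys * status_prob p (snd y)"
      if "(?e, ?N (length ys)) \<notin> read_states w g ys"
    proof -
      have "(\<integral>b. of_bool (env_event w g (y # ys) b) \<partial>?B)
          = (\<integral>b. of_bool (env_event w g ys b) * (of_bool :: bool \<Rightarrow> real) (b (?e, ?N (length ys)) = snd y) \<partial>?B)"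
        by (intro Bochner_Integration.integral_cong refl) (simp add: of_bool_conj)
      also have "\<dots> = (\<integral>b. of_bool (env_event w g ys b) \<partial>?B) * (\<integral>b. of_bool (b (?e, ?N (length ys)) = snd y) \<partial>?B)"
      proof (rule integral_mult_disjoint_coordinates(1)[where A = "read_states w g ys" and B = "{(?e, ?N (length ys))}"])
        show "integrable ?B (\<lambda>b. of_bool (env_event w g ys b) :: real)"
          using env_event_measurable_state[of w g ys] by (intro B.integrable_const_bound[where B = 1]) auto
        have "(\<lambda>b. b (?e, ?N (length ys))) \<in> measurable ?B (measure_pmf (bernoulli_pmf p))"
          using e by (intro measurable_component_singleton) auto
        then have [measurable]: "(\<lambda>b. b (?e, ?N (length ys))) \<in> measurable ?B (count_space UNIV)" by simp
        show "integrable ?B (\<lambda>b. of_bool (b (?e, ?N (length ys)) = snd y) :: real)"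
          by (intro B.integrable_const_bound[where B = 1]) auto
        show "of_bool (env_event w g ys b) = (of_bool (env_event w g ys b') :: real)"
          if "\<And>z. z \<in> read_states w g ys \<Longrightarrow> b z = b' z" for b b'
          by (rule arg_cong[where f = of_bool], rule env_event_cong, rule that)
      qed (use that e read_states_lattice lattice_edges_nonempty in \<open>auto intro: prob_space_measure_pmf\<close>)
      finally show ?thesis by (simp only: Cons.IH integral_state_coordinate[OF e])
    qed
    show ?case
    proof (cases "last_visit ys ?e")
      case None
      then have "(?e, ?N (length ys)) \<notin> read_states w g ys"
        using read_states_last_visit[OF w fin] by fastforce
      then show ?thesis using fresh None by (simp add: env_factor_def)
    next
      case (Some v)
      obtain i s' where v: "v = (i, s')" by (cases v)
      have T: "arrival_time w i \<le> arrival_time w (length ys)"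
        using last_visit_less[of ys ?e i s'] Some v w by (intro arrival_time_mono) simp_all
      have q: "?N i = ?N (length ys) \<longleftrightarrow> quiet w g ?e i (length ys)"
        unfolding quiet_def by (rule num_arrivals_eq_iff[OF fin[OF e] T])
      show ?thesis
      proof (cases "quiet w g ?e i (length ys)")
        case True
        then have "of_bool (env_event w g (y # ys) b) = of_bool (snd y = s') * (of_bool (env_event w g ys b) :: real)" for b
          using env_event_last_visit[of w g ys b ?e i s'] Some v q by auto
        then show ?thesis using True Some v Cons.IH by (simp add: env_factor_def)
      next
        case False
        then have "?N i < ?N (length ys)"
          using num_arrivals_mono[OF fin[OF e] T] q by linarith
        then have "(?e, ?N (length ys)) \<notin> read_states w g ys"
          using read_states_last_visit[OF w fin, where e = ?e and ys = ys] Some v by fastforce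
        then show ?thesis using fresh False Some v by (simp add: env_factor_def)
      qed
    qed
  }
qed

lemma AE_refresh_finite:
  "AE g in refresh_space TYPE('d::finite) mu. \<forall>e\<in>lattice_edges. \<forall>t. finite {n. edge_time g e n \<le> t}"
proof (subst AE_ball_countable[OF countable_lattice_edges], rule ballI)
  fix e :: "(int ^ 'd) set"
  assume e: "e \<in> lattice_edges"
  have "AE w in distr (refresh_space TYPE('d) mu) S (\<lambda>g k. g (e, k)). \<forall>t. finite {n. arrival_time w n \<le> t}"
    unfolding edge_marginal[OF e] by (rule AE_arrivals_finite)
  then show "AE g in refresh_space TYPE('d) mu. \<forall>t. finite {n. edge_time g e n \<le> t}"
    by (rule AE_distrD[OF edge_process_measurable[OF e]])
qed

end

lemma num_arrivals_measurable:
  assumes A: "\<And>n. (\<lambda>x. arrival_time (v x) n) \<in> borel_measurable M" and [measurable]: "t \<in> borel_measurable M"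
  shows "(\<lambda>x. num_arrivals (v x) (t x)) \<in> measurable M (count_space UNIV)"
  unfolding num_arrivals_def
proof (rule measurable_card)
  fix n
  note [measurable] = A[of n]
  show "{x \<in> space M. n \<in> {n. arrival_time (v x) n \<le> t x}} \<in> sets M" by simp
qed

section \<open>The directions and the history of a sample\<close>

abbreviation direction_space :: "'d::finite \<Rightarrow> real \<Rightarrow> (nat \<Rightarrow> 'd \<times> bool) measure" where
  "direction_space a l \<equiv> \<Pi>\<^sub>M n\<in>UNIV. measure_pmf (direction_pmf a l)"

lemma dir_event_measurable:
  "Measurable.pred (direction_space a l) (\<lambda>u. dir_event u ys)"
proof (induction ys)
  case (Cons y ys)
  have [measurable]: "(\<lambda>u. u k) \<in> measurable (direction_space a l) (count_space UNIV)" for k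
    using measurable_component_singleton[of k UNIV "\<lambda>_. measure_pmf (direction_pmf a l)"] by simp
  note [measurable] = Cons
  show ?case by simp
qed simp

lemma dir_event_cong: "(\<And>i. i < length ys \<Longrightarrow> u i = u' i) \<Longrightarrow> dir_event u ys = dir_event u' ys"
  by (induction ys) auto

lemma integral_dir_event:
  "(\<integral>u. of_bool (dir_event u ys) \<partial>direction_space a l) = direction_prob (direction_weight a l) ys"
proof (induction ys)
  interpret D: prob_space "direction_space a l" by (intro prob_space_PiM prob_space_measure_pmf)
  {
    case Nil
    show ?case using D.prob_space by simp
  next
    case (Cons y ys)
    let ?D = "direction_space a l" and ?n = "length ys"
    have [measurable]: "(\<lambda>u. u ?n) \<in> measurable ?D (count_space UNIV)"
      using measurable_component_singleton[of ?n UNIV "\<lambda>_. measure_pmf (direction_pmf a l)"] by simp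
    note [measurable] = dir_event_measurable[where a = a and l = l and ys = ys]
    have "(\<integral>u. of_bool (dir_event u (y # ys)) \<partial>?D) = (\<integral>u. of_bool (dir_event u ys) * (of_bool :: bool \<Rightarrow> real) (u ?n = fst y) \<partial>?D)"
      by (intro Bochner_Integration.integral_cong refl) (simp add: of_bool_conj)
    also have "\<dots> = (\<integral>u. of_bool (dir_event u ys) \<partial>?D) * (\<integral>u. of_bool (u ?n = fst y) \<partial>?D)"
    proof (rule integral_mult_disjoint_coordinates(1)[where A = "{..<?n}" and B = "{?n}"])
      show "integrable ?D (\<lambda>u. of_bool (dir_event u ys) :: real)" "integrable ?D (\<lambda>u. of_bool (u ?n = fst y) :: real)"
        by (auto intro!: D.integrable_const_bound[where B = 1])
      show "of_bool (dir_event u ys) = (of_bool (dir_event u' ys) :: real)"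
        if "\<And>i. i \<in> {..<?n} \<Longrightarrow> u i = u' i" for u u' :: "nat \<Rightarrow> 'a \<times> bool"
        by (rule arg_cong[where f = of_bool], rule dir_event_cong) (simp add: that)
    qed (auto intro: prob_space_measure_pmf)
    also have "(\<integral>u. of_bool (u ?n = fst y) \<partial>?D)
        = (\<integral>x. (of_bool (x = fst y) :: real) \<partial>distr ?D (measure_pmf (direction_pmf a l)) (\<lambda>u. u ?n))"
      by (rule integral_distr[symmetric]) auto
    also have "distr ?D (measure_pmf (direction_pmf a l)) (\<lambda>u. u ?n) = measure_pmf (direction_pmf a l)"
      by (rule distr_PiM_component[of _ "\<lambda>_. measure_pmf (direction_pmf a l)"]) (auto intro: prob_space_measure_pmf)
    also have "(\<integral>x. of_bool (x = fst y) \<partial>measure_pmf (direction_pmf a l)) = direction_weight a l (fst y)"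
    proof (subst integral_measure_pmf[of UNIV])
      have "(\<Sum>x\<in>UNIV. pmf (direction_pmf a l) x *\<^sub>R of_bool (x = fst y))
          = (\<Sum>x\<in>UNIV. if x = fst y then direction_weight a l (fst y) else (0 :: real))"
        by (rule sum.cong) (auto simp: pmf_direction_pmf)
      then show "(\<Sum>x\<in>UNIV. pmf (direction_pmf a l) x *\<^sub>R (of_bool (x = fst y) :: real)) = direction_weight a l (fst y)"
        by simp
    qed auto
    finally show ?case using Cons by simp
  }
qed

primrec history :: "'d::finite sample \<Rightarrow> nat \<Rightarrow> 'd ring list" where
  "history \<omega> 0 = []"
| "history \<omega> (Suc n) =
     (let (g, b, w, u) = \<omega>
      in (u n, edge_open \<omega> (arrival_time w n) (examined_edge (history \<omega> n) (u n))) # history \<omega> n)"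

lemma length_history [simp]: "length (history \<omega> n) = n"
  by (induction n) (auto split: prod.split)

lemma position_after_history: "position_after \<omega> n = endpoint (history \<omega> n)"
  by (induction n)
    (auto simp: Let_def displacement_def examined_edge_def add.commute split: prod.split)

text \<open>Once the whole list is prescribed, the event is a conjunction of a condition on the
  directions and one on the environment, and its probability factorises.\<close>

lemma history_eq_iff:
  "history (g, b, w, u) (length ys) = ys \<longleftrightarrow> dir_event u ys \<and> env_event w g ys b"
  by (induction ys) (auto simp: edge_open_def)

lemma env_event_measurable:
  fixes ys :: "'d::finite ring list"
  assumes G: "\<And>e n. e \<in> lattice_edges \<Longrightarrow> (\<lambda>x. edge_time (g x) e n) \<in> borel_measurable M"
    and B: "\<And>e k. e \<in> lattice_edges \<Longrightarrow> (\<lambda>x. b x (e, k)) \<in> measurable M (count_space UNIV)"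
    and C: "\<And>n. (\<lambda>x. arrival_time (w x) n) \<in> borel_measurable M"
  shows "Measurable.pred M (\<lambda>x. env_event (w x) (g x) ys (b x))"
proof (induction ys)
  case (Cons y ys)
  let ?e = "examined_edge ys (fst y)"
  have "(\<lambda>x. num_arrivals (\<lambda>k. g x (?e, k)) (arrival_time (w x) (length ys))) \<in> measurable M (count_space UNIV)"
    by (intro num_arrivals_measurable G C examined_edge_lattice)
  \<comment> \<open>The coordinate that is read is itself random, but its counter takes only
    countably many values.\<close>
  then have "(\<lambda>x. b x (?e, num_arrivals (\<lambda>k. g x (?e, k)) (arrival_time (w x) (length ys))))
      \<in> measurable M (count_space UNIV)"
    by (rule measurable_compose_countable[where f = "\<lambda>k x. b x (?e, k)", OF B[OF examined_edge_lattice]])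
  then have "Measurable.pred M (\<lambda>x. b x (?e, num_arrivals (\<lambda>k. g x (?e, k)) (arrival_time (w x) (length ys))) = snd y)"
    by (rule measurable_compose) simp
  then show ?case
    unfolding env_event.simps by (rule pred_intros_logic(3)[OF Cons])
qed simp

lemma state_component_measurable:
  fixes e :: "(int ^ 'd::finite) set"
  assumes "e \<in> lattice_edges"
  shows "(\<lambda>b. b (e, k)) \<in> measurable (state_space TYPE('d) p) (count_space UNIV)"
  using measurable_component_singleton[of "(e, k)" "lattice_edges \<times> UNIV"
      "\<lambda>_. measure_pmf (bernoulli_pmf p)"] assms by simp

lemma (in prob_space) integrable_of_bool:
  "Measurable.pred M P \<Longrightarrow> integrable M (\<lambda>x. of_bool (P x) :: real)"
  by (intro integrable_const_bound[where B = 1]) auto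

lemma walk_space_pred:
  fixes ys :: "'d::finite ring list"
  shows "Measurable.pred (walk_space a mu p l) (\<lambda>(g, b, w, u). dir_event u ys \<and> env_event w g ys b)"
proof -
  let ?G = "refresh_space TYPE('d) mu" and ?B = "state_space TYPE('d) p" and ?D = "direction_space a l"
  let ?M = "?G \<Otimes>\<^sub>M ?B \<Otimes>\<^sub>M clock_space \<Otimes>\<^sub>M ?D"
  have "Measurable.pred ?M (\<lambda>z. env_event (fst (snd (snd z))) (fst z) ys (fst (snd z)))"
  proof (rule env_event_measurable)
    show "(\<lambda>z. edge_time (fst z) e n) \<in> borel_measurable ?M" if "e \<in> lattice_edges" for e n
      by (rule measurable_compose[OF measurable_fst edge_time_measurable[OF that]])
    show "(\<lambda>z. fst (snd z) (e, k)) \<in> measurable ?M (count_space UNIV)" if "e \<in> lattice_edges" for e k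
      by (rule measurable_compose[OF _ state_component_measurable[OF that]]) measurable
    show "(\<lambda>z. arrival_time (fst (snd (snd z))) n) \<in> borel_measurable ?M" for n
      by (rule measurable_compose[OF _ measurable_arrival_time]) measurable
  qed
  moreover have "Measurable.pred ?M (\<lambda>z. dir_event (snd (snd (snd z))) ys)"
    by (rule measurable_compose[OF _ dir_event_measurable]) measurable
  ultimately show ?thesis
    unfolding walk_space_def case_prod_beta by measurable
qed

lemma walk_space_history_pred:
  fixes ys :: "'d::finite ring list"
  shows "Measurable.pred (walk_space a mu p l) (\<lambda>\<omega>. history \<omega> (length ys) = ys)"
proof -
  have "(\<lambda>\<omega>. history \<omega> (length ys) = ys) = (\<lambda>(g, b, w, u). dir_event u ys \<and> env_event w g ys b)"
    by (auto simp: history_eq_iff)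
  then show ?thesis using walk_space_pred[of ys a mu p l] by simp
qed

text \<open>The directions are integrated first, then the states, which leaves
  \<open>env_prob\<close>, then the refresh times, which leaves \<open>path_prob\<close>; the clock
  stays to the end, since both results are conditional on it. The two applications of Fubini's
  theorem bring the variables into this order.\<close>

lemma (in ring_params) history_prob:
  fixes ys :: "'d::finite ring list"
  shows "(\<integral>\<omega>. of_bool (history \<omega> (length ys) = ys) \<partial>walk_space a mu p l)
    = direction_prob (direction_weight a l) ys * (\<integral>w. path_prob mu p w ys \<partial>clock_space)"
proof -
  let ?G = "refresh_space TYPE('d) mu" and ?B = "state_space TYPE('d) p" and ?D = "direction_space a l"
  interpret G: prob_space ?G using mu_pos by (intro prob_space_PiM prob_space_waiting_time)
  interpret B: prob_space ?B by (intro prob_space_PiM prob_space_measure_pmf)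
  interpret C: prob_space clock_space by (rule prob_space_clock)
  interpret D: prob_space ?D by (intro prob_space_PiM prob_space_measure_pmf)
  interpret CD: pair_prob_space clock_space ?D ..
  interpret BCD: pair_prob_space ?B "clock_space \<Otimes>\<^sub>M ?D" ..
  interpret GBCD: pair_prob_space ?G "?B \<Otimes>\<^sub>M clock_space \<Otimes>\<^sub>M ?D" ..
  interpret BC: pair_prob_space ?B clock_space ..
  interpret CG: pair_prob_space clock_space ?G ..
  let ?P = "\<lambda>g b w u. dir_event u ys \<and> env_event w g ys b"
  let ?dp = "direction_prob (direction_weight a l) ys"
  have M: "walk_space a mu p l = ?G \<Otimes>\<^sub>M ?B \<Otimes>\<^sub>M clock_space \<Otimes>\<^sub>M ?D"
    by (simp add: walk_space_def)
  have P: "Measurable.pred (?G \<Otimes>\<^sub>M ?B \<Otimes>\<^sub>M clock_space \<Otimes>\<^sub>M ?D) (\<lambda>(g, b, w, u). ?P g b w u)"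
    using walk_space_pred[of ys a mu p l] unfolding M .
  have P_g: "Measurable.pred (?B \<Otimes>\<^sub>M clock_space \<Otimes>\<^sub>M ?D) (\<lambda>(b, w, u). ?P g b w u)" if "g \<in> space ?G" for g
    using measurable_compose[OF measurable_Pair1'[OF that] P] by (simp add: case_prod_beta)
  have P_gb: "Measurable.pred (clock_space \<Otimes>\<^sub>M ?D) (\<lambda>(w, u). ?P g b w u)" if "g \<in> space ?G" "b \<in> space ?B" for g b
    using measurable_compose[OF measurable_Pair1'[OF that(2)] P_g[OF that(1)]] by (simp add: case_prod_beta)
  have E: "Measurable.pred (?B \<Otimes>\<^sub>M clock_space) (\<lambda>(b, w). env_event w g ys b)" if "g \<in> space ?G" for g
    unfolding case_prod_beta
  proof (rule env_event_measurable)
    show "(\<lambda>z. fst z (e, k)) \<in> measurable (?B \<Otimes>\<^sub>M clock_space) (count_space UNIV)" if "e \<in> lattice_edges" for e k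
      by (rule measurable_compose[OF measurable_fst state_component_measurable[OF that]])
    show "(\<lambda>z. arrival_time (snd z) n) \<in> borel_measurable (?B \<Otimes>\<^sub>M clock_space)" for n
      by (rule measurable_compose[OF measurable_snd measurable_arrival_time])
  qed simp
  have E_b: "Measurable.pred ?B (env_event w g ys)" if "g \<in> space ?G" for g w
    using measurable_compose[OF measurable_Pair2' E[OF that], of w] by (simp add: space_PiM)
  have "(\<integral>\<omega>. of_bool (history \<omega> (length ys) = ys) \<partial>walk_space a mu p l)
      = (\<integral>z. of_bool (case z of (g, b, w, u) \<Rightarrow> ?P g b w u) \<partial>walk_space a mu p l :: real)"
    by (intro Bochner_Integration.integral_cong refl) (auto simp: history_eq_iff)
  also have "\<dots> = (\<integral>g. \<integral>z. of_bool (case z of (b, w, u) \<Rightarrow> ?P g b w u) \<partial>(?B \<Otimes>\<^sub>M clock_space \<Otimes>\<^sub>M ?D) \<partial>?G)"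
    unfolding M by (subst GBCD.integral_fst'[symmetric]) (simp_all add: GBCD.integrable_of_bool[OF P])
  also have "\<dots> = (\<integral>g. \<integral>b. \<integral>z. of_bool (case z of (w, u) \<Rightarrow> ?P g b w u) \<partial>(clock_space \<Otimes>\<^sub>M ?D) \<partial>?B \<partial>?G)"
    by (intro Bochner_Integration.integral_cong refl, subst BCD.integral_fst'[symmetric])
      (simp_all add: BCD.integrable_of_bool[OF P_g])
  also have "\<dots> = (\<integral>g. \<integral>b. \<integral>w. \<integral>u. of_bool (?P g b w u) \<partial>?D \<partial>clock_space \<partial>?B \<partial>?G)"
    by (intro Bochner_Integration.integral_cong refl, subst CD.integral_fst'[symmetric])
      (simp_all add: CD.integrable_of_bool[OF P_gb])
  also have "\<dots> = (\<integral>g. \<integral>b. \<integral>w. ?dp * of_bool (env_event w g ys b) \<partial>clock_space \<partial>?B \<partial>?G)"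
  proof (intro Bochner_Integration.integral_cong refl)
    fix g :: "(int ^ 'd) set \<times> nat \<Rightarrow> real" and b :: "(int ^ 'd) set \<times> nat \<Rightarrow> bool" and w :: "nat \<Rightarrow> real"
    show "(\<integral>u. of_bool (?P g b w u) \<partial>?D) = ?dp * of_bool (env_event w g ys b)"
      unfolding integral_dir_event[symmetric] by (simp add: of_bool_conj)
  qed
  also have "\<dots> = ?dp * (\<integral>g. \<integral>b. \<integral>w. of_bool (env_event w g ys b) \<partial>clock_space \<partial>?B \<partial>?G)"
    by simp
  also have "(\<integral>g. \<integral>b. \<integral>w. of_bool (env_event w g ys b) \<partial>clock_space \<partial>?B \<partial>?G)
      = (\<integral>g. \<integral>w. \<integral>b. of_bool (env_event w g ys b) \<partial>?B \<partial>clock_space \<partial>?G :: real)"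
  proof (intro Bochner_Integration.integral_cong refl)
    fix g assume g: "g \<in> space ?G"
    have "integrable (?B \<Otimes>\<^sub>M clock_space) (case_prod (\<lambda>b w. of_bool (env_event w g ys b) :: real))"
      using BC.integrable_of_bool[OF E[OF g]] by (simp only: case_prod_beta')
    then show "(\<integral>b. \<integral>w. of_bool (env_event w g ys b) \<partial>clock_space \<partial>?B)
        = (\<integral>w. \<integral>b. of_bool (env_event w g ys b) \<partial>?B \<partial>clock_space :: real)"
      by (rule BC.Fubini_integral[symmetric])
  qed
  also have "\<dots> = (\<integral>g. \<integral>w. env_prob w g ys \<partial>clock_space \<partial>?G)"
  proof (rule integral_cong_AE)
    have "(\<lambda>x. \<integral>b. of_bool (env_event (snd x) (fst x) ys b) \<partial>?B :: real) \<in> borel_measurable (?G \<Otimes>\<^sub>M clock_space)"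
    proof (rule B.borel_measurable_lebesgue_integral)
      have "Measurable.pred ((?G \<Otimes>\<^sub>M clock_space) \<Otimes>\<^sub>M ?B) (\<lambda>z. env_event (snd (fst z)) (fst (fst z)) ys (snd z))"
      proof (rule env_event_measurable)
        show "(\<lambda>z. edge_time (fst (fst z)) e n) \<in> borel_measurable ((?G \<Otimes>\<^sub>M clock_space) \<Otimes>\<^sub>M ?B)"
          if "e \<in> lattice_edges" for e n
          by (rule measurable_compose[OF _ edge_time_measurable[OF that]]) measurable
        show "(\<lambda>z. snd z (e, k)) \<in> measurable ((?G \<Otimes>\<^sub>M clock_space) \<Otimes>\<^sub>M ?B) (count_space UNIV)"
          if "e \<in> lattice_edges" for e k
          by (rule measurable_compose[OF measurable_snd state_component_measurable[OF that]])
        show "(\<lambda>z. arrival_time (snd (fst z)) n) \<in> borel_measurable ((?G \<Otimes>\<^sub>M clock_space) \<Otimes>\<^sub>M ?B)" for n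
          by (rule measurable_compose[OF _ measurable_arrival_time]) measurable
      qed
      then show "(\<lambda>(x, b). of_bool (env_event (snd x) (fst x) ys b) :: real)
          \<in> borel_measurable ((?G \<Otimes>\<^sub>M clock_space) \<Otimes>\<^sub>M ?B)"
        unfolding case_prod_beta' by measurable
    qed
    then have "(\<lambda>(g, w). \<integral>b. of_bool (env_event w g ys b) \<partial>?B :: real) \<in> borel_measurable (?G \<Otimes>\<^sub>M clock_space)"
      by (simp only: case_prod_beta')
    then show "(\<lambda>g. \<integral>w. \<integral>b. of_bool (env_event w g ys b) \<partial>?B \<partial>clock_space :: real) \<in> borel_measurable ?G"
      by (rule C.borel_measurable_lebesgue_integral)
    have "(\<lambda>(g, w). env_prob w g ys) \<in> borel_measurable (?G \<Otimes>\<^sub>M clock_space)"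
      using measurable_compose[OF measurable_pair_swap' env_prob_measurable] by (simp add: case_prod_beta')
    then show "(\<lambda>g. \<integral>w. env_prob w g ys \<partial>clock_space) \<in> borel_measurable ?G"
      by (rule C.borel_measurable_lebesgue_integral)
    \<comment> \<open>Refresh times are locally finite only almost surely, so the integration over
      the states is valid only for almost every \<open>g\<close>.\<close>
    show "AE g in ?G. (\<integral>w. \<integral>b. of_bool (env_event w g ys b) \<partial>?B \<partial>clock_space)
        = (\<integral>w. env_prob w g ys \<partial>clock_space)"
      using AE_refresh_finite[where 'd = 'd] AE_space
    proof eventually_elim
      case (elim g)
      show ?case
      proof (rule integral_cong_AE)
        have "(\<lambda>(w, b). of_bool (env_event w g ys b) :: real) \<in> borel_measurable (clock_space \<Otimes>\<^sub>M ?B)"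
          using measurable_compose[OF measurable_pair_swap' E[OF elim(2)]] by (simp add: case_prod_beta')
        then show "(\<lambda>w. \<integral>b. of_bool (env_event w g ys b) \<partial>?B :: real) \<in> borel_measurable clock_space"
          by (rule B.borel_measurable_lebesgue_integral)
        show "(\<lambda>w. env_prob w g ys) \<in> borel_measurable clock_space"
          using measurable_compose[OF measurable_Pair2'[OF elim(2)] env_prob_measurable] by simp
        show "AE w in clock_space. (\<integral>b. of_bool (env_event w g ys b) \<partial>?B) = env_prob w g ys"
          using AE_clock_pos
        proof eventually_elim
          case (elim w)
          then show ?case
            using \<open>\<forall>e\<in>lattice_edges. \<forall>t. finite {n. edge_time g e n \<le> t}\<close>
            by (intro integral_env_event) (auto simp: less_imp_le)
        qed
      qed
    qed
  qed
  also have "\<dots> = (\<integral>w. \<integral>g. env_prob w g ys \<partial>?G \<partial>clock_space)"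
  proof (rule CG.Fubini_integral)
    show "integrable (clock_space \<Otimes>\<^sub>M ?G) (\<lambda>(w, g). env_prob w g ys)"
    proof (rule CG.integrable_const_bound[where B = 1])
      show "AE z in clock_space \<Otimes>\<^sub>M ?G. norm (case z of (w, g) \<Rightarrow> env_prob w g ys) \<le> 1"
      proof (rule AE_I2)
        fix z show "norm (case z of (w, g) \<Rightarrow> env_prob w g ys) \<le> 1"
          using env_prob_bounds[of "fst z" "snd z" ys] by (simp add: case_prod_beta)
      qed
    qed (use env_prob_measurable in \<open>simp only: case_prod_beta'\<close>)
  qed
  also have "\<dots> = (\<integral>w. path_prob mu p w ys \<partial>clock_space)"
  proof (rule integral_cong_AE)
    show "(\<lambda>w. \<integral>g. env_prob w g ys \<partial>?G) \<in> borel_measurable clock_space"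
      by (rule G.borel_measurable_lebesgue_integral) (use env_prob_measurable in \<open>simp only: case_prod_beta'\<close>)
    show "AE w in clock_space. (\<integral>g. env_prob w g ys \<partial>?G) = path_prob mu p w ys"
      using AE_clock_pos by eventually_elim (auto intro!: integral_env_prob simp: less_imp_le)
  qed measurable
  finally show ?thesis .
qed

section \<open>Laws of large numbers\<close>

lemma ring_walk_direction_weight:
  assumes "ring_params mu p"
  shows "ring_walk mu p (direction_weight (a :: 'd::finite) l)"
proof -
  interpret ring_params mu p by fact
  show ?thesis
  proof
    show "direction_weight a l u \<ge> 0" for u
      using bias_normalizer_pos[of l, where 'd = 'd] by (simp add: direction_weight_def)
    show "(\<Sum>u\<in>UNIV. direction_weight a l u) = 1" by (rule sum_direction_weight)
  qed
qed

lemma finite_histories: "finite {ys :: 'd::finite ring list. length ys = n}"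
  using finite_lists_length_eq[of "UNIV :: 'd ring set" n] by simp

lemma (in ring_walk) K_pow_sum:
  "finite I \<Longrightarrow> (K ^^ n) (\<lambda>h. \<Sum>i\<in>I. F i h) = (\<lambda>h. \<Sum>i\<in>I. (K ^^ n) (F i) h)"
  by (induction rule: finite_induct) (simp_all add: K_pow_add)

text \<open>The bridge from the sample space to the operators. There are finitely many histories of
  a given length, so \<open>F\<close> is arbitrary and both sides are finite sums over single
  histories.\<close>

lemma (in ring_params) expectation_history:
  fixes F :: "'d::finite ring list \<Rightarrow> real"
  shows "integrable (walk_space a mu p l) (\<lambda>\<omega>. F (history \<omega> n))"
    and "(\<integral>\<omega>. F (history \<omega> n) \<partial>walk_space a mu p l)
      = (ring_op mu p (direction_weight a l) ^^ n) (\<lambda>h. F (map fst h)) []"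
proof -
  interpret ring_walk mu p "direction_weight a l"
    by (rule ring_walk_direction_weight) unfold_locales
  interpret W: prob_space "walk_space a mu p l"
    using mu_pos by (rule prob_space_walk_space)
  let ?H = "{ys :: 'd ring list. length ys = n}"
  have eq: "F xs = (\<Sum>ys\<in>?H. F ys * of_bool (xs = ys))" if "length xs = n" for xs
  proof -
    have "(\<Sum>ys\<in>?H. F ys * of_bool (xs = ys)) = (\<Sum>ys\<in>?H. if ys = xs then F xs else 0)"
      by (rule sum.cong) auto
    also have "\<dots> = F xs"
      using that by (subst sum.delta[OF finite_histories]) simp
    finally show ?thesis by (rule sym)
  qed
  have pred: "Measurable.pred (walk_space a mu p l) (\<lambda>\<omega>. history \<omega> n = ys)" if "ys \<in> ?H" for ys
    using walk_space_history_pred[where a = a and mu = mu and p = p and l = l and ys = ys] that by simp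
  have F: "(\<lambda>\<omega>. F (history \<omega> n)) = (\<lambda>\<omega>. \<Sum>ys\<in>?H. F ys * of_bool (history \<omega> n = ys))"
    by (rule ext, rule eq) simp
  have int: "integrable (walk_space a mu p l) (\<lambda>\<omega>. F ys * of_bool (history \<omega> n = ys))" if "ys \<in> ?H" for ys
    by (intro integrable_mult_right W.integrable_of_bool pred that)
  then show "integrable (walk_space a mu p l) (\<lambda>\<omega>. F (history \<omega> n))"
    unfolding F by (rule Bochner_Integration.integrable_sum)
  have "(\<integral>\<omega>. F (history \<omega> n) \<partial>walk_space a mu p l)
      = (\<Sum>ys\<in>?H. F ys * (\<integral>\<omega>. of_bool (history \<omega> n = ys) \<partial>walk_space a mu p l))"
    unfolding F by (subst Bochner_Integration.integral_sum[OF int]) simp_all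
  also have "\<dots> = (\<Sum>ys\<in>?H. F ys * (K ^^ n) (\<lambda>h. of_bool (map fst h = ys)) [])"
  proof (rule sum.cong[OF refl])
    fix ys :: "'d ring list" assume "ys \<in> ?H"
    then show "F ys * (\<integral>\<omega>. of_bool (history \<omega> n = ys) \<partial>walk_space a mu p l)
        = F ys * (K ^^ n) (\<lambda>h. of_bool (map fst h = ys)) []"
      using history_prob[where ys = ys and a = a and l = l] K_pow_history_prob[of ys] by auto
  qed
  also have "\<dots> = (K ^^ n) (\<lambda>h. \<Sum>ys\<in>?H. F ys * of_bool (map fst h = ys)) []"
    by (simp add: K_pow_sum[OF finite_histories] K_pow_cmult)
  also have "\<dots> = (K ^^ n) (\<lambda>h. F (map fst h)) []"
    by (rule K_pow_cong, rule eq[symmetric]) simp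
  finally show "(\<integral>\<omega>. F (history \<omega> n) \<partial>walk_space a mu p l) = (K ^^ n) (\<lambda>h. F (map fst h)) []" .
qed

text \<open>For \<open>n\<close> between \<open>k^2\<close> and \<open>(k + 1)^2\<close>
  monotonicity traps \<open>s n / n\<close> between values at the squares, and the ratio of
  consecutive squares tends to 1.\<close>

lemma tendsto_from_squares:
  fixes s :: "nat \<Rightarrow> real"
  assumes mono: "\<And>m n. m \<le> n \<Longrightarrow> s m \<le> s n" and nonneg: "\<And>n. 0 \<le> s n"
    and sq: "(\<lambda>k. s ((Suc k)\<^sup>2) / real ((Suc k)\<^sup>2)) \<longlonglongrightarrow> c"
  shows "(\<lambda>n. s n / real n) \<longlonglongrightarrow> c"
proof -
  define a where "a k = s (k\<^sup>2) / real (k\<^sup>2)" for k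
  have a: "a \<longlonglongrightarrow> c" using sq by (subst filterlim_sequentially_Suc[symmetric]) (simp add: a_def)
  have sqrt: "filterlim floor_sqrt at_top sequentially"
    unfolding filterlim_at_top
  proof
    fix Z :: nat
    show "\<forall>\<^sub>F n in sequentially. Z \<le> floor_sqrt n"
      using eventually_ge_at_top[of "Z\<^sup>2"] by eventually_elim (rule le_floor_sqrtI)
  qed
  have r1: "(\<lambda>k. real k / real (Suc k)) \<longlonglongrightarrow> 1" by (rule LIMSEQ_n_over_Suc_n)
  have r2: "(\<lambda>k. real (Suc k) / real k) \<longlonglongrightarrow> 1" by (rule LIMSEQ_Suc_n_over_n)
  have "(\<lambda>k. a k * (real k / real (Suc k))\<^sup>2) \<longlonglongrightarrow> c * 1\<^sup>2"
    by (intro tendsto_intros a r1)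
  then have lower: "(\<lambda>n. a (floor_sqrt n) * (real (floor_sqrt n) / real (Suc (floor_sqrt n)))\<^sup>2) \<longlonglongrightarrow> c"
    using filterlim_compose[OF _ sqrt] by fastforce
  have "(\<lambda>k. a (Suc k) * (real (Suc k) / real k)\<^sup>2) \<longlonglongrightarrow> c * 1\<^sup>2"
    by (intro tendsto_intros LIMSEQ_Suc[OF a] r2)
  then have upper: "(\<lambda>n. a (Suc (floor_sqrt n)) * (real (Suc (floor_sqrt n)) / real (floor_sqrt n))\<^sup>2) \<longlonglongrightarrow> c"
    using filterlim_compose[OF _ sqrt] by fastforce
  show ?thesis
  proof (rule tendsto_sandwich[OF _ _ lower upper])
    show "\<forall>\<^sub>F n in sequentially. a (floor_sqrt n) * (real (floor_sqrt n) / real (Suc (floor_sqrt n)))\<^sup>2 \<le> s n / real n"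
      using eventually_gt_at_top[of 0]
    proof eventually_elim
      case (elim n)
      let ?k = "floor_sqrt n"
      have k: "?k > 0" using elim by simp
      have "a ?k * (real ?k / real (Suc ?k))\<^sup>2 = s (?k\<^sup>2) / real ((Suc ?k)\<^sup>2)"
        using k by (simp add: a_def power_divide)
      also have "\<dots> \<le> s n / real n"
        using Suc_floor_sqrt_power2_gt[of n] elim
        by (intro frac_le nonneg mono) (simp_all only: of_nat_le_iff of_nat_0_less_iff floor_sqrt_power2_le less_imp_le)
      finally show ?case .
    qed
    show "\<forall>\<^sub>F n in sequentially. s n / real n \<le> a (Suc (floor_sqrt n)) * (real (Suc (floor_sqrt n)) / real (floor_sqrt n))\<^sup>2"
      using eventually_gt_at_top[of 0]
    proof eventually_elim
      case (elim n)
      let ?k = "floor_sqrt n"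
      have k: "?k > 0" using elim by simp
      have "s n / real n \<le> s ((Suc ?k)\<^sup>2) / real (?k\<^sup>2)"
        using Suc_floor_sqrt_power2_gt[of n] k
        by (intro frac_le nonneg mono) (simp_all only: of_nat_le_iff of_nat_0_less_iff floor_sqrt_power2_le less_imp_le zero_less_power)
      also have "\<dots> = a (Suc ?k) * (real (Suc ?k) / real ?k)\<^sup>2"
        using k by (simp add: a_def power_divide del: of_nat_Suc)
      finally show ?case .
    qed
  qed
qed

text \<open>Along the squares the mean squared deviations are of order \<open>1 / k^2\<close>. Their
  sum is finite, so the series of squared deviations converges almost surely and its terms tend to
  zero.\<close>

lemma (in prob_space) monotone_LLN:
  fixes S :: "nat \<Rightarrow> 'a \<Rightarrow> real"
  assumes mono: "AE \<omega> in M. \<forall>m n. m \<le> n \<longrightarrow> S m \<omega> \<le> S n \<omega>" and nonneg: "AE \<omega> in M. \<forall>n. 0 \<le> S n \<omega>"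
    and int: "\<And>n. integrable M (\<lambda>\<omega>. (S n \<omega> - c * real n)\<^sup>2)"
    and bound: "\<And>n. (\<integral>\<omega>. (S n \<omega> - c * real n)\<^sup>2 \<partial>M) \<le> C * real (Suc n)"
  shows "AE \<omega> in M. (\<lambda>n. S n \<omega> / real n) \<longlonglongrightarrow> c"
proof -
  have "0 \<le> (\<integral>\<omega>. (S 0 \<omega> - c * real 0)\<^sup>2 \<partial>M)" by (rule Bochner_Integration.integral_nonneg) simp
  from order_trans[OF this bound[of 0]] have C: "C \<ge> 0" by simp
  define f where "f k \<omega> = (S ((Suc k)\<^sup>2) \<omega> / real ((Suc k)\<^sup>2) - c)\<^sup>2" for k \<omega>
  have f_eq: "f k \<omega> = (S ((Suc k)\<^sup>2) \<omega> - c * real ((Suc k)\<^sup>2))\<^sup>2 / (real ((Suc k)\<^sup>2))\<^sup>2" for k \<omega>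
  proof -
    have "S ((Suc k)\<^sup>2) \<omega> / real ((Suc k)\<^sup>2) - c = (S ((Suc k)\<^sup>2) \<omega> - c * real ((Suc k)\<^sup>2)) / real ((Suc k)\<^sup>2)"
      by (simp add: diff_divide_distrib del: of_nat_power of_nat_Suc)
    then show ?thesis by (simp only: f_def power_divide)
  qed
  have f_int: "integrable M (f k)" for k
    unfolding f_eq[abs_def] by (intro integrable_divide int)
  have f_le: "(\<integral>\<omega>. f k \<omega> \<partial>M) \<le> 2 * C * (1 / (real (Suc k))\<^sup>2)" for k
  proof -
    let ?m = "(Suc k)\<^sup>2"
    have "1 \<le> ?m" by (rule one_le_power) simp
    then have m: "real ?m \<ge> 1" by (rule real_of_nat_ge_one_iff[THEN iffD2])
    have "(\<integral>\<omega>. f k \<omega> \<partial>M) = (\<integral>\<omega>. (S ?m \<omega> - c * real ?m)\<^sup>2 \<partial>M) / (real ?m)\<^sup>2"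
      unfolding f_eq[abs_def] by (rule integral_divide_zero)
    also have "\<dots> \<le> C * real (Suc ?m) / (real ?m)\<^sup>2"
      by (intro divide_right_mono bound) simp
    also have "\<dots> \<le> C * (2 * real ?m) / (real ?m)\<^sup>2"
      using C m by (intro divide_right_mono mult_left_mono) auto
    also have "\<dots> = 2 * C * (1 / real ?m)"
      using m by (simp add: power2_eq_square[of "real ((Suc k)\<^sup>2)"] del: of_nat_power)
    finally show ?thesis by (simp only: of_nat_power)
  qed
  have "summable (\<lambda>k. 2 * C * (1 / (real (Suc k))\<^sup>2))"
    using inverse_squares_sums by (intro summable_mult) (simp add: sums_summable field_simps sums_iff)
  then have "summable (\<lambda>k. \<integral>\<omega>. f k \<omega> \<partial>M)"
    by (rule summable_comparison_test'[where N = 0])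
      (use f_le in \<open>auto simp: f_def intro!: Bochner_Integration.integral_nonneg\<close>)
  moreover have f_nonneg: "0 \<le> f k \<omega>" for k \<omega> by (simp add: f_def)
  ultimately have "(\<Sum>k. ennreal (\<integral>\<omega>. f k \<omega> \<partial>M)) \<noteq> \<top>"
    by (subst suminf_ennreal2) (auto intro!: Bochner_Integration.integral_nonneg)
  also have "(\<Sum>k. ennreal (\<integral>\<omega>. f k \<omega> \<partial>M)) = (\<Sum>k. \<integral>\<^sup>+\<omega>. f k \<omega> \<partial>M)"
    by (intro suminf_cong nn_integral_eq_integral[symmetric] f_int) (simp add: f_def)
  also have "\<dots> = (\<integral>\<^sup>+\<omega>. (\<Sum>k. ennreal (f k \<omega>)) \<partial>M)"
    using f_int by (intro nn_integral_suminf[symmetric]) auto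
  finally have "AE \<omega> in M. (\<Sum>k. ennreal (f k \<omega>)) \<noteq> \<top>"
    using f_int by (intro nn_integral_noteq_infinite[unfolded infinity_ennreal_def]) auto
  with mono nonneg show ?thesis
  proof eventually_elim
    case (elim \<omega>)
    have "summable (\<lambda>k. f k \<omega>)"
      using elim(3) by (intro summable_suminf_not_top) (auto simp: f_def)
    then have "(\<lambda>k. f k \<omega>) \<longlonglongrightarrow> 0" by (rule summable_LIMSEQ_zero)
    then have "(\<lambda>k. S ((Suc k)\<^sup>2) \<omega> / real ((Suc k)\<^sup>2) - c) \<longlonglongrightarrow> 0"
      unfolding f_def by simp
    then have "(\<lambda>k. S ((Suc k)\<^sup>2) \<omega> / real ((Suc k)\<^sup>2)) \<longlonglongrightarrow> c"
      by (simp only: LIM_zero_iff)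
    then show ?case using elim(1,2) by (intro tendsto_from_squares) auto
  qed
qed

lemma distr_pair_snd:
  assumes "prob_space M1" "prob_space M2"
  shows "distr (M1 \<Otimes>\<^sub>M M2) M2 snd = M2"
proof (rule measure_eqI)
  interpret M1: prob_space M1 by fact
  interpret M2: prob_space M2 by fact
  fix A assume "A \<in> sets (distr (M1 \<Otimes>\<^sub>M M2) M2 snd)"
  then have A: "A \<in> sets M2" by simp
  then have "snd -` A \<inter> space (M1 \<Otimes>\<^sub>M M2) = space M1 \<times> A"
    using sets.sets_into_space[OF A] by (auto simp: space_pair_measure)
  then show "emeasure (distr (M1 \<Otimes>\<^sub>M M2) M2 snd) A = emeasure M2 A"
    using A by (simp add: emeasure_distr M2.emeasure_pair_measure_Times M1.emeasure_space_1)
qed simp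

text \<open>The unit exponential law is the Erlang law with shape index 0, whose moments are
  factorials.\<close>

lemma waiting_time_moments:
  shows "integrable (waiting_time 1) (\<lambda>x. x ^ i)" "(\<integral>x. x ^ i \<partial>waiting_time 1) = fact i"
proof -
  interpret prob_space "waiting_time 1" by (rule prob_space_waiting_time) simp
  have "distr (waiting_time 1) lborel (\<lambda>x. x) = waiting_time 1"
    by (rule distr_id2) simp
  then have D: "distributed (waiting_time 1) lborel (\<lambda>x. x) (erlang_density 0 1)"
    unfolding distributed_def by (simp add: waiting_time_def)
  show "integrable (waiting_time 1) (\<lambda>x. x ^ i)" "(\<integral>x. x ^ i \<partial>waiting_time 1) = fact i"
    using erlang_ith_moment_integrable[OF _ D, of i] erlang_ith_moment[OF _ D, of i] by simp_all
qed

lemma clock_component: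
  fixes f :: "real \<Rightarrow> real"
  assumes "integrable (waiting_time 1) f"
  shows "integrable clock_space (\<lambda>w. f (w n))" "(\<integral>w. f (w n) \<partial>clock_space) = (\<integral>x. f x \<partial>waiting_time 1)"
proof -
  have d: "distr clock_space (waiting_time 1) (\<lambda>w. w n) = waiting_time 1"
    by (rule distr_PiM_component) (auto intro: prob_space_waiting_time)
  have m: "(\<lambda>w. w n) \<in> measurable clock_space (waiting_time 1)" by simp
  show "integrable clock_space (\<lambda>w. f (w n))"
    by (rule integrable_distr[OF m]) (simp add: d assms)
  show "(\<integral>w. f (w n) \<partial>clock_space) = (\<integral>x. f x \<partial>waiting_time 1)"
    using integral_distr[OF m, of f] assms unfolding d by simp
qed

text \<open>Arrival \<open>n\<close> is the sum of \<open>n + 1\<close> waiting times of mean and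
  variance 1, hence the centring at \<open>Suc n\<close>; independence of the last one removes the
  cross term.\<close>

lemma centered_arrival_moments:
  defines "Y \<equiv> \<lambda>n w. arrival_time w n - real (Suc n)"
  shows "integrable clock_space (Y n) \<and> (\<integral>w. Y n w \<partial>clock_space) = 0
    \<and> integrable clock_space (\<lambda>w. (Y n w)\<^sup>2) \<and> (\<integral>w. (Y n w)\<^sup>2 \<partial>clock_space) = real (Suc n)"
proof (induction n)
  interpret E: prob_space "waiting_time 1" by (rule prob_space_waiting_time) simp
  interpret C: prob_space clock_space by (rule prob_space_clock)
  have i1: "integrable (waiting_time 1) (\<lambda>x. x)" "(\<integral>x. x \<partial>waiting_time 1) = (1 :: real)"
    and i2: "integrable (waiting_time 1) (\<lambda>x. x\<^sup>2)" "(\<integral>x. x\<^sup>2 \<partial>waiting_time 1) = (2 :: real)"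
    using waiting_time_moments[of 1] waiting_time_moments[of 2] by (simp_all add: fact_2)
  have j1: "integrable (waiting_time 1) (\<lambda>x. x - 1)" "(\<integral>x. x - 1 \<partial>waiting_time 1) = (0 :: real)"
    using i1 E.prob_space by (auto simp: Bochner_Integration.integral_diff)
  have sq: "(\<lambda>x :: real. (x - 1)\<^sup>2) = (\<lambda>x. x\<^sup>2 - 2 * x + 1)"
    by (auto simp: power2_diff)
  have j2: "integrable (waiting_time 1) (\<lambda>x. (x - 1)\<^sup>2)" "(\<integral>x. (x - 1)\<^sup>2 \<partial>waiting_time 1) = (1 :: real)"
    unfolding sq using i1 i2 E.prob_space by auto
  {
    case 0
    show ?case
      using clock_component[OF j1(1), of 0] clock_component[OF j2(1), of 0] j1 j2
      by (simp add: Y_def arrival_time_def)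
  next
    case (Suc n)
    let ?x = "\<lambda>w. w (Suc n) - 1"
    have Y: "Y (Suc n) w = Y n w + ?x w" for w
      by (simp add: Y_def arrival_time_def)
    have x: "integrable clock_space ?x" "(\<integral>w. ?x w \<partial>clock_space) = 0"
      "integrable clock_space (\<lambda>w. (?x w)\<^sup>2)" "(\<integral>w. (?x w)\<^sup>2 \<partial>clock_space) = 1"
      using clock_component[OF j1(1), of "Suc n"] clock_component[OF j2(1), of "Suc n"] j1 j2 by auto
    have cong: "Y n w = Y n w'" if "\<And>i. i \<in> {..n} \<Longrightarrow> w i = w' i" for w w' :: "nat \<Rightarrow> real"
      using that by (simp add: Y_def arrival_time_def)
    have prod: "(\<integral>w. Y n w * ?x w \<partial>clock_space) = (\<integral>w. Y n w \<partial>clock_space) * (\<integral>w. ?x w \<partial>clock_space)"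
      "integrable clock_space (\<lambda>w. Y n w * ?x w)"
      by (rule integral_mult_disjoint_coordinates[where A = "{..n}" and B = "{Suc n}"];
          (rule cong; assumption)?; use Suc x in \<open>auto intro: prob_space_waiting_time\<close>)+
    have sq: "(Y (Suc n) w)\<^sup>2 = (Y n w)\<^sup>2 + 2 * (Y n w * ?x w) + (?x w)\<^sup>2" for w
      unfolding Y by (simp add: power2_sum)
    show ?case
      unfolding sq unfolding Y using Suc x prod by simp
  }
qed

lemma AE_arrival_time_LLN: "AE w in clock_space. (\<lambda>n. arrival_time w n / real n) \<longlonglongrightarrow> 1"
proof -
  interpret C: prob_space clock_space by (rule prob_space_clock)
  let ?Y = "\<lambda>n w. arrival_time w n - real (Suc n)"
  note Y = centered_arrival_moments
  \<comment> \<open>Centring at \<open>n\<close> instead of \<open>n + 1\<close> adds 1 to the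
    second moment, and \<open>(n + 1) + 1 \<le> 2 * (n + 1)\<close> explains the constant 2.\<close>
  have sq: "(arrival_time w n - 1 * real n)\<^sup>2 = (?Y n w)\<^sup>2 + 2 * ?Y n w + 1" for w n
    by (simp add: power2_eq_square algebra_simps)
  show ?thesis
  proof (rule C.monotone_LLN[where c = 1 and C = 2])
    show "AE w in clock_space. \<forall>m n. m \<le> n \<longrightarrow> arrival_time w m \<le> arrival_time w n"
      using AE_clock_pos by eventually_elim (auto intro!: arrival_time_mono simp: less_imp_le)
    show "AE w in clock_space. \<forall>n. 0 \<le> arrival_time w n"
      using AE_clock_pos by eventually_elim (auto simp: arrival_time_def less_imp_le intro!: sum_nonneg)
    show "integrable clock_space (\<lambda>w. (arrival_time w n - 1 * real n)\<^sup>2)" for n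
      unfolding sq using Y[of n] by (intro Bochner_Integration.integrable_add integrable_mult_right C.integrable_const) blast+
    have "(\<integral>w. (arrival_time w n - 1 * real n)\<^sup>2 \<partial>clock_space)
        = (\<integral>w. (?Y n w)\<^sup>2 \<partial>clock_space) + 2 * (\<integral>w. ?Y n w \<partial>clock_space) + 1" for n
    proof -
      have "(\<integral>w. (Z w)\<^sup>2 + 2 * Z w + 1 \<partial>clock_space) = (\<integral>w. (Z w)\<^sup>2 \<partial>clock_space) + 2 * (\<integral>w. Z w \<partial>clock_space) + 1"
        if "integrable clock_space Z" "integrable clock_space (\<lambda>w. (Z w)\<^sup>2)" for Z :: "(nat \<Rightarrow> real) \<Rightarrow> real"
        using that C.prob_space by simp
      then show ?thesis unfolding sq using Y[of n] by blast
    qed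
    then show "(\<integral>w. (arrival_time w n - 1 * real n)\<^sup>2 \<partial>clock_space) \<le> 2 * real (Suc n)" for n
      using Y[of n] by (simp only:) simp
  qed
qed

text \<open>Inversion of the law of large numbers: if \<open>N\<close> points have arrived by time
  \<open>t\<close>, then \<open>t\<close> lies between the arrivals with indices
  \<open>N - 1\<close> and \<open>N\<close>.\<close>

lemma num_arrivals_asymptotics:
  assumes pos: "\<And>n. w n > 0" and LLN: "(\<lambda>n. arrival_time w n / real n) \<longlonglongrightarrow> 1"
  shows "filterlim (num_arrivals w) at_top at_top"
    and "((\<lambda>t. real (num_arrivals w t) / t) \<longlongrightarrow> 1) at_top"
proof -
  let ?T = "arrival_time w" and ?N = "num_arrivals w"
  have mono: "?T m \<le> ?T n" if "m \<le> n" for m n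
    using pos that by (intro arrival_time_mono) (auto simp: less_imp_le)
  have T_top: "filterlim ?T at_top sequentially"
  proof -
    have "filterlim (\<lambda>n. ?T n / real n * real n) at_top sequentially"
      by (rule filterlim_tendsto_pos_mult_at_top[OF LLN]) (auto simp: filterlim_real_sequentially)
    then show ?thesis
      by (rule filterlim_cong[THEN iffD1, OF refl refl, rotated])
        (use eventually_gt_at_top[of 0] in \<open>eventually_elim, simp\<close>)
  qed
  have set: "{n. ?T n \<le> t} = {..<?N t}" for t
  proof -
    have "\<forall>\<^sub>F m in sequentially. ?T m > t"
      using T_top unfolding filterlim_at_top_dense by (rule spec)
    then obtain m where m: "?T m > t"
      by (auto dest: eventually_happens)
    define k where "k = (LEAST m. ?T m > t)"
    have k: "?T k > t" unfolding k_def by (rule LeastI[of _ m]) (rule m)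
    have "{n. ?T n \<le> t} = {..<k}"
    proof (intro set_eqI iffI)
      fix n assume "n \<in> {n. ?T n \<le> t}"
      then show "n \<in> {..<k}" using k mono[of k n] by force
    next
      fix n assume "n \<in> {..<k}"
      then show "n \<in> {n. ?T n \<le> t}" unfolding k_def using not_less_Least by force
    qed
    then show ?thesis by (simp add: num_arrivals_def)
  qed
  show top: "filterlim ?N at_top at_top"
    unfolding filterlim_at_top
  proof
    fix Z :: nat
    show "\<forall>\<^sub>F t in at_top. Z \<le> ?N t"
      using eventually_ge_at_top[of "?T Z"]
    proof eventually_elim
      case (elim t)
      then have "Z \<in> {..<?N t}" unfolding set[symmetric] by simp
      then show ?case by simp
    qed
  qed
  have "(\<lambda>n. ?T n / real n * (real n / real (Suc n))) \<longlonglongrightarrow> 1 * 1"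
    by (intro tendsto_mult LLN LIMSEQ_n_over_Suc_n)
  then have "(\<lambda>n. ?T n / real (Suc n)) \<longlonglongrightarrow> 1"
    unfolding mult_1
  proof (rule Lim_transform_eventually)
    show "\<forall>\<^sub>F n in sequentially. ?T n / real n * (real n / real (Suc n)) = ?T n / real (Suc n)"
      using eventually_gt_at_top[of 0] by eventually_elim simp
  qed
  then have LLN': "(\<lambda>n. ?T (n - 1) / real n) \<longlonglongrightarrow> 1"
    by (subst filterlim_sequentially_Suc[symmetric]) simp
  have "((\<lambda>t. t / real (?N t)) \<longlongrightarrow> 1) at_top"
  proof (rule tendsto_sandwich)
    show "((\<lambda>t. ?T (?N t - 1) / real (?N t)) \<longlongrightarrow> 1) at_top"
      by (rule filterlim_compose[OF LLN' top])
    show "((\<lambda>t. ?T (?N t) / real (?N t)) \<longlongrightarrow> 1) at_top"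
      by (rule filterlim_compose[OF LLN top])
    have ev: "\<forall>\<^sub>F t in at_top. ?N t > 0"
      using top eventually_gt_at_top[of "0 :: nat"] by (auto simp: filterlim_iff)
    show "\<forall>\<^sub>F t in at_top. ?T (?N t - 1) / real (?N t) \<le> t / real (?N t)"
      using ev
    proof eventually_elim
      case (elim t)
      then have "?N t - 1 \<in> {n. ?T n \<le> t}" unfolding set by simp
      then show ?case by (intro divide_right_mono) auto
    qed
    show "\<forall>\<^sub>F t in at_top. t / real (?N t) \<le> ?T (?N t) / real (?N t)"
    proof (intro always_eventually allI divide_right_mono)
      fix t
      have "?N t \<notin> {n. ?T n \<le> t}" unfolding set by simp
      then show "t \<le> ?T (?N t)" by simp
    qed simp
  qed
  from tendsto_inverse[OF this] show "((\<lambda>t. real (?N t) / t) \<longlongrightarrow> 1) at_top"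
    by (simp add: field_simps)
qed

context ring_params
begin

lemma AE_position_LLN:
  fixes a :: "'d::finite"
  assumes dec: "decay \<le> 1 / 8"
  shows "AE \<omega> in walk_space a mu p l.
    (\<lambda>n. real_of_int (position_after \<omega> n $ i) / real n) \<longlonglongrightarrow> ring_walk.drift mu p (direction_weight a l) i"
proof -
  interpret ring_walk mu p "direction_weight a l"
    by (rule ring_walk_direction_weight) unfold_locales
  interpret P: prob_space "walk_space a mu p l"
    using mu_pos by (rule prob_space_walk_space)
  let ?X = "\<lambda>\<omega> n. real_of_int (position_after \<omega> n $ i)"
  have step: "\<bar>?X \<omega> (Suc n) - ?X \<omega> n\<bar> \<le> 1" for \<omega> n
  proof -
    have "position_after \<omega> (Suc n) $ i - position_after \<omega> n $ i
        = displacement (hd (history \<omega> (Suc n))) $ i"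
      unfolding position_after_history by (simp add: Let_def split: prod.split)
    then show ?thesis using abs_displacement_le[of "hd (history \<omega> (Suc n))" i] by linarith
  qed
  have mono: "?X \<omega> m + real m \<le> ?X \<omega> n + real n" if "m \<le> n" for \<omega> m n
    using that
  proof (induction n rule: dec_induct)
    case (step n)
    then show ?case using \<open>\<bar>?X \<omega> (Suc n) - ?X \<omega> n\<bar> \<le> 1\<close> by simp
  qed simp
  have sq: "(?X \<omega> n + real n - (drift i + 1) * real n)\<^sup>2
      = (real_of_int (endpoint (history \<omega> n) $ i) - drift i * real (length (history \<omega> n)))\<^sup>2" for \<omega> n
    by (simp add: position_after_history algebra_simps)
  have "AE \<omega> in walk_space a mu p l. (\<lambda>n. (?X \<omega> n + real n) / real n) \<longlonglongrightarrow> drift i + 1"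
  proof (rule P.monotone_LLN[where C = "19 * (1 + \<bar>drift i\<bar>)\<^sup>2"])
    show "AE \<omega> in walk_space a mu p l. \<forall>m n. m \<le> n \<longrightarrow> ?X \<omega> m + real m \<le> ?X \<omega> n + real n"
      using mono by simp
    show "AE \<omega> in walk_space a mu p l. \<forall>n. 0 \<le> ?X \<omega> n + real n"
      using mono[of 0] by simp
    fix n
    let ?F = "\<lambda>ys. (real_of_int (endpoint ys $ i) - drift i * real (length ys))\<^sup>2"
    show "integrable (walk_space a mu p l) (\<lambda>\<omega>. (?X \<omega> n + real n - (drift i + 1) * real n)\<^sup>2)"
      unfolding sq by (rule expectation_history(1)[of a l ?F])
    have "(\<integral>\<omega>. (?X \<omega> n + real n - (drift i + 1) * real n)\<^sup>2 \<partial>walk_space a mu p l)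
        = (K ^^ n) (\<lambda>h. (compensated i h)\<^sup>2) []"
      unfolding sq expectation_history(2)[of a l ?F n] by (simp add: compensated_def coord_def)
    also have "\<dots> \<le> 19 * (1 + \<bar>drift i\<bar>)\<^sup>2 * real (Suc n)"
      by (rule K_pow_compensated_square[OF dec])
    finally show "(\<integral>\<omega>. (?X \<omega> n + real n - (drift i + 1) * real n)\<^sup>2 \<partial>walk_space a mu p l)
        \<le> 19 * (1 + \<bar>drift i\<bar>)\<^sup>2 * real (Suc n)" .
  qed
  then show ?thesis
  proof eventually_elim
    case (elim \<omega>)
    have "(\<lambda>n. (?X \<omega> n + real n) / real n - 1) \<longlonglongrightarrow> drift i + 1 - 1"
      by (intro tendsto_diff elim tendsto_const)
    then have "(\<lambda>n. (?X \<omega> n + real n) / real n - 1) \<longlonglongrightarrow> drift i" by simp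
    then show ?case
    proof (rule Lim_transform_eventually)
      show "\<forall>\<^sub>F n in sequentially. (?X \<omega> n + real n) / real n - 1 = ?X \<omega> n / real n"
        using eventually_gt_at_top[of 0] by eventually_elim (simp add: field_simps)
    qed
  qed
qed

lemma AE_walk_clock:
  assumes "AE w in clock_space. P w"
  shows "AE \<omega> in walk_space (a :: 'd::finite) mu p l. P (fst (snd (snd \<omega>)))"
proof -
  let ?G = "refresh_space TYPE('d) mu" and ?B = "state_space TYPE('d) p" and ?D = "direction_space a l"
  interpret D: prob_space ?D by (intro prob_space_PiM prob_space_measure_pmf)
  have G: "prob_space ?G" using mu_pos by (intro prob_space_PiM prob_space_waiting_time)
  have B: "prob_space ?B" by (intro prob_space_PiM prob_space_measure_pmf)
  have CD: "prob_space (clock_space \<Otimes>\<^sub>M ?D)"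
    by (intro prob_space_pair prob_space_clock D.prob_space_axioms)
  have BCD: "prob_space (?B \<Otimes>\<^sub>M clock_space \<Otimes>\<^sub>M ?D)"
    by (intro prob_space_pair B CD)
  have "AE w in distr (clock_space \<Otimes>\<^sub>M ?D) clock_space fst. P w"
    unfolding D.distr_pair_fst by (rule assms)
  then have "AE z in clock_space \<Otimes>\<^sub>M ?D. P (fst z)"
    by (rule AE_distrD[rotated]) simp
  then have "AE z in distr (?B \<Otimes>\<^sub>M clock_space \<Otimes>\<^sub>M ?D) (clock_space \<Otimes>\<^sub>M ?D) snd. P (fst z)"
    unfolding distr_pair_snd[OF B CD] .
  then have "AE z in ?B \<Otimes>\<^sub>M clock_space \<Otimes>\<^sub>M ?D. P (fst (snd z))"
    by (rule AE_distrD[rotated]) simp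
  then have "AE z in distr (?G \<Otimes>\<^sub>M ?B \<Otimes>\<^sub>M clock_space \<Otimes>\<^sub>M ?D) (?B \<Otimes>\<^sub>M clock_space \<Otimes>\<^sub>M ?D) snd. P (fst (snd z))"
    unfolding distr_pair_snd[OF G BCD] .
  then show ?thesis
    unfolding walk_space_def by (rule AE_distrD[rotated]) simp
qed

text \<open>The clock has rate 1, so passing from the number of rings to time does not change the
  limit. The transversal coordinates have drift zero by reflection, which gives the limit the
  required direction.\<close>

lemma has_speed_drift:
  fixes a :: "'d::finite"
  assumes dec: "decay \<le> 1 / 8"
  shows "has_speed a mu p l (ring_walk.drift mu p (direction_weight a l) a)"
proof -
  interpret ring_walk mu p "direction_weight a l"
    by (rule ring_walk_direction_weight) unfold_locales
  have drift: "drift i = (axis a (drift a) :: real ^ 'd) $ i" for i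
  proof (cases "i = a")
    case False
    have "direction_weight a l (flip i u) = direction_weight a l u" for u
      using False by (cases u) (auto simp: direction_weight_def flip_def)
    then show ?thesis using drift_eq_0[of i] False by (simp add: axis_def)
  qed simp
  have "AE \<omega> in walk_space a mu p l. \<forall>i. (\<lambda>n. real_of_int (position_after \<omega> n $ i) / real n) \<longlonglongrightarrow> drift i"
    by (rule eventually_all_finite) (rule AE_position_LLN[OF dec])
  moreover have "AE \<omega> in walk_space a mu p l. filterlim (num_arrivals (fst (snd (snd \<omega>)))) at_top at_top
      \<and> ((\<lambda>t. real (num_arrivals (fst (snd (snd \<omega>))) t) / t) \<longlongrightarrow> 1) at_top"
  proof (rule AE_walk_clock)
    show "AE w in clock_space. filterlim (num_arrivals w) at_top at_top
        \<and> ((\<lambda>t. real (num_arrivals w t) / t) \<longlongrightarrow> 1) at_top"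
      using AE_clock_pos AE_arrival_time_LLN
      by eventually_elim (auto intro!: num_arrivals_asymptotics)
  qed
  ultimately show ?thesis
    unfolding has_speed_def
  proof eventually_elim
    case (elim \<omega>)
    let ?N = "num_arrivals (fst (snd (snd \<omega>)))"
    have walker: "walker \<omega> t = position_after \<omega> (?N t)" for t
      by (cases \<omega>) (simp add: walker_def)
    show ?case
    proof (rule vec_tendstoI)
      fix i
      let ?X = "\<lambda>n. real_of_int (position_after \<omega> n $ i)"
      have "((\<lambda>t. ?X (?N t) / real (?N t) * (real (?N t) / t)) \<longlongrightarrow> drift i * 1) at_top"
        using elim by (intro tendsto_mult filterlim_compose[of "\<lambda>n. ?X n / real n" _ at_top ?N]) auto
      then have "((\<lambda>t. ?X (?N t) / real (?N t) * (real (?N t) / t)) \<longlongrightarrow> axis a (drift a) $ i) at_top"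
        by (simp add: drift[of i])
      then show "((\<lambda>t. ((1 / t) *\<^sub>R (\<chi> i. real_of_int (walker \<omega> t $ i))) $ i) \<longlongrightarrow> axis a (drift a) $ i) at_top"
      proof (rule Lim_transform_eventually)
        have "\<forall>\<^sub>F t in at_top. ?N t > 0"
          using elim eventually_gt_at_top[of "0 :: nat"] by (auto simp: filterlim_iff)
        then show "\<forall>\<^sub>F t in at_top. ?X (?N t) / real (?N t) * (real (?N t) / t)
            = ((1 / t) *\<^sub>R (\<chi> i. real_of_int (walker \<omega> t $ i))) $ i"
          by eventually_elim (simp add: walker)
      qed
    qed
  qed
qed

end

section \<open>Monotonicity\<close>

text \<open>The weight of \<open>+ e_1\<close> is the only one that increases with the bias.\<close>

lemma direction_weight_total_variation:
  fixes a :: "'d::finite"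
  assumes l: "0 < l" "l < l'"
  defines "W \<equiv> direction_weight a l" and "W' \<equiv> direction_weight a l'"
  shows "W (a, True) - W (a, False) < W' (a, True) - W' (a, False)"
    and "(\<Sum>u\<in>UNIV. \<bar>W' u - W u\<bar>)
      \<le> 2 * ((W' (a, True) - W' (a, False)) - (W (a, True) - W (a, False)))"
proof -
  let ?Z = "bias_normalizer TYPE('d)"
  have Z_pos: "?Z l > 0" "?Z l' > 0" by (rule bias_normalizer_pos)+
  have Z: "?Z l \<le> ?Z l'"
  proof -
    have "1 < exp l" "exp l < exp l'" using l by auto
    moreover have "1 \<le> exp l * exp l'" using l by (simp flip: exp_add)
    \<comment> \<open>This product is the difference of \<open>exp x + exp (- x)\<close> at
      \<open>l'\<close> and \<open>l\<close>.\<close>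
    ultimately have "0 \<le> (exp l' - exp l) * (1 - 1 / (exp l * exp l'))"
      by (intro mult_nonneg_nonneg) auto
    also have "\<dots> = exp l' + exp (- l') - (exp l + exp (- l))"
      by (simp add: exp_minus field_simps)
    finally show ?thesis by (simp add: bias_normalizer_def)
  qed
  have le: "W' u \<le> W u" if "u \<noteq> (a, True)" for u
    unfolding W_def W'_def direction_weight_def using that Z Z_pos l
    by (auto intro!: frac_le)
  have less: "W' (a, False) < W (a, False)"
    unfolding W_def W'_def direction_weight_def using Z Z_pos l
    by (auto intro!: frac_less)
  have split: "sum f UNIV = f (a, True) + sum f (UNIV - {(a, True)})" for f :: "'d \<times> bool \<Rightarrow> real"
    by (rule sum.remove) auto
  have sums: "sum W UNIV = 1" "sum W' UNIV = 1"
    unfolding W_def W'_def by (rule sum_direction_weight)+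
  have rest: "W' (a, True) - W (a, True) = (\<Sum>u\<in>UNIV - {(a, True)}. W u - W' u)"
    using sums unfolding split[of W] split[of W'] by (simp add: sum_subtractf)
  have "W (a, False) - W' (a, False) \<le> (\<Sum>u\<in>UNIV - {(a, True)}. W u - W' u)"
    by (rule member_le_sum) (auto simp: le)
  then have up: "W' (a, True) - W (a, True) > 0" using less rest by linarith
  then show "W (a, True) - W (a, False) < W' (a, True) - W' (a, False)" using less by linarith
  have "(\<Sum>u\<in>UNIV. \<bar>W' u - W u\<bar>) = \<bar>W' (a, True) - W (a, True)\<bar> + (\<Sum>u\<in>UNIV - {(a, True)}. \<bar>W' u - W u\<bar>)"
    by (rule split)
  also have "(\<Sum>u\<in>UNIV - {(a, True)}. \<bar>W' u - W u\<bar>) = (\<Sum>u\<in>UNIV - {(a, True)}. W u - W' u)"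
  proof (rule sum.cong[OF refl])
    fix u assume "u \<in> UNIV - {(a, True)}"
    then show "\<bar>W' u - W u\<bar> = W u - W' u" using le[of u] by simp
  qed
  also have "\<bar>W' (a, True) - W (a, True)\<bar> = W' (a, True) - W (a, True)"
    using up by (rule abs_of_pos)
  \<comment> \<open>The weights sum to one, so the l1 distance is twice the gain of
    \<open>(a, True)\<close>; the mean increases at least by this gain because
    \<open>(a, False)\<close> loses weight.\<close>
  finally have "(\<Sum>u\<in>UNIV. \<bar>W' u - W u\<bar>) = 2 * (W' (a, True) - W (a, True))"
    unfolding rest[symmetric] by simp
  then show "(\<Sum>u\<in>UNIV. \<bar>W' u - W u\<bar>)
      \<le> 2 * ((W' (a, True) - W' (a, False)) - (W (a, True) - W (a, False)))"
    using less by simp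
qed

theorem proposition5p1:
  fixes a :: "'d::finite" and p :: real
  assumes "CARD('d) \<ge> 2" and "0 < p" and "p < 1"
  shows "\<exists>mu0>0. \<forall>mu>mu0. strict_mono_on {0<..} (\<lambda>l. speed a mu p l)"
proof (intro exI[of _ "64 / p"] conjI allI impI)
  show "64 / p > 0" using assms by simp
  fix mu assume mu: "mu > 64 / p"
  \<comment> \<open>The witness is the threshold of \<open>ring_params_drift_less\<close>; as
    \<open>p < 1\<close>, it also gives the bound on \<open>decay\<close> required for the existence
    of the speed.\<close>
  have "64 < 64 / p" using assms by (simp add: field_simps)
  then have mu64: "mu > 64" using mu by linarith
  interpret ring_params mu p by standard (use assms mu64 in auto)
  have dec: "decay \<le> 1 / 8" using mu64 by (simp add: decay_def field_simps)
  have speed: "speed a mu p l = ring_walk.drift mu p (direction_weight a l) a" for l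
    by (rule speed_eqI[OF mu_pos has_speed_drift[OF dec]])
  show "strict_mono_on {0<..} (\<lambda>l. speed a mu p l)"
  proof (rule strict_mono_onI)
    fix l l' :: real
    assume "l \<in> {0<..}" "l' \<in> {0<..}" "l < l'"
    then show "speed a mu p l < speed a mu p l'"
      unfolding speed using mu direction_weight_total_variation[of l l' a]
      by (intro ring_params_drift_less ring_walk_direction_weight ring_params_axioms) auto
  qed
qed

end
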